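(* Assume that $c'(0)$ exists, in the sense that $\theta\mapsto c_{(1+\theta)\Omega}$ is differentiable at $\theta=0$ with derivative $c'(0)$. Then the function $\mathcal{C}:\mathbb{R}\to\mathbb{R}$, $\mathcal{C}(\gamma)=u^\gamma(\cdot)-u^0(\cdot)$, is differentiable at $0$ with $\mathcal{C}'(0)=-c'(0)$, and $\mathcal{C}(\gamma)=-\gamma c'(0)$ for all $\gamma\in\mathbb{R}$. In other words, $u^\gamma(\cdot)=u^0(\cdot)-\gamma c'(0)$ for all $\gamma\in\mathbb{R}$.
   Context: Standing assumptions. $\varepsilon>0$ is fixed, $p>2$, $U\subset\mathbb{R}^n$ is open and bounded with smooth boundary, $f\in C^1(\overline U)$, and $H(x,\xi)=|\xi|^p-f(x)$. $\Omega\subset\mathbb{R}^n$ is open, bounded, connected, with $C^2$ boundary, $\overline\Omega\subset U$, star-shaped with respect to the origin, and there is $\kappa>0$ such that $\overline{B(0,\kappa)}\subset\Omega$ and $\mathrm{dist}(x,\overline\Omega)\ge\kappa s$ for all $x\in(1+s)\partial\Omega$ and all $s>0$. Viscosity solutions. For an open set $\mathcal{O}$ and $\delta\ge0$, $c\in\mathbb R$, $w$ satisfies $\delta w+H(x,Dw)-\varepsilon\Delta w\le c$ in $\mathcal{O}$ if for every $x\in\mathcal{O}$ and $\varphi\in C^2(\mathcal{O})$ such that $w-\varphi$ has a local maximum at $x$, $\delta w(x)+H(x,D\varphi(x))-\varepsilon\Delta\varphi(x)\le c$. It satisfies $\ge c$ on $\overline{\mathcal{O}}$ if for every $x\in\overline{\mathcal{O}}$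 and $\varphi\in C^2(\overline{\mathcal{O}})$ such that $w-\varphi$ has a local minimum over $\overline{\mathcal{O}}$ at $x$, $\delta w(x)+H(x,D\varphi(x))-\varepsilon\Delta\varphi(x)\ge c$. A state-constraint solution satisfies both. Additive eigenvalue. $c_{\mathcal{O}}=\min\{c\in\mathbb{R}: H(x,Du)-\varepsilon\Delta u\le c\text{ in }\mathcal{O}\text{ has a (continuous viscosity) solution}\}$. The functions $u^\gamma$ and $\mathcal{C}$. For $\gamma\in\mathbb{R}$ and small $\lambda>0$ put $\Omega_\lambda=(1+\gamma\lambda)\Omega$ and let $u_\lambda\in C(\overline\Omega_\lambda)$ be the unique state-constraint solution of $\lambda u_\lambda+H(x,Du_\lambda)-\varepsilon\Delta u_\lambda=0$ on $\Omega_\lambda$ (i.e. $\le0$ in $\Omega_\lambda$, $\ge0$ on $\overline\Omega_\lambda$). Then $u^\gamma\in C(\overline\Omega)$ denotes the limit of $u_\lambda+\lambda^{-1}c_\Omega$ as $\lambda\to0^+$ (uniform where $u_\lambda$ is defined in $\overline\Omega$); this limit exists and is a state-constraint solution of the ergodic problem $H(x,Dw)-\varepsilon\Delta w\le c_\Omega$ in $\Omega$, $\ge c_\Omega$ on $\overline\Omega$. Solutions of this ergodic problem are unique up to additive constants, so $u^\gamma-u^0$ is a constant, denoted $\mathcal{C}(\gamma)$. *)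

theory Defs
  imports "HOL-Analysis.Analysis"
begin

text \<open>A function of class C^k on the whole space: once differentiable, with every directional
  derivative again of class C^(k-1).\<close>

primrec C_k :: "nat \<Rightarrow> (real ^ 'n \<Rightarrow> real) \<Rightarrow> bool" where
  "C_k 0 g \<longleftrightarrow> continuous_on UNIV g"
| "C_k (Suc k) g \<longleftrightarrow>
     (\<forall>x. g differentiable (at x)) \<and> (\<forall>v. C_k k (\<lambda>x. frechet_derivative g (at x) v))"

text \<open>Near each boundary point the set is, in a suitable orthonormal coordinate system, the region
  above the graph of a function of the remaining \<open>n - 1\<close> coordinates.  The last coordinate axis
  is \<open>\<nu>\<close>; a function on the hyperplane orthogonal to \<open>\<nu>\<close> is represented by a function on the
  whole space that is invariant under translations along \<open>\<nu>\<close>.\<close>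

definition graph_boundary :: "((real ^ 'n \<Rightarrow> real) \<Rightarrow> bool) \<Rightarrow> (real ^ 'n) set \<Rightarrow> bool" where
  "graph_boundary P S \<longleftrightarrow>
     (\<forall>x\<in>frontier S. \<exists>r>0. \<exists>\<nu> g. norm \<nu> = 1 \<and> P g \<and>
        (\<forall>y t. g (y + t *\<^sub>R \<nu>) = g y) \<and>
        S \<inter> ball x r = {y \<in> ball x r. y \<bullet> \<nu> > g y})"

definition C2_boundary :: "(real ^ 'n) set \<Rightarrow> bool" where
  "C2_boundary S \<longleftrightarrow> graph_boundary (C_k 2) S"

definition smooth_boundary :: "(real ^ 'n) set \<Rightarrow> bool" where
  "smooth_boundary S \<longleftrightarrow> graph_boundary (\<lambda>g. \<forall>k. C_k k g) S"

text \<open>For an open set \<open>A\<close>, a function belongs to C^1 of the closure of \<open>A\<close> if it is C^1 in \<open>A\<close>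
  and, together with its gradient, extends continuously to the closure.\<close>

definition C1_closure :: "(real ^ 'n) set \<Rightarrow> (real ^ 'n \<Rightarrow> real) \<Rightarrow> bool" where
  "C1_closure A f \<longleftrightarrow>
     continuous_on (closure A) f \<and>
     (\<exists>G. continuous_on (closure A) G \<and>
        (\<forall>x\<in>A. (f has_derivative (\<lambda>h. G x \<bullet> h)) (at x)))"

text \<open>For \<open>A\<close> open, \<open>\<phi>\<close> is C^2 on \<open>A\<close> (case \<open>S = A\<close>) or on the closure of \<open>A\<close>
  (case \<open>S = closure A\<close>, same convention as above), with gradient \<open>G\<close> and Hessian \<open>M\<close>.
  On \<open>S\<close> both are determined by \<open>\<phi>\<close>: at boundary points they are the continuous extensions.\<close>

definition C2_jet ::
  "(real ^ 'n) set \<Rightarrow> (real ^ 'n) set \<Rightarrow> (real ^ 'n \<Rightarrow> real) \<Rightarrow> (real ^ 'n \<Rightarrow> real ^ 'n)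
     \<Rightarrow> (real ^ 'n \<Rightarrow> real ^ 'n ^ 'n) \<Rightarrow> bool" where
  "C2_jet A S \<phi> G M \<longleftrightarrow>
     continuous_on S \<phi> \<and> continuous_on S G \<and> continuous_on S M \<and>
     (\<forall>x\<in>A. (\<phi> has_derivative (\<lambda>h. G x \<bullet> h)) (at x) \<and>
             (G has_derivative (\<lambda>h. M x *v h)) (at x))"

definition local_max_on :: "(real ^ 'n \<Rightarrow> real) \<Rightarrow> (real ^ 'n) set \<Rightarrow> real ^ 'n \<Rightarrow> bool" where
  "local_max_on g S x \<longleftrightarrow> x \<in> S \<and> (\<forall>\<^sub>F y in at x within S. g y \<le> g x)"

definition local_min_on :: "(real ^ 'n \<Rightarrow> real) \<Rightarrow> (real ^ 'n) set \<Rightarrow> real ^ 'n \<Rightarrow> bool" where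
  "local_min_on g S x \<longleftrightarrow> x \<in> S \<and> (\<forall>\<^sub>F y in at x within S. g x \<le> g y)"

text \<open>\<open>\<delta> w + H(x, Dw) - \<epsilon> \<Delta>w \<le> c\<close> in the open set \<open>A\<close>; the Laplacian of a test function
  is the trace of its Hessian.\<close>

definition viscosity_subsolution ::
  "real \<Rightarrow> (real ^ 'n \<Rightarrow> real ^ 'n \<Rightarrow> real) \<Rightarrow> real \<Rightarrow> real
     \<Rightarrow> (real ^ 'n) set \<Rightarrow> (real ^ 'n \<Rightarrow> real) \<Rightarrow> bool" where
  "viscosity_subsolution \<epsilon> H \<delta> c A w \<longleftrightarrow>
     (\<forall>x\<in>A. \<forall>\<phi> G M. C2_jet A A \<phi> G M \<longrightarrow> local_max_on (\<lambda>y. w y - \<phi> y) A x \<longrightarrow>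
        \<delta> * w x + H x (G x) - \<epsilon> * trace (M x) \<le> c)"

text \<open>\<open>\<delta> w + H(x, Dw) - \<epsilon> \<Delta>w \<ge> c\<close> on the closure of \<open>A\<close>, boundary points included.\<close>

definition viscosity_supersolution_closure ::
  "real \<Rightarrow> (real ^ 'n \<Rightarrow> real ^ 'n \<Rightarrow> real) \<Rightarrow> real \<Rightarrow> real
     \<Rightarrow> (real ^ 'n) set \<Rightarrow> (real ^ 'n \<Rightarrow> real) \<Rightarrow> bool" where
  "viscosity_supersolution_closure \<epsilon> H \<delta> c A w \<longleftrightarrow>
     (\<forall>x\<in>closure A. \<forall>\<phi> G M. C2_jet A (closure A) \<phi> G M \<longrightarrow>
        local_min_on (\<lambda>y. w y - \<phi> y) (closure A) x \<longrightarrow>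
        \<delta> * w x + H x (G x) - \<epsilon> * trace (M x) \<ge> c)"

definition state_constraint_solution ::
  "real \<Rightarrow> (real ^ 'n \<Rightarrow> real ^ 'n \<Rightarrow> real) \<Rightarrow> real \<Rightarrow> real
     \<Rightarrow> (real ^ 'n) set \<Rightarrow> (real ^ 'n \<Rightarrow> real) \<Rightarrow> bool" where
  "state_constraint_solution \<epsilon> H \<delta> c A w \<longleftrightarrow>
     continuous_on (closure A) w \<and>
     viscosity_subsolution \<epsilon> H \<delta> c A w \<and>
     viscosity_supersolution_closure \<epsilon> H \<delta> c A w"

definition additive_eigenvalue ::
  "real \<Rightarrow> (real ^ 'n \<Rightarrow> real ^ 'n \<Rightarrow> real) \<Rightarrow> (real ^ 'n) set \<Rightarrow> real" where
  "additive_eigenvalue \<epsilon> H A =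
     (LEAST c. \<exists>w. continuous_on A w \<and> viscosity_subsolution \<epsilon> H 0 c A w)"

definition hamiltonian ::
  "real \<Rightarrow> (real ^ 'n \<Rightarrow> real) \<Rightarrow> real ^ 'n \<Rightarrow> real ^ 'n \<Rightarrow> real" where
  "hamiltonian p f x \<xi> = norm \<xi> powr p - f x"

definition dilate :: "real \<Rightarrow> (real ^ 'n) set \<Rightarrow> (real ^ 'n) set" where
  "dilate r S = (\<lambda>x. r *\<^sub>R x) ` S"

end

theory Submission
  imports Defs
begin

text \<open>Write \<open>F w = |Dw|^p - \<epsilon> \<Delta>w\<close>, \<open>\<Omega>_\<theta> = (1 + \<theta>) \<Omega>\<close> and \<open>c(\<theta>)\<close> for the additive eigenvalue of \<open>\<Omega>_\<theta>\<close>.  Everything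
follows from the one-sided inequality
  \<open>C(a) - b c' \<le> C(a + b)\<close> for all real \<open>a\<close> and \<open>b\<close>   (lemma \<open>superadditivity\<close>):
applied to \<open>(0, \<gamma>)\<close> and to \<open>(\<gamma>, -\<gamma>)\<close> it gives \<open>C(\<gamma>) = C(0) - \<gamma> c'\<close>, and \<open>C(0) = 0\<close>.

The inequality expresses the convexity of \<open>F\<close>.  Put \<open>t = a + b\<close> and let \<open>\<lambda>\<close> be small.  On
\<open>\<Omega>_(2a\<lambda>)\<close> take the solution with discount \<open>2\<lambda>\<close>; it satisfies
\<open>F w = f + c(0) - 2\<lambda> u^a + o(\<lambda>)\<close>.  On \<open>\<Omega>_(2b\<lambda>)\<close> take an ergodic subsolution; it satisfies
\<open>F w \<le> f + c(2b\<lambda>) = f + c(0) + 2b\<lambda> c' + o(\<lambda>)\<close>.  The transformation \<open>w \<mapsto> r^\<alpha> w(x / r)\<close> with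
\<open>\<alpha> = (p - 2) / (p - 1)\<close> multiplies \<open>|Dw|^p\<close> and \<open>\<Delta>w\<close> by the same power of \<open>r\<close>, so both functions can
be carried to a domain slightly larger than \<open>\<Omega>_(t\<lambda>)\<close> at the price of first-order changes of the
right-hand side.  These changes are opposite to each other because \<open>2a + 2b = 2t\<close>.  The mean of
the two functions is therefore a subsolution with right-hand side
\<open>f + c(0) + \<lambda> (b c' - u^a) + o(\<lambda>)\<close>, whereas the solution on \<open>\<Omega>_(t\<lambda>)\<close> with discount \<open>\<lambda>\<close> is a
supersolution, up to the boundary, with right-hand side \<open>f + c(0) - \<lambda> u^t + o(\<lambda>)\<close>.  At a point
where the difference of the two is minimal the right-hand sides are ordered, and division by \<open>\<lambda>\<close>
gives \<open>u^a - b c' \<le> u^t\<close> at a limit point.  Only the right-hand sides enter, never the values of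
the mean.

Three facts support this argument.

Viscosity subsolutions can be replaced by smooth ones on compact subsets (lemma
\<open>smooth_subsolution_exists\<close>), so that means of subsolutions are harmless and the comparison is a
direct application of the definition of a supersolution (lemma \<open>supersolution_test\<close>).  Since
\<open>|\<xi>|^p\<close> is the supremum of its tangents, a subsolution satisfies a family of linear inequalities
with constant coefficients, and those survive mollification.  For a viscosity subsolution this
last statement is proved by comparison with a random walk that approximates the semigroup of
the linear operator (lemmas \<open>walk_domination\<close> and \<open>mollification_drift\<close>).

Along rays, subsolutions are Hoelder continuous up to the boundary, with a constant that depends
on the function only through a bound for its right-hand side (lemma \<open>boundary_modulus\<close>).  This is where \<open>p > 2\<close> enters: there
is an explicit barrier in a ball that is infinite on the sphere and behaves like \<open>|x|^\<alpha>\<close> at the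
centre.  It extends the convergence of the discounted solutions from \<open>\<Omega>\<close> to the dilated domains.

The minimum in the definition of the additive eigenvalue is attained near \<open>\<theta> = 0\<close> (lemmas
\<open>additive_eigenvalue_attained\<close> and \<open>eigenfunction_exists\<close>), because the Hoelder estimate makes
subsolutions equicontinuous and upper limits of subsolutions are subsolutions.\<close>

section \<open>Viscosity subsolutions with a variable right-hand side\<close>

text \<open>The right-hand side is a function: it absorbs the potential, the constant and the zeroth-order
term, so that discounted and ergodic inequalities take the same form.\<close>

definition visc_le ::
  "real \<Rightarrow> real \<Rightarrow> (real ^ 'n \<Rightarrow> real) \<Rightarrow> (real ^ 'n) set \<Rightarrow> (real ^ 'n \<Rightarrow> real) \<Rightarrow> bool" where
  "visc_le \<epsilon> p h A w \<longleftrightarrow>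
     (\<forall>x\<in>A. \<forall>\<phi> G M. C2_jet A A \<phi> G M \<longrightarrow> local_max_on (\<lambda>y. w y - \<phi> y) A x \<longrightarrow>
        norm (G x) powr p - \<epsilon> * trace (M x) \<le> h x)"

lemma viscosity_subsolution_iff_visc_le:
  "viscosity_subsolution \<epsilon> (hamiltonian p f) \<delta> c A w \<longleftrightarrow>
     visc_le \<epsilon> p (\<lambda>x. f x + c - \<delta> * w x) A w"
proof -
  have *: "\<delta> * w x + hamiltonian p f x g - \<epsilon> * t \<le> c \<longleftrightarrow>
      norm g powr p - \<epsilon> * t \<le> f x + c - \<delta> * w x" for x g t
    by (auto simp: hamiltonian_def)
  show ?thesis
    unfolding viscosity_subsolution_def visc_le_def * ..
qed

lemma visc_le_mono:
  assumes "visc_le \<epsilon> p h A w" "\<And>x. x \<in> A \<Longrightarrow> h x \<le> h' x"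
  shows "visc_le \<epsilon> p h' A w"
  unfolding visc_le_def
proof (intro ballI allI impI)
  fix x \<phi> G M
  assume x: "x \<in> A" and "C2_jet A A \<phi> G M" "local_max_on (\<lambda>y. w y - \<phi> y) A x"
  then have "norm (G x) powr p - \<epsilon> * trace (M x) \<le> h x"
    using assms(1) unfolding visc_le_def by blast
  then show "norm (G x) powr p - \<epsilon> * trace (M x) \<le> h' x"
    using assms(2)[OF x] by linarith
qed

text \<open>A test function matters only near the point of contact, and its gradient has to be
differentiable only there.\<close>

definition jet_at ::
  "(real ^ 'n \<Rightarrow> real) \<Rightarrow> (real ^ 'n \<Rightarrow> real ^ 'n) \<Rightarrow> real ^ 'n ^ 'n \<Rightarrow> real ^ 'n \<Rightarrow> bool" where
  "jet_at \<phi> G M x \<longleftrightarrow>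
     (\<forall>\<^sub>F y in nhds x. (\<phi> has_derivative (\<lambda>h. G y \<bullet> h)) (at y)) \<and>
     (G has_derivative (\<lambda>h. M *v h)) (at x)"

lemma trace_transpose: "trace (transpose M) = trace (M :: real ^ 'n ^ 'n)"
  by (simp add: trace_def transpose_def)

lemma trace_mat_1: "trace (mat 1 :: real ^ 'n ^ 'n) = real CARD('n)"
  by (simp add: trace_def mat_def)

lemma trace_scaleR: "trace (c *\<^sub>R M) = c * trace (M :: real ^ 'n ^ 'n)"
  by (simp add: trace_def sum_distrib_left)

lemma continuous_on_trace [continuous_intros]:
  assumes "continuous_on S M"
  shows "continuous_on S (\<lambda>x. trace (M x :: real ^ 'n ^ 'n))"
  unfolding trace_def by (intro continuous_intros assms)

lemma local_max_on_open_iff: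
  assumes "open A" "x \<in> A"
  shows "local_max_on g A x \<longleftrightarrow> (\<forall>\<^sub>F y in nhds x. g y \<le> g x)"
proof -
  have "local_max_on g A x \<longleftrightarrow> (\<forall>\<^sub>F y in nhds x. y \<noteq> x \<longrightarrow> g y \<le> g x)"
    by (simp add: local_max_on_def at_within_open[OF assms(2,1)] eventually_at_filter assms)
  also have "\<dots> \<longleftrightarrow> (\<forall>\<^sub>F y in nhds x. g y \<le> g x)"
    by (intro arg_cong2[where f = eventually] ext) auto
  finally show ?thesis .
qed

text \<open>The test functions in the definition are global.  A local one is replaced by its second-order
Taylor polynomial with \<open>\<eta> |y - x|^2 / 2\<close> added, which still touches from above; \<open>\<eta>\<close> then tends
to 0.  The polynomial uses the symmetric part of \<open>M\<close>, which has the same quadratic form and the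
same trace as \<open>M\<close>.\<close>

lemma visc_le_jet_at:
  fixes w :: "real ^ 'n \<Rightarrow> real"
  assumes sub: "visc_le \<epsilon> p h A w" and "open A" "x \<in> A" and "jet_at \<phi> G M x"
    and max: "\<forall>\<^sub>F y in nhds x. w y - \<phi> y \<le> w x - \<phi> x" and eps: "\<epsilon> \<ge> 0"
  shows "norm (G x) powr p - \<epsilon> * trace M \<le> h x"
proof -
  have d1: "\<forall>\<^sub>F y in nhds x. (\<phi> has_derivative (\<lambda>h. G y \<bullet> h)) (at y)"
    and d2: "(G has_derivative (\<lambda>h. M *v h)) (at x)"
    using assms(4) by (auto simp: jet_at_def)
  have key: "norm (G x) powr p - \<epsilon> * trace M \<le> h x + \<eta> * (\<epsilon> * real CARD('n))" if "\<eta> > 0" for \<eta>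
  proof -
    define S where "S = (1/2) *\<^sub>R (M + transpose M) + \<eta> *\<^sub>R mat 1"
    define P where "P = (\<lambda>y. G x \<bullet> (y - x) + (1/2) * ((y - x) \<bullet> (M *v (y - x))) + \<eta> / 2 * ((y - x) \<bullet> (y - x)))"
    define GP where "GP = (\<lambda>y. G x + S *v (y - x))"
    have Sv: "S *v v = (1/2) *\<^sub>R (M *v v + transpose M *v v) + \<eta> *\<^sub>R v" for v
      by (simp add: S_def matrix_vector_mult_add_rdistrib flip: scaleR_matrix_vector_assoc)
    have tr: "(transpose M *v a) \<bullet> b = a \<bullet> (M *v b)" for a b
      by (metis dot_lmul_matrix vector_transpose_matrix transpose_transpose)
    have tr2: "a \<bullet> (b v* M) = b \<bullet> (M *v a)" for a b
      by (metis dot_lmul_matrix inner_commute)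
    have dyx: "((\<lambda>y. y - x) has_derivative (\<lambda>h. h)) (at y)" for y
      by (auto intro!: derivative_eq_intros)
    have dM: "((\<lambda>y. N *v (y - x)) has_derivative (\<lambda>h. N *v h)) (at y)" for y and N :: "real ^ 'n ^ 'n"
      by (rule bounded_linear.has_derivative[OF matrix_vector_mul_bounded_linear dyx])
    have dP: "(P has_derivative (\<lambda>h. GP y \<bullet> h)) (at y)" for y
    proof -
      have eq: "G x \<bullet> h + (1/2) * (v \<bullet> (M *v h) + h \<bullet> (M *v v)) + \<eta> / 2 * (v \<bullet> h + h \<bullet> v) =
          (G x + S *v v) \<bullet> h" for v h
        by (simp add: Sv inner_add_left inner_add_right tr tr2 dot_lmul_matrix inner_commute[of h] field_simps)
      show ?thesis
        unfolding P_def GP_def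
        by (rule has_derivative_eq_rhs, (rule has_derivative_add has_derivative_mult_right
              has_derivative_inner_right has_derivative_inner dM dyx)+) (simp only: eq)
    qed
    have dGP: "(GP has_derivative (\<lambda>h. S *v h)) (at y)" for y
      unfolding GP_def using has_derivative_add[OF has_derivative_const dM] by simp
    have jet: "C2_jet A A P GP (\<lambda>_. S)"
      unfolding C2_jet_def
      by (intro conjI ballI dP dGP continuous_on_const
          has_derivative_continuous_on[OF has_derivative_at_withinI[OF dP]]
          has_derivative_continuous_on[OF has_derivative_at_withinI[OF dGP]])
    obtain r1 where r1: "r1 > 0" "\<And>y. dist y x < r1 \<Longrightarrow> (\<phi> has_derivative (\<lambda>h. G y \<bullet> h)) (at y)"
      using d1 unfolding eventually_nhds_metric by blast
    obtain r2 where r2: "r2 > 0"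
      "\<And>y. norm (y - x) < r2 \<Longrightarrow> norm (G y - G x - M *v (y - x)) \<le> \<eta> * norm (y - x)"
      using d2 \<open>\<eta> > 0\<close> unfolding has_derivative_at_alt by blast
    have cmp: "\<phi> y - P y \<le> \<phi> x - P x" if y: "dist y x < min r1 r2" for y
    proof -
      define v where "v = y - x"
      define k where "k = (\<lambda>s. \<phi> (x + s *\<^sub>R v) - P (x + s *\<^sub>R v))"
      define k' where "k' = (\<lambda>s. (G (x + s *\<^sub>R v) - GP (x + s *\<^sub>R v)) \<bullet> v)"
      have nv: "norm v < r1" "norm v < r2" using y by (auto simp: v_def dist_norm)
      have small: "norm (s *\<^sub>R v) \<le> norm v" if "0 \<le> s" "s \<le> 1" for s
        using that by (simp add: mult_left_le_one_le)
      have dk: "(k has_real_derivative k' s) (at s)" if s: "0 \<le> s" "s \<le> 1" for s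
      proof -
        have "(\<phi> has_derivative (\<lambda>h. G (x + s *\<^sub>R v) \<bullet> h)) (at (x + s *\<^sub>R v))"
          using small[OF s] nv by (intro r1) (auto simp: dist_norm)
        from has_derivative_diff[OF this dP]
        have D: "((\<lambda>z. \<phi> z - P z) has_derivative (\<lambda>h. (G (x + s *\<^sub>R v) - GP (x + s *\<^sub>R v)) \<bullet> h)) (at (x + s *\<^sub>R v))"
          by (simp add: inner_diff_left)
        have "((\<lambda>s. x + s *\<^sub>R v) has_derivative (\<lambda>h. h *\<^sub>R v)) (at s)"
          by (auto intro!: derivative_eq_intros)
        from has_derivative_compose[OF this D]
        show ?thesis unfolding k_def k'_def
          by (rule has_derivative_imp_has_field_derivative) simp
      qed
      \<comment> \<open>Along the ray the slope is nonpositive: the term with \<eta> absorbs the error of the expansion.\<close>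
      obtain s where s: "0 < s" "s < 1" "k 1 - k 0 = (1 - 0) * k' s"
        using MVT2[of 0 1 k k'] dk by auto
      have "k' s = (G (x + s *\<^sub>R v) - G x - M *v (s *\<^sub>R v)) \<bullet> v - \<eta> * s * (v \<bullet> v)"
        by (simp add: k'_def GP_def Sv inner_simps tr dot_lmul_matrix inner_commute[of "M *v v" v]
            matrix_vector_mult_scaleR algebra_simps)
      also have "\<dots> \<le> norm (G (x + s *\<^sub>R v) - G x - M *v (s *\<^sub>R v)) * norm v - \<eta> * s * (v \<bullet> v)"
        by (simp add: norm_cauchy_schwarz)
      also have "\<dots> \<le> \<eta> * norm (s *\<^sub>R v) * norm v - \<eta> * s * (v \<bullet> v)"
        using r2(2)[of "x + s *\<^sub>R v"] small[of s] nv s by (auto intro!: mult_right_mono)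
      also have "\<dots> = 0" using s by (simp add: dot_square_norm power2_eq_square)
      finally have "k 1 \<le> k 0" using s(3) by simp
      then show ?thesis by (simp add: k_def v_def)
    qed
    have "\<forall>\<^sub>F y in nhds x. w y - P y \<le> w x - P x"
    proof -
      have "\<forall>\<^sub>F y in nhds x. dist y x < min r1 r2"
        using r1(1) r2(1) unfolding eventually_nhds_metric by (intro exI[of _ "min r1 r2"]) simp
      then show ?thesis using max by eventually_elim (use cmp in fastforce)
    qed
    then have "local_max_on (\<lambda>y. w y - P y) A x"
      by (rule iffD2[OF local_max_on_open_iff[OF \<open>open A\<close> \<open>x \<in> A\<close>]])
    then have "norm (GP x) powr p - \<epsilon> * trace S \<le> h x"
      using sub jet \<open>x \<in> A\<close> unfolding visc_le_def by blast
    moreover have "GP x = G x" by (simp add: GP_def)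
    moreover have "trace S = trace M + \<eta> * real CARD('n)"
      by (simp add: S_def trace_add trace_scaleR trace_transpose trace_mat_1)
    ultimately show ?thesis by (simp add: algebra_simps)
  qed
  have lim: "((\<lambda>\<eta>. h x + \<eta> * (\<epsilon> * real CARD('n))) \<longlongrightarrow> h x + 0 * (\<epsilon> * real CARD('n))) (at_right 0)"
    by (intro tendsto_intros)
  have "\<forall>\<^sub>F \<eta> in at_right 0. norm (G x) powr p - \<epsilon> * trace M \<le> h x + \<eta> * (\<epsilon> * real CARD('n))"
    by (rule eventually_mono[OF eventually_at_right_less[of "0::real"] key])
  from tendsto_lowerbound[OF lim this] show ?thesis by simp
qed

lemma visc_le_subset:
  assumes "visc_le \<epsilon> p h A w" "open A" "open B" "B \<subseteq> A" "\<epsilon> \<ge> 0"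
  shows "visc_le \<epsilon> p h B w"
  unfolding visc_le_def
proof (intro ballI allI impI)
  fix x \<phi> G M
  assume x: "x \<in> B" and j: "C2_jet B B \<phi> G M" and m: "local_max_on (\<lambda>y. w y - \<phi> y) B x"
  have ev: "\<forall>\<^sub>F y in nhds x. y \<in> B" using x \<open>open B\<close> by (simp add: eventually_nhds_in_open)
  have "jet_at \<phi> G (M x) x"
    unfolding jet_at_def
  proof
    show "\<forall>\<^sub>F y in nhds x. (\<phi> has_derivative (\<lambda>h. G y \<bullet> h)) (at y)"
      using ev by eventually_elim (use j in \<open>simp add: C2_jet_def\<close>)
    show "(G has_derivative (\<lambda>h. M x *v h)) (at x)"
      using j x by (simp add: C2_jet_def)
  qed
  moreover have "\<forall>\<^sub>F y in nhds x. w y - \<phi> y \<le> w x - \<phi> x"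
    by (rule iffD1[OF local_max_on_open_iff[OF \<open>open B\<close> x] m])
  ultimately show "norm (G x) powr p - \<epsilon> * trace (M x) \<le> h x"
    using visc_le_jet_at[OF assms(1,2) subsetD[OF \<open>B \<subseteq> A\<close> x] _ _ \<open>\<epsilon> \<ge> 0\<close>] by simp
qed

text \<open>The exponent \<open>\<alpha>\<close> solves \<open>(1 - \<alpha>) p = 2 - \<alpha>\<close>: the \<open>p\<close>-th power of the gradient and the Laplacian
pick up the same factor \<open>r^(\<alpha> - 2)\<close>.\<close>

lemma visc_le_scale:
  fixes w :: "real ^ 'n \<Rightarrow> real"
  assumes sub: "visc_le \<epsilon> p h A w" and A: "open A" and r: "r > 0" and eps: "\<epsilon> \<ge> 0" and p: "p > 2"
  defines "\<alpha> \<equiv> (p - 2) / (p - 1)"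
  assumes B: "\<And>x. x \<in> B \<longleftrightarrow> (1 / r) *\<^sub>R (x - b) \<in> A" 
  shows "visc_le \<epsilon> p (\<lambda>x. r powr (\<alpha> - 2) * h ((1 / r) *\<^sub>R (x - b))) B
           (\<lambda>x. r powr \<alpha> * w ((1 / r) *\<^sub>R (x - b)))"
  unfolding visc_le_def
proof (intro ballI allI impI)
  fix x \<phi> G M
  assume x: "x \<in> B" and j: "C2_jet B B \<phi> G M"
    and m: "local_max_on (\<lambda>y. r powr \<alpha> * w ((1 / r) *\<^sub>R (y - b)) - \<phi> y) B x"
  define S where "S = (\<lambda>z. b + r *\<^sub>R z)"
  define z where "z = (1 / r) *\<^sub>R (x - b)"
  define s where "s = r powr \<alpha>"
  have s: "s > 0" using r by (simp add: s_def)
  have Sz: "S z = x" using r by (simp add: S_def z_def)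
  have inv: "(1 / r) *\<^sub>R (S y - b) = y" for y using r by (simp add: S_def)
  have zA: "z \<in> A" using x B by (simp add: z_def)
  have SB: "S y \<in> B \<longleftrightarrow> y \<in> A" for y by (simp add: B inv)
  have "B = (\<lambda>x. (1 / r) *\<^sub>R (x - b)) -` A" using B by auto
  then have opB: "open B" using A by (auto intro!: open_vimage continuous_intros)
  have dS: "(S has_derivative (\<lambda>h. r *\<^sub>R h)) (at y)" for y
    unfolding S_def by (auto intro!: derivative_eq_intros)
  have evA: "\<forall>\<^sub>F y in nhds z. y \<in> A" using zA A by (simp add: eventually_nhds_in_open)
  have d1: "\<And>y. y \<in> B \<Longrightarrow> (\<phi> has_derivative (\<lambda>h. G y \<bullet> h)) (at y)"
    and d2: "\<And>y. y \<in> B \<Longrightarrow> (G has_derivative (\<lambda>h. M y *v h)) (at y)"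
    using j unfolding C2_jet_def by auto
  have "jet_at (\<lambda>y. (1 / s) * \<phi> (S y)) (\<lambda>y. (r / s) *\<^sub>R G (S y)) ((r\<^sup>2 / s) *\<^sub>R M x) z"
    unfolding jet_at_def
  proof
    show "\<forall>\<^sub>F y in nhds z. ((\<lambda>y. 1 / s * \<phi> (S y)) has_derivative (\<lambda>h. ((r / s) *\<^sub>R G (S y)) \<bullet> h)) (at y)"
      using evA
    proof eventually_elim
      case (elim y)
      have "((\<lambda>y. \<phi> (S y)) has_derivative (\<lambda>h. G (S y) \<bullet> (r *\<^sub>R h))) (at y)"
        by (rule has_derivative_compose[OF dS d1]) (use elim SB in auto)
      from has_derivative_mult_right[OF this, of "1 / s"] show ?case
        by (simp add: inner_simps mult.commute)
    qed
    have "((\<lambda>y. G (S y)) has_derivative (\<lambda>h. M x *v (r *\<^sub>R h))) (at z)"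
      using has_derivative_compose[OF dS[of z] d2[of "S z"]] x by (simp add: Sz)
    then have "((\<lambda>y. (r / s) *\<^sub>R G (S y)) has_derivative (\<lambda>h. (r / s) *\<^sub>R (M x *v (r *\<^sub>R h)))) (at z)"
      by (rule has_derivative_scaleR_right)
    moreover have "(\<lambda>h. (r / s) *\<^sub>R (M x *v (r *\<^sub>R h))) = (*v) ((r\<^sup>2 / s) *\<^sub>R M x)"
      by (rule ext) (simp add: matrix_vector_mult_scaleR power2_eq_square scaleR_matrix_vector_assoc[symmetric])
    ultimately show "((\<lambda>y. (r / s) *\<^sub>R G (S y)) has_derivative (*v) ((r\<^sup>2 / s) *\<^sub>R M x)) (at z)"
      by (simp only:)
  qed
  moreover have "\<forall>\<^sub>F y in nhds z. w y - (1 / s) * \<phi> (S y) \<le> w z - (1 / s) * \<phi> (S z)"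
  proof -
    have "\<forall>\<^sub>F y in nhds x. s * w ((1 / r) *\<^sub>R (y - b)) - \<phi> y \<le> s * w ((1 / r) *\<^sub>R (x - b)) - \<phi> x"
      unfolding s_def by (rule iffD1[OF local_max_on_open_iff[OF opB x] m])
    moreover have "filterlim S (nhds x) (nhds z)"
      using Sz unfolding S_def by (auto intro!: tendsto_eq_intros filterlim_ident)
    ultimately have "\<forall>\<^sub>F y in nhds z. s * w ((1 / r) *\<^sub>R (S y - b)) - \<phi> (S y) \<le> s * w ((1 / r) *\<^sub>R (x - b)) - \<phi> x"
      unfolding filterlim_iff by blast
    then show ?thesis
    proof eventually_elim
      case (elim y)
      then have "(s * w y - \<phi> (S y)) / s \<le> (s * w z - \<phi> (S z)) / s"
        using s by (intro divide_right_mono) (simp_all add: inv Sz z_def[symmetric])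
      then show ?case using s by (simp add: diff_divide_distrib)
    qed
  qed
  ultimately have "norm ((r / s) *\<^sub>R G (S z)) powr p - \<epsilon> * trace ((r\<^sup>2 / s) *\<^sub>R M x) \<le> h z"
    by (rule visc_le_jet_at[OF sub A zA _ _ eps])
  moreover have "norm ((r / s) *\<^sub>R G (S z)) powr p = (r\<^sup>2 / s) * norm (G x) powr p"
  proof -
    have "r / s = r powr (1 - \<alpha>)" using r by (simp add: s_def powr_diff)
    then have "(r / s) powr p = r powr ((1 - \<alpha>) * p)" by (simp add: powr_powr)
    also have "(1 - \<alpha>) * p = 2 - \<alpha>" using p by (simp add: \<alpha>_def field_simps)
    also have "r powr (2 - \<alpha>) = r\<^sup>2 / s" unfolding s_def powr_diff using r by simp
    finally have rs: "(r / s) powr p = r\<^sup>2 / s" .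
    have "norm ((r / s) *\<^sub>R G (S z)) = (r / s) * norm (G x)" using r s by (simp add: Sz)
    then show ?thesis using rs powr_mult[of "r / s" "norm (G x)" p] r s by simp
  qed
  ultimately have "(r\<^sup>2 / s) * (norm (G x) powr p - \<epsilon> * trace (M x)) \<le> h z"
    by (simp add: trace_scaleR algebra_simps)
  then have "(s / r\<^sup>2) * ((r\<^sup>2 / s) * (norm (G x) powr p - \<epsilon> * trace (M x))) \<le> (s / r\<^sup>2) * h z"
    using r s by (intro mult_left_mono) auto
  moreover have cancel: "(s / r\<^sup>2) * ((r\<^sup>2 / s) * X) = X" for X using r s by simp
  ultimately have "norm (G x) powr p - \<epsilon> * trace (M x) \<le> (s / r\<^sup>2) * h z"
    unfolding cancel by simp
  also have "s / r\<^sup>2 = r powr (\<alpha> - 2)"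
    unfolding s_def powr_diff using r by simp
  finally show "norm (G x) powr p - \<epsilon> * trace (M x) \<le> r powr (\<alpha> - 2) * h ((1 / r) *\<^sub>R (x - b))"
    by (simp add: z_def)
qed

section \<open>Mollification\<close>

lemma has_real_derivative_pos_part_power:
  "((\<lambda>s. max 0 s ^ Suc (Suc k)) has_real_derivative real (Suc (Suc k)) * max 0 s ^ Suc k) (at s)"
proof -
  consider "s > 0" | "s < 0" | "s = 0" by linarith
  then show ?thesis
  proof cases
    case 1
    have "((\<lambda>s. s ^ Suc (Suc k)) has_real_derivative real (Suc (Suc k)) * max 0 s ^ Suc k) (at s)"
      using DERIV_pow[of "Suc (Suc k)" s] 1 by simp
    then show ?thesis
      by (rule DERIV_cong_ev[THEN iffD2, rotated -1])
        (use 1 eventually_nhds_in_open[of "{0<..}" s] in \<open>auto elim!: eventually_mono\<close>)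
  next
    case 2
    have "((\<lambda>s. 0) has_real_derivative real (Suc (Suc k)) * max 0 s ^ Suc k) (at s)"
      using 2 by (auto intro!: derivative_eq_intros)
    then show ?thesis
      by (rule DERIV_cong_ev[THEN iffD2, rotated -1])
        (use 2 eventually_nhds_in_open[of "{..<0}" s] in \<open>auto elim!: eventually_mono\<close>)
  next
    case 3
    have "((\<lambda>h::real. max 0 h ^ Suc k) \<longlongrightarrow> max 0 0 ^ Suc k) (at 0)"
      by (intro tendsto_intros)
    then have lim: "((\<lambda>h::real. max 0 h ^ Suc k) \<longlongrightarrow> 0) (at 0)" by simp
    have "((\<lambda>h::real. (max 0 (0 + h) ^ Suc (Suc k) - max 0 0 ^ Suc (Suc k)) / h) \<longlongrightarrow> 0) (at 0)"
      by (rule Lim_null_comparison[OF _ lim]) (auto simp: max_def eventually_at_filter)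
    then show ?thesis using 3 by (simp add: DERIV_def)
  qed
qed

lemma uniformly_continuous_compact_support:
  fixes f :: "'a::euclidean_space \<Rightarrow> 'b::real_normed_vector"
  assumes "continuous_on UNIV f" and supp: "\<And>x. norm x > B \<Longrightarrow> f x = 0"
  shows "uniformly_continuous_on UNIV f" "bounded (range f)"
proof -
  have u: "uniformly_continuous_on (cball 0 (B + 1)) f"
    by (rule compact_uniformly_continuous) (auto intro: continuous_on_subset[OF assms(1)])
  show "uniformly_continuous_on UNIV f"
    unfolding uniformly_continuous_on_def
  proof (intro allI impI)
    fix e :: real assume "e > 0"
    then obtain d where d: "d > 0" "\<And>x x'. x \<in> cball 0 (B + 1) \<Longrightarrow> x' \<in> cball 0 (B + 1) \<Longrightarrow> dist x' x < d \<Longrightarrow> dist (f x') (f x) < e"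
      using u unfolding uniformly_continuous_on_def by metis
    have "dist (f x') (f x) < e" if "dist x' x < min d 1" for x x'
    proof (cases "norm x > B \<and> norm x' > B")
      case True then show ?thesis using supp \<open>e > 0\<close> by simp
    next
      case False
      then have "norm x \<le> B + 1 \<and> norm x' \<le> B + 1"
        using that norm_triangle_ineq2[of x x'] norm_triangle_ineq2[of x' x]
        by (auto simp: dist_norm norm_minus_commute)
      then show ?thesis using that d by simp
    qed
    then show "\<exists>d>0. \<forall>x\<in>UNIV. \<forall>x'\<in>UNIV. dist x' x < d \<longrightarrow> dist (f x') (f x) < e"
      using d(1) by (intro exI[of _ "min d 1"]) auto
  qed
  have "bounded (f ` cball 0 B)"
    by (intro compact_imp_bounded compact_continuous_image) (auto intro: continuous_on_subset[OF assms(1)])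
  moreover have "range f \<subseteq> insert 0 (f ` cball 0 B)" using supp by (force simp: not_less)
  ultimately show "bounded (range f)" by (metis bounded_insert bounded_subset)
qed

lemma convolution_has_derivative:
  fixes k :: "'a::euclidean_space \<Rightarrow> 'b::euclidean_space" and k' :: "'a \<Rightarrow> 'a \<Rightarrow>\<^sub>L 'b" and a b :: 'a
  assumes k: "\<And>x. (k has_derivative blinfun_apply (k' x)) (at x)"
    and k': "continuous_on UNIV k'" and u: "continuous_on UNIV u"
  defines "D \<equiv> \<lambda>x. integral (cbox a b) (\<lambda>t. u t *\<^sub>R k' (x - t))"
  shows "((\<lambda>x. integral (cbox a b) (\<lambda>t. u t *\<^sub>R k (x - t))) has_derivative blinfun_apply (D x)) (at x)"
    and "continuous_on UNIV D"
proof -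
  have ck: "continuous_on UNIV k"
    by (rule has_derivative_continuous_on[of _ _ "\<lambda>x. blinfun_apply (k' x)"]) (use k in auto)
  have cont: "continuous_on (UNIV \<times> cbox a b) (\<lambda>(x, t). u t *\<^sub>R k' (x - t))"
    unfolding split_beta
    by (intro continuous_intros continuous_on_compose2[OF k'] continuous_on_compose2[OF u]) auto
  then show "continuous_on UNIV D"
    unfolding D_def by (rule integral_continuous_on_param)
  show "((\<lambda>x. integral (cbox a b) (\<lambda>t. u t *\<^sub>R k (x - t))) has_derivative blinfun_apply (D x)) (at x)"
    unfolding D_def
  proof (rule leibniz_rule[where U = UNIV])
    fix x t
    have "((\<lambda>x. k (x - t)) has_derivative blinfun_apply (k' (x - t))) (at x)"
      by (rule has_derivative_compose[OF _ k, of "\<lambda>x. x - t" "\<lambda>h. h" x UNIV])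
        (auto intro!: derivative_eq_intros)
    from has_derivative_scaleR_right[OF this, of "u t"]
    show "((\<lambda>x. u t *\<^sub>R k (x - t)) has_derivative blinfun_apply (u t *\<^sub>R k' (x - t))) (at x)"
      by (simp add: scaleR_blinfun.rep_eq)
  next
    fix x
    show "(\<lambda>t. u t *\<^sub>R k (x - t)) integrable_on cbox a b"
      by (intro integrable_continuous continuous_intros continuous_on_compose2[OF ck] continuous_on_compose2[OF u]) auto
  qed (use cont in auto)
qed

text \<open>For \<open>s = 1\<close> this is a kernel supported in the ball of radius \<open>\<sigma>\<close>; for \<open>s = -1\<close> it vanishes in that
ball and grows outside, and serves as a barrier.  The third power makes it twice continuously
differentiable.\<close>

definition bump :: "real \<Rightarrow> real \<Rightarrow> 'a::euclidean_space \<Rightarrow> real" where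
  "bump s \<sigma> y = max 0 (s * (\<sigma>\<^sup>2 - y \<bullet> y)) ^ 3"

definition bump_grad :: "real \<Rightarrow> real \<Rightarrow> 'a::euclidean_space \<Rightarrow> 'a" where
  "bump_grad s \<sigma> y = (- 6 * s * max 0 (s * (\<sigma>\<^sup>2 - y \<bullet> y)) ^ 2) *\<^sub>R y"

definition bump_hess :: "real \<Rightarrow> real \<Rightarrow> 'a::euclidean_space \<Rightarrow> 'a \<Rightarrow>\<^sub>L 'a" where
  "bump_hess s \<sigma> y = (- 6 * s * max 0 (s * (\<sigma>\<^sup>2 - y \<bullet> y)) ^ 2) *\<^sub>R id_blinfun +
     (24 * s\<^sup>2 * max 0 (s * (\<sigma>\<^sup>2 - y \<bullet> y))) *\<^sub>R (blinfun_scaleR_left y o\<^sub>L blinfun_inner_left y)"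

lemma bump_has_derivative:
  "(bump s \<sigma> has_derivative blinfun_apply (blinfun_inner_right (bump_grad s \<sigma> y))) (at y)"
proof -
  have i: "((\<lambda>y. s * (\<sigma>\<^sup>2 - y \<bullet> y)) has_derivative (\<lambda>h. s * (- 2 * (y \<bullet> h)))) (at y)"
    by (auto intro!: derivative_eq_intros simp: inner_commute)
  have "((\<lambda>s. max 0 s ^ Suc (Suc 1)) has_derivative (*) (real (Suc (Suc 1)) * max 0 (s * (\<sigma>\<^sup>2 - y \<bullet> y)) ^ Suc 1)) (at (s * (\<sigma>\<^sup>2 - y \<bullet> y)))"
    using has_real_derivative_pos_part_power[of 1 "s * (\<sigma>\<^sup>2 - y \<bullet> y)"] unfolding has_field_derivative_def .
  from has_derivative_compose[OF i this]
  have "(bump s \<sigma> has_derivative (\<lambda>h. real (Suc (Suc 1)) * max 0 (s * (\<sigma>\<^sup>2 - y \<bullet> y)) ^ Suc 1 * (s * (- 2 * (y \<bullet> h))))) (at y)"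
    by (simp add: bump_def[abs_def] numeral_3_eq_3)
  moreover have "(\<lambda>h. real (Suc (Suc 1)) * max 0 (s * (\<sigma>\<^sup>2 - y \<bullet> y)) ^ Suc 1 * (s * (- 2 * (y \<bullet> h)))) =
      blinfun_apply (blinfun_inner_right (bump_grad s \<sigma> y))"
    by (rule ext) (simp add: bump_grad_def power2_eq_square)
  ultimately show ?thesis by simp
qed

lemma bump_grad_has_derivative:
  "(bump_grad s \<sigma> has_derivative blinfun_apply (bump_hess s \<sigma> y)) (at y)"
proof -
  have i: "((\<lambda>y. s * (\<sigma>\<^sup>2 - y \<bullet> y)) has_derivative (\<lambda>h. s * (- 2 * (y \<bullet> h)))) (at y)"
    by (auto intro!: derivative_eq_intros simp: inner_commute)
  have "((\<lambda>s. max 0 s ^ Suc (Suc 0)) has_derivative (*) (real (Suc (Suc 0)) * max 0 (s * (\<sigma>\<^sup>2 - y \<bullet> y)) ^ Suc 0)) (at (s * (\<sigma>\<^sup>2 - y \<bullet> y)))"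
    using has_real_derivative_pos_part_power[of 0 "s * (\<sigma>\<^sup>2 - y \<bullet> y)"] unfolding has_field_derivative_def .
  from has_derivative_compose[OF i this]
  have "((\<lambda>y. max 0 (s * (\<sigma>\<^sup>2 - y \<bullet> y)) ^ 2) has_derivative (\<lambda>h. - 4 * s * max 0 (s * (\<sigma>\<^sup>2 - y \<bullet> y)) * (y \<bullet> h))) (at y)"
    by (simp add: numeral_2_eq_2 mult.assoc mult.left_commute)
  from has_derivative_scaleR[OF has_derivative_mult_right[OF this, of "-6 * s"] has_derivative_ident]
  show ?thesis
    unfolding bump_grad_def[abs_def] bump_hess_def
    by (rule has_derivative_eq_rhs)
      (auto simp: blinfun.add_left blinfun.diff_left blinfun.minus_left blinfun.scaleR_left inner_commute
        scaleR_blinfun.rep_eq fun_eq_iff power2_eq_square algebra_simps)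
qed

lemma bump_continuous: "continuous_on UNIV (bump s \<sigma>)" "continuous_on UNIV (bump_grad s \<sigma>)"
  "continuous_on UNIV (bump_hess s \<sigma>)"
  unfolding bump_def[abs_def] bump_grad_def[abs_def] bump_hess_def[abs_def]
  by (intro continuous_intros)+

lemma bump_zero:
  assumes "\<sigma> > 0" "norm y \<ge> \<sigma>"
  shows "bump 1 \<sigma> y = 0" "bump_grad 1 \<sigma> y = 0" "bump_hess 1 \<sigma> y = 0"
proof -
  have "\<sigma>\<^sup>2 \<le> (norm y)\<^sup>2" using assms by (intro power_mono) auto
  then have "max 0 (\<sigma>\<^sup>2 - y \<bullet> y) = 0" by (simp add: dot_square_norm)
  then show "bump 1 \<sigma> y = 0" "bump_grad 1 \<sigma> y = 0" "bump_hess 1 \<sigma> y = 0"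
    by (simp_all add: bump_def bump_grad_def bump_hess_def)
qed

text \<open>The two forms of a convolution: in the first one \<open>x\<close> occurs only in the smooth kernel, so it can
be differentiated; the second one is an average of translates of \<open>u\<close>, so it inherits inequalities.\<close>

lemma integral_cbox_convolution_commute:
  fixes u :: "'a::euclidean_space \<Rightarrow> real" and k :: "'a \<Rightarrow> real"
  assumes k: "continuous_on UNIV k" and u: "continuous_on UNIV u"
    and ks: "\<And>y. y \<notin> cbox c d \<Longrightarrow> k y = 0" and us: "\<And>y. y \<notin> cbox a b \<Longrightarrow> u y = 0"
  shows "integral (cbox a b) (\<lambda>t. u t * k (x - t)) = integral (cbox c d) (\<lambda>y. k y * u (x - y))"
proof -
  have int1: "((\<lambda>t. u t * k (x - t)) has_integral integral (cbox a b) (\<lambda>t. u t * k (x - t))) (cbox a b)"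
    by (intro integrable_integral integrable_continuous continuous_intros
        continuous_on_compose2[OF k] continuous_on_compose2[OF u]) auto
  have int2: "((\<lambda>y. k y * u (x - y)) has_integral integral (cbox c d) (\<lambda>y. k y * u (x - y))) (cbox c d)"
    by (intro integrable_integral integrable_continuous continuous_intros
        continuous_on_compose2[OF k] continuous_on_compose2[OF u]) auto
  define S where "S = (\<lambda>y. (1 / (-1)) *\<^sub>R y + - ((1 / (-1)) *\<^sub>R x)) ` cbox a b"
  have "((\<lambda>y. u ((-1) *\<^sub>R y + x) * k (x - ((-1) *\<^sub>R y + x))) has_integral
      (1 / (\<bar>-1\<bar> ^ DIM('a))) *\<^sub>R integral (cbox a b) (\<lambda>t. u t * k (x - t))) S"
    unfolding S_def using has_integral_affinity[OF int1, of "-1" x] by simp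
  then have "((\<lambda>y. k y * u (x - y)) has_integral integral (cbox a b) (\<lambda>t. u t * k (x - t))) S"
    by (simp add: mult.commute)
  then have "((\<lambda>y. k y * u (x - y)) has_integral integral (cbox a b) (\<lambda>t. u t * k (x - t))) UNIV"
  proof (rule has_integral_on_superset)
    fix y assume "y \<notin> S"
    then have "x - y \<notin> cbox a b" unfolding S_def by (force simp: image_iff)
    then show "k y * u (x - y) = 0" using us by simp
  qed auto
  moreover have "((\<lambda>y. k y * u (x - y)) has_integral integral (cbox c d) (\<lambda>y. k y * u (x - y))) UNIV"
    by (rule has_integral_on_superset[OF int2]) (use ks in auto)
  ultimately show ?thesis by (rule has_integral_unique)
qed

lemma cball_subset_cbox_One: "norm y \<le> B \<Longrightarrow> y \<in> cbox (- (B *\<^sub>R One)) (B *\<^sub>R (One::'a::euclidean_space))"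
  using Basis_le_norm[of _ y] by (fastforce simp: mem_box abs_le_iff intro: order_trans)

definition C2_fun ::
  "(real ^ 'n \<Rightarrow> real) \<Rightarrow> (real ^ 'n \<Rightarrow> real ^ 'n) \<Rightarrow> (real ^ 'n \<Rightarrow> real ^ 'n ^ 'n) \<Rightarrow> bool" where
  "C2_fun g G M \<longleftrightarrow> (\<forall>x. (g has_derivative (\<lambda>h. G x \<bullet> h)) (at x)) \<and>
     (\<forall>x. (G has_derivative (\<lambda>h. M x *v h)) (at x)) \<and> continuous_on UNIV M"

lemma C2_funD:
  assumes "C2_fun g G M"
  shows "(g has_derivative (\<lambda>h. G x \<bullet> h)) (at x)" "(G has_derivative (\<lambda>h. M x *v h)) (at x)"
    "continuous_on UNIV g" "continuous_on UNIV G" "continuous_on UNIV M"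
  using assms unfolding C2_fun_def
  by (auto intro!: has_derivative_continuous_on[of UNIV g "\<lambda>x h. G x \<bullet> h"]
      has_derivative_continuous_on[of UNIV G "\<lambda>x h. M x *v h"])

text \<open>The mollification is an average of translates and at the same time a compactly supported
\<open>C^2\<close> function; both descriptions are needed below.\<close>

lemma mollification:
  fixes u :: "real ^ 'n \<Rightarrow> real"
  assumes u: "continuous_on UNIV u" and us: "\<forall>x. norm x > B \<longrightarrow> u x = 0" and \<sigma>: "\<sigma> > 0"
  shows "\<exists>\<rho> a b g G M.
    continuous_on UNIV \<rho> \<and> (\<forall>y. \<rho> y \<ge> 0) \<and> (\<forall>y. norm y \<ge> \<sigma> \<longrightarrow> \<rho> y = 0) \<and> integral (cbox a b) \<rho> = 1 \<and>
    (\<forall>x. g x = integral (cbox a b) (\<lambda>y. \<rho> y * u (x - y))) \<and>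
    C2_fun g G M \<and> (\<forall>x. norm x > B + \<sigma> \<longrightarrow> g x = 0 \<and> G x = 0 \<and> M x = 0)"
proof -
  define a where "a = - (\<sigma> *\<^sub>R One :: real ^ 'n)"
  define b where "b = (\<sigma> *\<^sub>R One :: real ^ 'n)"
  define c where "c = - (B *\<^sub>R One :: real ^ 'n)"
  define d where "d = (B *\<^sub>R One :: real ^ 'n)"
  have uc: "u y = 0" if "y \<notin> cbox c d" for y
    using that us cball_subset_cbox_One[of y B] unfolding c_def d_def by force
  have bc: "bump 1 \<sigma> y = 0" if "y \<notin> cbox a b" for y
    using that bump_zero[OF \<sigma>] cball_subset_cbox_One[of y \<sigma>] unfolding a_def b_def by force
  have nn: "bump 1 \<sigma> y \<ge> 0" for y :: "real ^ 'n" by (simp add: bump_def)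
  define Z where "Z = integral (cbox a b) (bump 1 \<sigma>)"
  have Zint: "bump 1 \<sigma> integrable_on cbox a b"
    by (intro integrable_continuous continuous_on_subset[OF bump_continuous(1)]) auto
  have "Z > 0"
  proof -
    have "Z \<ge> 0" unfolding Z_def by (intro integral_nonneg Zint nn)
    moreover have "Z \<noteq> 0"
    proof
      assume "Z = 0"
      have "0 \<in> box a b" using \<sigma> by (auto simp: a_def b_def mem_box)
      then have ne: "box a b \<noteq> {}" by auto
      have cb: "continuous_on (cbox a b) (bump 1 \<sigma>)" by (rule continuous_on_subset[OF bump_continuous(1)]) auto
      have "bump 1 \<sigma> (0 :: real ^ 'n) = 0"
        using integral_cbox_eq_0_iff[OF cb ne nn] \<open>Z = 0\<close> \<open>0 \<in> box a b\<close> box_subset_cbox[of a b]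
        unfolding Z_def by blast
      then show False using \<sigma> by (simp add: bump_def)
    qed
    ultimately show ?thesis by simp
  qed
  define \<rho> where "\<rho> = (\<lambda>y :: real ^ 'n. bump 1 \<sigma> y / Z)"
  define g where "g = (\<lambda>x. integral (cbox a b) (\<lambda>y. \<rho> y * u (x - y)))"
  define DG where "DG = (\<lambda>x. integral (cbox c d) (\<lambda>t. (u t / Z) *\<^sub>R blinfun_inner_right (bump_grad 1 \<sigma> (x - t))))"
  define G where "G = (\<lambda>x. integral (cbox c d) (\<lambda>t. (u t / Z) *\<^sub>R bump_grad 1 \<sigma> (x - t)))"
  define DM where "DM = (\<lambda>x. integral (cbox c d) (\<lambda>t. (u t / Z) *\<^sub>R bump_hess 1 \<sigma> (x - t)))"
  define M where "M = (\<lambda>x. matrix (blinfun_apply (DM x)))"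
  have c\<rho>: "continuous_on UNIV \<rho>" unfolding \<rho>_def using \<open>Z > 0\<close>
    by (intro continuous_intros bump_continuous) auto
  have cuZ: "continuous_on UNIV (\<lambda>t. u t / Z)" using \<open>Z > 0\<close> by (intro continuous_intros u) auto
  have g_alt: "g x = integral (cbox c d) (\<lambda>t. (u t / Z) *\<^sub>R bump 1 \<sigma> (x - t))" for x
  proof -
    have "integral (cbox c d) (\<lambda>t. u t * \<rho> (x - t)) = g x"
      unfolding g_def by (rule integral_cbox_convolution_commute[OF c\<rho> u]) (use bc uc in \<open>auto simp: \<rho>_def\<close>)
    then show ?thesis by (simp add: \<rho>_def)
  qed
  have z: "u t = 0 \<or> \<sigma> \<le> norm (x - t)" if "norm x > B + \<sigma>" for x t
  proof (rule ccontr)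
    assume "\<not> (u t = 0 \<or> \<sigma> \<le> norm (x - t))"
    then have "norm t \<le> B" "norm (x - t) < \<sigma>" using us by force+
    then show False using that norm_triangle_ineq[of t "x - t"] by simp
  qed
  have DG: "blinfun_apply (DG x) h = G x \<bullet> h" for x h
  proof -
    have i: "(\<lambda>t. (u t / Z) *\<^sub>R bump_grad 1 \<sigma> (x - t)) integrable_on cbox c d"
      by (intro integrable_continuous continuous_intros continuous_on_subset[OF cuZ]
          continuous_on_compose2[OF bump_continuous(2)]) auto
    have "DG x = blinfun_inner_right (G x)"
      unfolding DG_def G_def
      using integral_linear[OF i bounded_linear_blinfun_inner_right]
      by (simp add: o_def linear_simps[OF bounded_linear_blinfun_inner_right])
    then show ?thesis by simp
  qed
  have "continuous_on UNIV (\<lambda>x. blinfun_inner_right (bump_grad 1 \<sigma> x :: real ^ 'n))"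
    by (intro continuous_intros bump_continuous bounded_linear.continuous_on[OF bounded_linear_blinfun_inner_right])
  note D1 = convolution_has_derivative[OF bump_has_derivative this cuZ, of c d]
  note D2 = convolution_has_derivative[OF bump_grad_has_derivative bump_continuous(3) cuZ, of c d]
  have gG: "(g has_derivative (\<lambda>h. G x \<bullet> h)) (at x)" for x
  proof -
    have "blinfun_apply (DG x) = (\<lambda>h. G x \<bullet> h)" by (rule ext) (rule DG)
    then show ?thesis using D1(1)[where x = x] by (simp only: g_alt[abs_def] DG_def)
  qed
  have MM: "M x *v h = blinfun_apply (DM x) h" for x h
    using fun_cong[OF matrix_vector_mul(3)[OF blinfun.bounded_linear_right[of "DM x"]], of h] by (simp add: M_def)
  have GM: "(G has_derivative (\<lambda>h. M x *v h)) (at x)" for x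
  proof -
    have "(\<lambda>h. M x *v h) = blinfun_apply (DM x)" by (rule ext) (rule MM)
    then show ?thesis using D2(1)[where x = x] by (simp only: G_def DM_def)
  qed
  have cDM: "continuous_on UNIV DM" using D2(2) unfolding DM_def .
  have cM: "continuous_on UNIV M"
    unfolding M_def matrix_def
    by (intro continuous_on_vec_lambda continuous_intros blinfun.continuous_on cDM)
  have "M x = 0" if "norm x > B + \<sigma>" for x
  proof -
    have "(\<lambda>t. (u t / Z) *\<^sub>R bump_hess 1 \<sigma> (x - t)) = (\<lambda>t. 0)"
      using z[OF that] bump_zero[OF \<sigma>] by fastforce
    then have "DM x = 0" unfolding DM_def by simp
    then show ?thesis by (simp add: M_def matrix_def vec_eq_iff)
  qed
  moreover have "G x = 0" if "norm x > B + \<sigma>" for x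
  proof -
    have "(\<lambda>t. (u t / Z) *\<^sub>R bump_grad 1 \<sigma> (x - t)) = (\<lambda>t. 0)"
      using z[OF that] bump_zero[OF \<sigma>] by fastforce
    then show ?thesis unfolding G_def by simp
  qed
  moreover have "g x = 0" if "norm x > B + \<sigma>" for x
  proof -
    have "(\<lambda>t. (u t / Z) *\<^sub>R bump 1 \<sigma> (x - t)) = (\<lambda>t. 0)"
      using z[OF that] bump_zero[OF \<sigma>] by fastforce
    then show ?thesis unfolding g_alt by simp
  qed
  moreover have "integral (cbox a b) \<rho> = 1"
    using \<open>Z > 0\<close> unfolding \<rho>_def by (simp add: Z_def)
  moreover have "\<rho> y \<ge> 0" for y using nn[of y] \<open>Z > 0\<close> by (simp add: \<rho>_def)
  moreover have "\<rho> y = 0" if "norm y \<ge> \<sigma>" for y using bump_zero(1)[OF \<sigma> that] by (simp add: \<rho>_def)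
  ultimately show ?thesis using c\<rho> gG GM cM g_def
    by (intro exI[of _ \<rho>] exI[of _ a] exI[of _ b] exI[of _ g] exI[of _ G] exI[of _ M]) (simp add: C2_fun_def)
qed

lemma mollification_close:
  fixes u :: "'a::euclidean_space \<Rightarrow> real"
  assumes \<rho>: "continuous_on UNIV \<rho>" "\<And>y. \<rho> y \<ge> 0" "\<And>y. norm y \<ge> \<sigma> \<Longrightarrow> \<rho> y = 0" "integral (cbox a b) \<rho> = 1"
    and u: "continuous_on UNIV u" and v: "continuous_on UNIV v"
    and le: "\<And>y. norm y < \<sigma> \<Longrightarrow> u (x - y) \<le> v (x - y) + m"
  shows "integral (cbox a b) (\<lambda>y. \<rho> y * u (x - y)) \<le> integral (cbox a b) (\<lambda>y. \<rho> y * v (x - y)) + m"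
proof -
  have i: "(\<lambda>y. \<rho> y * u (x - y)) integrable_on cbox a b" "(\<lambda>y. \<rho> y * v (x - y)) integrable_on cbox a b"
    "(\<lambda>y. \<rho> y * m) integrable_on cbox a b"
    by (intro integrable_continuous continuous_intros continuous_on_subset[OF \<rho>(1)]
        continuous_on_compose2[OF u] continuous_on_compose2[OF v] subset_UNIV)+
  have "integral (cbox a b) (\<lambda>y. \<rho> y * u (x - y)) \<le> integral (cbox a b) (\<lambda>y. \<rho> y * v (x - y) + \<rho> y * m)"
  proof (rule integral_le[OF i(1) integrable_add[OF i(2,3)]])
    fix y
    show "\<rho> y * u (x - y) \<le> \<rho> y * v (x - y) + \<rho> y * m"
      using \<rho>(2,3)[of y] le[of y] mult_left_mono[of "u (x - y)" "v (x - y) + m" "\<rho> y"]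
      by (cases "norm y < \<sigma>") (auto simp: distrib_left)
  qed
  also have "\<dots> = integral (cbox a b) (\<lambda>y. \<rho> y * v (x - y)) + m"
    using \<rho>(4) by (simp add: integral_add[OF i(2,3)])
  finally show ?thesis .
qed

section \<open>Averages over finitely many translations\<close>

text \<open>Iterated averages preserve order and sup bounds, and they commute with linear maps,
differentiation and convolution: these are the properties of a convolution semigroup on which
the comparison below rests.  The operator is polymorphic in the values in order to act alike on a function, its
gradient and its Hessian.\<close>

definition avg :: "('i::finite \<Rightarrow> 'a::real_normed_vector) \<Rightarrow> ('a \<Rightarrow> 'b::real_normed_vector) \<Rightarrow> 'a \<Rightarrow> 'b" where
  "avg st F x = (\<Sum>j\<in>UNIV. F (x + st j)) /\<^sub>R real CARD('i)"

lemma avg_const [simp]: "avg st (\<lambda>x. c) = (\<lambda>x. c)"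
  by (rule ext) (simp add: avg_def sum_constant_scaleR)

lemma avg_pow_const [simp]: "(avg st ^^ k) (\<lambda>x. c) = (\<lambda>x. c)"
  by (induction k) simp_all

lemma avg_pow_Suc:
  fixes st :: "'i::finite \<Rightarrow> 'a::real_normed_vector"
  shows
  "(avg st ^^ Suc k) F x = (\<Sum>j\<in>UNIV. (avg st ^^ k) F (x + st j)) /\<^sub>R real CARD('i)"
  unfolding funpow.simps o_apply by (rule avg_def)

lemma avg_add: "avg st (\<lambda>x. F x + G x) = (\<lambda>x. avg st F x + avg st G x)"
  by (rule ext) (simp add: avg_def sum.distrib scaleR_add_right)

lemma avg_pow_add: "(avg st ^^ k) (\<lambda>x. F x + G x) = (\<lambda>x. (avg st ^^ k) F x + (avg st ^^ k) G x)"
  by (induction k) (simp_all add: avg_add)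

lemma avg_linear:
  assumes "linear L"
  shows "avg st (\<lambda>x. L (F x)) = (\<lambda>x. L (avg st F x))"
  by (rule ext) (simp add: avg_def linear_sum[OF assms] linear_scale[OF assms])

lemma avg_pow_linear:
  assumes "linear L"
  shows "(avg st ^^ k) (\<lambda>x. L (F x)) = (\<lambda>x. L ((avg st ^^ k) F x))"
  by (induction k) (simp_all add: avg_linear[OF assms])

lemma avg_pow_diff:
  fixes F G :: "'a::real_normed_vector \<Rightarrow> 'b::real_normed_vector"
  shows "(avg st ^^ k) (\<lambda>x. F x - G x) = (\<lambda>x. (avg st ^^ k) F x - (avg st ^^ k) G x)"
proof -
  have "linear (\<lambda>x::'b. - x)" by (simp add: linear_iff)
  from avg_pow_linear[OF this, of k st G] show ?thesis
    using avg_pow_add[of k st F "\<lambda>x. - G x"] by simp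
qed

lemma avg_mono:
  fixes F :: "'a::real_normed_vector \<Rightarrow> real"
  assumes "\<And>x. F x \<le> G x"
  shows "avg st F x \<le> avg st G x"
  unfolding avg_def using assms by (auto intro!: divide_right_mono sum_mono simp: divide_inverse_commute[symmetric])

lemma avg_pow_mono:
  fixes F :: "'a::real_normed_vector \<Rightarrow> real"
  assumes "\<And>x. F x \<le> G x"
  shows "(avg st ^^ k) F x \<le> (avg st ^^ k) G x"
  by (induction k arbitrary: x) (simp_all add: assms avg_mono)

lemma avg_pow_norm_le:
  fixes st :: "'i::finite \<Rightarrow> 'a::real_normed_vector"
  assumes "\<And>x. norm (F x) \<le> b"
  shows "norm ((avg st ^^ k) F x) \<le> b"
proof (induction k arbitrary: x)
  case (Suc k)
  have "norm ((avg st ^^ Suc k) F x) \<le> (\<Sum>j\<in>(UNIV :: 'i set). b) /\<^sub>R real CARD('i)"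
    unfolding avg_pow_Suc norm_scaleR real_scaleR_def
    using Suc by (intro mult_mono order_trans[OF norm_sum sum_mono]) (auto simp del: sum_constant intro: sum_norm_le)
  also have "\<dots> = b" by simp
  finally show ?case .
qed (use assms in simp)

lemma avg_pow_has_derivative_gradient:
  fixes \<phi> :: "'a::real_inner \<Rightarrow> real" and st :: "'i::finite \<Rightarrow> 'a"
  assumes "\<And>x. (\<phi> has_derivative (\<lambda>h. G x \<bullet> h)) (at x)"
  shows "((avg st ^^ k) \<phi> has_derivative (\<lambda>h. (avg st ^^ k) G x \<bullet> h)) (at x)"
proof (induction k arbitrary: x)
  case (Suc k)
  have "((\<lambda>x. (avg st ^^ k) \<phi> (x + s)) has_derivative (\<lambda>h. (avg st ^^ k) G (x + s) \<bullet> h)) (at x)" for s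
    by (rule has_derivative_compose[OF _ Suc, of "\<lambda>x. x + s" "\<lambda>h. h" x UNIV])
      (auto intro!: derivative_eq_intros)
  then have "((\<lambda>x. (\<Sum>j\<in>UNIV. (avg st ^^ k) \<phi> (x + st j)) /\<^sub>R real CARD('i)) has_derivative
     (\<lambda>h. (\<Sum>j\<in>UNIV. (avg st ^^ k) G (x + st j) \<bullet> h) /\<^sub>R real CARD('i))) (at x)"
    by (intro has_derivative_scaleR_right has_derivative_sum)
  then show ?case
    by (simp only: avg_pow_Suc inner_sum_left inner_scaleR_left real_scaleR_def)
qed (use assms in simp)

lemma avg_pow_has_derivative_hessian:
  fixes G :: "real ^ 'n \<Rightarrow> real ^ 'n" and st :: "'i::finite \<Rightarrow> real ^ 'n"
  assumes "\<And>x. (G has_derivative (\<lambda>h. M x *v h)) (at x)"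
  shows "((avg st ^^ k) G has_derivative (\<lambda>h. (avg st ^^ k) M x *v h)) (at x)"
proof (induction k arbitrary: x)
  case (Suc k)
  have "((\<lambda>x. (avg st ^^ k) G (x + s)) has_derivative (\<lambda>h. (avg st ^^ k) M (x + s) *v h)) (at x)" for s
    by (rule has_derivative_compose[OF _ Suc, of "\<lambda>x. x + s" "\<lambda>h. h" x UNIV])
      (auto intro!: derivative_eq_intros)
  then have D: "((\<lambda>x. (\<Sum>j\<in>UNIV. (avg st ^^ k) G (x + st j)) /\<^sub>R real CARD('i)) has_derivative
     (\<lambda>h. (\<Sum>j\<in>UNIV. (avg st ^^ k) M (x + st j) *v h) /\<^sub>R real CARD('i))) (at x)"
    by (intro has_derivative_scaleR_right has_derivative_sum)
  have lin: "linear (\<lambda>N :: real ^ 'n ^ 'n. N *v h)" for h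
    by (auto simp: linear_iff matrix_vector_mult_add_rdistrib scaleR_matrix_vector_assoc[symmetric])
  have "(\<Sum>j\<in>UNIV. (avg st ^^ k) M (x + st j) *v h) /\<^sub>R real CARD('i) = (avg st ^^ Suc k) M x *v h" for h
    by (simp only: avg_pow_Suc linear_sum[OF lin] linear_scale[OF lin])
  then show ?case using D
    by (simp only: avg_pow_Suc)
qed (use assms in simp)

lemma avg_pow_continuous:
  assumes "continuous_on UNIV F"
  shows "continuous_on UNIV ((avg st ^^ k) F)"
proof (induction k)
  case (Suc k)
  show ?case unfolding avg_pow_Suc[abs_def]
    by (intro continuous_intros continuous_on_compose2[OF Suc]) auto
qed (use assms in simp)

lemma avg_pow_convolution:
  fixes u :: "'a::euclidean_space \<Rightarrow> real" and st :: "'i::finite \<Rightarrow> 'a"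
  assumes \<rho>: "continuous_on UNIV \<rho>" and u: "continuous_on UNIV u"
  shows "(avg st ^^ k) (\<lambda>x. integral (cbox a b) (\<lambda>y. \<rho> y * u (x - y))) =
    (\<lambda>x. integral (cbox a b) (\<lambda>y. \<rho> y * (avg st ^^ k) u (x - y)))"
proof (induction k)
  case (Suc k)
  have c: "continuous_on UNIV ((avg st ^^ k) u)" by (rule avg_pow_continuous[OF u])
  have i: "(\<lambda>y. \<rho> y * (avg st ^^ k) u (x + st j - y)) integrable_on cbox a b" for x j
    by (intro integrable_continuous continuous_intros continuous_on_subset[OF \<rho>] continuous_on_compose2[OF c] subset_UNIV)
  show ?case
  proof
    fix x
    have "integral (cbox a b) (\<lambda>y. \<rho> y * (avg st ^^ Suc k) u (x - y)) =
        integral (cbox a b) (\<lambda>y. (\<Sum>j\<in>UNIV. \<rho> y * (avg st ^^ k) u (x + st j - y)) /\<^sub>R real CARD('i))"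
      by (intro arg_cong[where f = "integral (cbox a b)"] ext)
        (simp only: avg_pow_Suc real_scaleR_def sum_distrib_left mult.left_commute add_diff_eq diff_add_eq)
    also have "\<dots> = (\<Sum>j\<in>UNIV. integral (cbox a b) (\<lambda>y. \<rho> y * (avg st ^^ k) u (x + st j - y))) /\<^sub>R real CARD('i)"
      using i by (simp add: integral_sum)
    finally show "(avg st ^^ Suc k) (\<lambda>x. integral (cbox a b) (\<lambda>y. \<rho> y * u (x - y))) x =
        integral (cbox a b) (\<lambda>y. \<rho> y * (avg st ^^ Suc k) u (x - y))"
      by (simp only: avg_pow_Suc Suc)
  qed
qed simp

section \<open>A random walk approximating a diffusion with constant drift\<close>

text \<open>There are \<open>2n\<close> steps, \<open>+ r e_i\<close> and \<open>- r e_i\<close> with \<open>r^2 = 2 n \<epsilon> \<tau>\<close>, each followed by the drift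
\<open>- \<tau> q\<close>.  The first and second moments make one averaging step equal to \<open>1 + \<tau> L + o(\<tau>)\<close> with
\<open>L = \<epsilon> \<Delta> - q \<bullet> D\<close>.\<close>

definition walk_step :: "real \<Rightarrow> real ^ 'n \<Rightarrow> real \<Rightarrow> 'n \<times> bool \<Rightarrow> real ^ 'n" where
  "walk_step \<epsilon> q \<tau> j = (if snd j then 1 else - 1) *\<^sub>R (sqrt (2 * real CARD('n) * \<epsilon> * \<tau>) *\<^sub>R axis (fst j) 1) - \<tau> *\<^sub>R q"

lemma sum_prod_bool: "(\<Sum>j\<in>(UNIV :: ('n::finite \<times> bool) set). F j) = (\<Sum>i\<in>UNIV. F (i, True) + F (i, False))"
proof -
  have "(\<Sum>j\<in>(UNIV :: ('n \<times> bool) set). F j) = (\<Sum>i\<in>UNIV. \<Sum>b\<in>UNIV. F (i, b))"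
    by (simp add: sum.cartesian_product UNIV_Times_UNIV)
  also have "\<dots> = (\<Sum>i\<in>UNIV. F (i, True) + F (i, False))"
    by (simp add: UNIV_bool add.commute)
  finally show ?thesis .
qed

lemma walk_step_quadratic:
  fixes q :: "real ^ 'n" and N :: "real ^ 'n ^ 'n"
  assumes "\<epsilon> \<ge> 0" "\<tau> \<ge> 0"
  shows "(\<Sum>j\<in>UNIV. walk_step \<epsilon> q \<tau> j \<bullet> (N *v walk_step \<epsilon> q \<tau> j)) /\<^sub>R real CARD('n \<times> bool) =
    2 * \<epsilon> * \<tau> * trace N + \<tau>\<^sup>2 * (q \<bullet> (N *v q))"
proof -
  define r where "r = sqrt (2 * real CARD('n) * \<epsilon> * \<tau>)"
  have r2: "r * r = 2 * real CARD('n) * \<epsilon> * \<tau>" using assms by (simp add: r_def)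
  have ax: "axis i 1 \<bullet> (N *v axis i 1) = N $ i $ i" for i
    by (simp add: inner_axis' matrix_vector_mul_component inner_axis)
  have Nm: "N *v (- x) = - (N *v x)" for x
    by (simp add: matrix_vector_mult_def vec_eq_iff sum_negf)
  have pair: "(v - c) \<bullet> (N *v (v - c)) + (- v - c) \<bullet> (N *v (- v - c)) = 2 * (v \<bullet> (N *v v)) + 2 * (c \<bullet> (N *v c))" for v c
    by (simp add: inner_simps matrix_vector_mult_diff_distrib Nm)
  have "walk_step \<epsilon> q \<tau> (i, True) \<bullet> (N *v walk_step \<epsilon> q \<tau> (i, True)) +
      walk_step \<epsilon> q \<tau> (i, False) \<bullet> (N *v walk_step \<epsilon> q \<tau> (i, False)) =
      2 * (r * r) * N $ i $ i + 2 * \<tau>\<^sup>2 * (q \<bullet> (N *v q))" for i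
    using pair[of "r *\<^sub>R axis i 1" "\<tau> *\<^sub>R q"] ax[of i]
    by (simp add: walk_step_def r_def[symmetric] matrix_vector_mult_scaleR power2_eq_square)
  then have "(\<Sum>j\<in>UNIV. walk_step \<epsilon> q \<tau> j \<bullet> (N *v walk_step \<epsilon> q \<tau> j)) =
     2 * (r * r) * trace N + real CARD('n) * (2 * \<tau>\<^sup>2 * (q \<bullet> (N *v q)))"
    by (simp add: sum_prod_bool sum.distrib trace_def sum_distrib_left)
  then show ?thesis by (simp add: r2 field_simps)
qed

lemma walk_step_mean:
  fixes q :: "real ^ 'n"
  shows "(\<Sum>j\<in>UNIV. walk_step \<epsilon> q \<tau> j) /\<^sub>R real CARD('n \<times> bool) = - (\<tau> *\<^sub>R q)"
proof -
  have "walk_step \<epsilon> q \<tau> (i, True) + walk_step \<epsilon> q \<tau> (i, False) = 2 *\<^sub>R (- (\<tau> *\<^sub>R q))" for i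
    unfolding walk_step_def scaleR_2 by simp
  then have "(\<Sum>j\<in>UNIV. walk_step \<epsilon> q \<tau> j) = real CARD('n) *\<^sub>R 2 *\<^sub>R (- (\<tau> *\<^sub>R q))"
    by (simp only: sum_prod_bool sum_constant_scaleR)
  then show ?thesis by simp
qed

lemma norm_walk_step_le:
  fixes q :: "real ^ 'n"
  assumes "0 \<le> \<epsilon>" "0 \<le> \<tau>" "\<tau> \<le> 1"
  shows "norm (walk_step \<epsilon> q \<tau> j) \<le> sqrt \<tau> * (sqrt (2 * real CARD('n) * \<epsilon>) + norm q)"
proof -
  have "sqrt \<tau> \<le> 1" using assms by simp
  then have "\<tau> \<le> sqrt \<tau>" using assms by (metis mult_left_le real_sqrt_ge_zero real_sqrt_mult_self abs_of_nonneg)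
  have "norm (walk_step \<epsilon> q \<tau> j) \<le> sqrt (2 * real CARD('n) * \<epsilon> * \<tau>) + \<tau> * norm q"
    unfolding walk_step_def using assms
    by (intro order_trans[OF norm_triangle_ineq4]) (auto simp: norm_axis_1)
  also have "\<dots> \<le> sqrt (2 * real CARD('n) * \<epsilon>) * sqrt \<tau> + sqrt \<tau> * norm q"
    using \<open>\<tau> \<le> sqrt \<tau>\<close> by (simp add: real_sqrt_mult mult_right_mono)
  finally show ?thesis by (simp add: algebra_simps)
qed

lemma avg_pow_walk_square:
  fixes q :: "real ^ 'n"
  assumes "\<epsilon> \<ge> 0" "\<tau> \<ge> 0"
  shows "(avg (walk_step \<epsilon> q \<tau>) ^^ k) (\<lambda>x. (x - b) \<bullet> (x - b)) x =
     (x - real k *\<^sub>R \<tau> *\<^sub>R q - b) \<bullet> (x - real k *\<^sub>R \<tau> *\<^sub>R q - b) + real k * (2 * real CARD('n) * \<epsilon> * \<tau>)"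
proof (induction k arbitrary: x)
  case (Suc k)
  define st where "st = walk_step \<epsilon> q \<tau>"
  define z where "z = x - real k *\<^sub>R \<tau> *\<^sub>R q - b"
  define K where "K = real k * (2 * real CARD('n) * \<epsilon> * \<tau>)"
  define n where "n = real CARD('n \<times> bool)"
  have n: "n > 0" by (simp add: n_def)
  have m1: "(\<Sum>j\<in>UNIV. st j) /\<^sub>R n = - (\<tau> *\<^sub>R q)" unfolding st_def n_def by (rule walk_step_mean)
  have m2: "(\<Sum>j\<in>UNIV. st j \<bullet> st j) /\<^sub>R n = 2 * \<epsilon> * \<tau> * real CARD('n) + \<tau>\<^sup>2 * (q \<bullet> q)"
    using walk_step_quadratic[OF assms, of q "mat 1"] unfolding st_def n_def by (simp add: trace_mat_1)
  have "(avg st ^^ Suc k) (\<lambda>x. (x - b) \<bullet> (x - b)) x = (\<Sum>j\<in>UNIV. ((z + st j) \<bullet> (z + st j) + K)) /\<^sub>R n"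
    unfolding avg_pow_Suc st_def Suc unfolding z_def K_def n_def
    by (intro arg_cong2[where f = scaleR] sum.cong refl) (simp_all add: algebra_simps)
  also have "\<dots> = (\<Sum>j\<in>UNIV. (z \<bullet> z + K) + 2 * (z \<bullet> st j) + st j \<bullet> st j) /\<^sub>R n"
    by (intro arg_cong2[where f = scaleR] sum.cong refl) (simp add: inner_add_left inner_add_right inner_commute)
  also have "\<dots> = (z \<bullet> z + K) + 2 * (z \<bullet> ((\<Sum>j\<in>UNIV. st j) /\<^sub>R n)) + (\<Sum>j\<in>UNIV. st j \<bullet> st j) /\<^sub>R n"
    using n by (simp add: sum.distrib inner_sum_right sum_distrib_left[symmetric] distrib_left n_def field_simps)
  also have "\<dots> = (z - \<tau> *\<^sub>R q) \<bullet> (z - \<tau> *\<^sub>R q) + (K + 2 * real CARD('n) * \<epsilon> * \<tau>)"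
    unfolding m1 m2 by (simp add: inner_simps power2_eq_square inner_commute algebra_simps)
  also have "z - \<tau> *\<^sub>R q = x - real (Suc k) *\<^sub>R \<tau> *\<^sub>R q - b" by (simp add: z_def algebra_simps)
  also have "K + 2 * real CARD('n) * \<epsilon> * \<tau> = real (Suc k) * (2 * real CARD('n) * \<epsilon> * \<tau>)"
    by (simp add: K_def algebra_simps)
  finally show ?case by (simp add: st_def)
qed simp

text \<open>A modulus of continuity and a bound give \<open>|w y - w x| \<le> e / 2 + C |y - x|^2\<close>, and the second
moment after time \<open>k \<tau>\<close> is \<open>O(k \<tau>)\<close>.  The essential point is uniformity in the step size.\<close>

lemma walk_spread:
  fixes w :: "real ^ 'n \<Rightarrow> real" and q :: "real ^ 'n"
  assumes "uniformly_continuous_on UNIV w" "bounded (range w)" "\<epsilon> \<ge> 0" "e > 0"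
  shows "\<exists>t0>0. \<forall>\<tau>\<ge>0. \<forall>k x. real k * \<tau> \<le> t0 \<longrightarrow> \<bar>(avg (walk_step \<epsilon> q \<tau>) ^^ k) w x - w x\<bar> \<le> e"
proof -
  obtain d where d: "d > 0" "\<And>x x'. dist x' x < d \<Longrightarrow> dist (w x') (w x) < e / 2"
    using assms(1,4) unfolding uniformly_continuous_on_def by (metis UNIV_I half_gt_zero)
  obtain B where B: "B > 0" "\<And>x. \<bar>w x\<bar> \<le> B"
    using assms(2) unfolding bounded_pos by auto
  define C where "C = 2 * B / d\<^sup>2"
  have C: "C > 0" using B d by (simp add: C_def)
  define D where "D = (norm q)\<^sup>2 + 2 * real CARD('n) * \<epsilon> + 1"
  have D: "D > 0" using assms by (simp add: D_def add_nonneg_pos)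
  define t0 where "t0 = min 1 (e / (2 * C * D))"
  have t0: "t0 > 0" using C D assms by (simp add: t0_def)
  have "\<bar>(avg (walk_step \<epsilon> q \<tau>) ^^ k) w x - w x\<bar> \<le> e" if \<tau>: "\<tau> \<ge> 0" "real k * \<tau> \<le> t0" for \<tau> k x
  proof -
    define A where "A = (avg (walk_step \<epsilon> q \<tau>) ^^ k :: (real ^ 'n \<Rightarrow> real) \<Rightarrow> _)"
    define Q where "Q = (\<lambda>y. e / 2 + C * ((y - x) \<bullet> (y - x)))"
    have bd: "\<bar>w y - w x\<bar> \<le> Q y" for y
    proof (cases "dist y x < d")
      case True
      then have "\<bar>w y - w x\<bar> \<le> e / 2" using d(2)[OF True] by (simp add: dist_real_def)
      moreover have "0 \<le> C * ((y - x) \<bullet> (y - x))" using C by simp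
      ultimately show ?thesis unfolding Q_def by linarith
    next
      case False
      then have "d\<^sup>2 \<le> (y - x) \<bullet> (y - x)" using d(1) by (simp add: dist_norm dot_square_norm power_mono)
      then have "C * d\<^sup>2 \<le> C * ((y - x) \<bullet> (y - x))" using C by (intro mult_left_mono) auto
      moreover have "C * d\<^sup>2 = 2 * B" using d by (simp add: C_def)
      moreover have "\<bar>w y - w x\<bar> \<le> 2 * B" using B(2)[of x] B(2)[of y] by linarith
      ultimately show ?thesis using assms(4) by (simp add: Q_def)
    qed
    have s: "A (\<lambda>y. (y - x) \<bullet> (y - x)) x \<le> t0 * D"
    proof -
      define t where "t = real k * \<tau>"
      have t: "0 \<le> t" "t \<le> t0" "t \<le> 1" using \<tau> by (auto simp: t_def t0_def)
      have "A (\<lambda>y. (y - x) \<bullet> (y - x)) x = t\<^sup>2 * (norm q)\<^sup>2 + t * (2 * real CARD('n) * \<epsilon>)"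
        unfolding A_def avg_pow_walk_square[OF assms(3) \<tau>(1)]
        by (simp add: t_def dot_square_norm power2_eq_square algebra_simps)
      also have "\<dots> \<le> t * (norm q)\<^sup>2 + t * (2 * real CARD('n) * \<epsilon>)"
        using t by (simp add: power2_eq_square mult_left_le mult_right_mono)
      also have "\<dots> \<le> t * D" using t by (simp add: D_def algebra_simps)
      also have "\<dots> \<le> t0 * D" using t D by simp
      finally show ?thesis .
    qed
    have "A Q x = e / 2 + C * A (\<lambda>y. (y - x) \<bullet> (y - x)) x"
    proof -
      have "linear (\<lambda>z. C * z)" by (simp add: linear_iff algebra_simps)
      from avg_pow_linear[OF this, of k "walk_step \<epsilon> q \<tau>" "\<lambda>y. (y - x) \<bullet> (y - x)"] show ?thesis
        unfolding A_def Q_def avg_pow_add by simp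
    qed
    also have "\<dots> \<le> e / 2 + C * (t0 * D)" using s C by simp
    also have "\<dots> \<le> e / 2 + C * (e / (2 * C * D) * D)"
      using C D by (intro add_left_mono mult_left_mono mult_right_mono) (auto simp: t0_def)
    also have "\<dots> = e" using C D by (simp add: field_simps)
    finally have "A Q x \<le> e" .
    moreover have "A (\<lambda>y. w y - w x) x \<le> A Q x" "A (\<lambda>y. w x - w y) x \<le> A Q x"
      unfolding A_def by (rule avg_pow_mono; use bd in \<open>fastforce simp: abs_le_iff\<close>)+
    ultimately show ?thesis
      unfolding A_def avg_pow_diff by simp
  qed
  then show ?thesis using t0 by blast
qed

lemma norm_matrix_vector_le:
  fixes N :: "real ^ 'n ^ 'n"
  shows "norm (N *v h) \<le> (real CARD('n))\<^sup>2 * norm N * norm h"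
proof -
  have "\<bar>N $ i $ j\<bar> \<le> norm N" for i j
    using component_le_norm_cart[of "N $ i" j] component_le_norm_cart Finite_Cartesian_Product.norm_nth_le[of N i]
    by (meson order_trans)
  then have "onorm ((*v) N) \<le> real CARD('n) * real CARD('n) * norm N"
    by (rule onorm_le_matrix_component)
  then have "onorm ((*v) N) * norm h \<le> real CARD('n) * real CARD('n) * norm N * norm h"
    by (rule mult_right_mono) simp
  then show ?thesis
    using onorm[OF matrix_vector_mul_bounded_linear[of N], of h] by (simp add: power2_eq_square)
qed

lemma taylor_remainder:
  fixes g :: "real ^ 'n \<Rightarrow> real"
  assumes g: "\<And>x. (g has_derivative (\<lambda>h. G x \<bullet> h)) (at x)"
    and G: "\<And>x. (G has_derivative (\<lambda>h. M x *v h)) (at x)"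
    and M: "\<And>y. norm (y - x) \<le> norm h \<Longrightarrow> norm (M y - M x) \<le> e"
  shows "\<bar>g (x + h) - g x - G x \<bullet> h - (1/2) * (h \<bullet> (M x *v h))\<bar> \<le> (real CARD('n))\<^sup>2 * e * (norm h)\<^sup>2"
proof -
  define K where "K = (real CARD('n))\<^sup>2"
  define k where "k = (\<lambda>t. g (x + t *\<^sub>R h) - t * (G x \<bullet> h) - t\<^sup>2 * ((1/2) * (h \<bullet> (M x *v h))))"
  define k' where "k' = (\<lambda>t. (G (x + t *\<^sub>R h) - G x - M x *v (t *\<^sub>R h)) \<bullet> h)"
  have lin: "((\<lambda>t. x + t *\<^sub>R h) has_derivative (\<lambda>s. s *\<^sub>R h)) (at t)" for t
    by (auto intro!: derivative_eq_intros)
  have "((\<lambda>t. g (x + t *\<^sub>R h)) has_real_derivative G (x + t *\<^sub>R h) \<bullet> h) (at t)" for t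
    by (rule has_derivative_imp_has_field_derivative[OF has_derivative_compose[OF lin g]]) simp
  then have dk: "(k has_real_derivative k' t) (at t)" for t
    unfolding k_def k'_def
    by (auto intro!: derivative_eq_intros simp: inner_diff_left inner_diff_right matrix_vector_mult_scaleR inner_commute power2_eq_square)
  obtain t where t: "0 < t" "t < 1" "k 1 - k 0 = (1 - 0) * k' t"
    using MVT2[of 0 1 k k'] dk by auto
  have small: "norm (s *\<^sub>R h) \<le> norm h" if "0 \<le> s" "s \<le> 1" for s
    using that by (simp add: mult_left_le_one_le)
  have "norm ((G (x + t *\<^sub>R h) - M x *v (x + t *\<^sub>R h)) - (G x - M x *v x)) \<le> K * e * norm (x + t *\<^sub>R h - x)"
  proof (rule differentiable_bound[of "cball x (norm (t *\<^sub>R h))" "\<lambda>y. G y - M x *v y" "\<lambda>y v. M y *v v - M x *v v"])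
    fix y assume y: "y \<in> cball x (norm (t *\<^sub>R h))"
    show "((\<lambda>y. G y - M x *v y) has_derivative (\<lambda>v. M y *v v - M x *v v)) (at y within cball x (norm (t *\<^sub>R h)))"
      by (intro has_derivative_diff has_derivative_at_withinI[OF G]
          bounded_linear_imp_has_derivative matrix_vector_mul_bounded_linear)
    have "norm (y - x) \<le> norm h" using y small[of t] t by (auto simp: dist_norm norm_minus_commute)
    from M[OF this] have e: "norm (M y - M x) \<le> e" .
    show "onorm (\<lambda>v. M y *v v - M x *v v) \<le> K * e"
    proof (rule onorm_bound)
      show "0 \<le> K * e" using order_trans[OF norm_ge_zero e] unfolding K_def by (intro mult_nonneg_nonneg) auto
      fix v
      have "norm ((M y - M x) *v v) \<le> K * norm (M y - M x) * norm v"
        unfolding K_def by (rule norm_matrix_vector_le)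
      also have "\<dots> \<le> K * e * norm v" using e by (intro mult_right_mono mult_left_mono) (auto simp: K_def)
      finally show "norm (M y *v v - M x *v v) \<le> K * e * norm v"
        by (simp add: matrix_vector_mult_diff_rdistrib)
    qed
  qed (auto simp: dist_norm)
  then have *: "norm (G (x + t *\<^sub>R h) - G x - M x *v (t *\<^sub>R h)) \<le> K * e * norm (t *\<^sub>R h)"
    by (simp add: matrix_vector_right_distrib algebra_simps)
  have Ke: "0 \<le> K * e" using M[of x] by (simp add: K_def)
  have "\<bar>k' t\<bar> \<le> norm (G (x + t *\<^sub>R h) - G x - M x *v (t *\<^sub>R h)) * norm h"
    unfolding k'_def by (rule Cauchy_Schwarz_ineq2)
  also have "\<dots> \<le> K * e * norm h * norm h"
    using * small[of t] t Ke by (intro mult_right_mono order_trans[OF *] mult_left_mono) auto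
  finally show ?thesis using t(3) by (simp add: k_def K_def power2_eq_square)
qed

text \<open>One averaging step to first order, uniformly in the point.  Since averages contract the sup
norm, the same error bound holds for every iterate of the step.\<close>

lemma walk_consistency:
  fixes g :: "real ^ 'n \<Rightarrow> real"
  assumes g: "\<And>x. (g has_derivative (\<lambda>h. G x \<bullet> h)) (at x)"
    and G: "\<And>x. (G has_derivative (\<lambda>h. M x *v h)) (at x)"
    and M: "uniformly_continuous_on UNIV M" "bounded (range M)"
    and eps: "\<epsilon> > 0" and e: "e > 0"
  shows "\<exists>\<tau>0>0. \<forall>\<tau>>0. \<tau> \<le> \<tau>0 \<longrightarrow> (\<forall>x. \<bar>avg (walk_step \<epsilon> q \<tau>) g x - g x - \<tau> * (\<epsilon> * trace (M x) - q \<bullet> G x)\<bar> \<le> \<tau> * e)"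
proof -
  define K where "K = (real CARD('n))\<^sup>2"
  define L where "L = sqrt (2 * real CARD('n) * \<epsilon>) + norm q"
  have L: "L > 0" using eps by (simp add: L_def add_pos_nonneg)
  have K: "K > 0" by (simp add: K_def)
  obtain B where B: "B > 0" "\<And>x. norm (M x) \<le> B" using M(2) unfolding bounded_pos by auto
  define e1 where "e1 = e / (2 * K * L\<^sup>2)"
  have e1: "e1 > 0" using e K L by (simp add: e1_def)
  then obtain d where d: "d > 0" "\<And>x x'. dist x' x < d \<Longrightarrow> dist (M x') (M x) < e1"
    using M(1) unfolding uniformly_continuous_on_def by (metis UNIV_I)
  define D where "D = norm q * (K * B * norm q)"
  have D: "D \<ge> 0" using K B by (simp add: D_def)
  define \<tau>0 where "\<tau>0 = min 1 (min (e / (D + 1)) ((d / (2 * L))\<^sup>2))"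
  have "\<tau>0 > 0" using d e D L by (simp add: \<tau>0_def add_nonneg_pos)
  moreover have "\<bar>avg (walk_step \<epsilon> q \<tau>) g x - g x - \<tau> * (\<epsilon> * trace (M x) - q \<bullet> G x)\<bar> \<le> \<tau> * e"
    if \<tau>: "\<tau> > 0" "\<tau> \<le> \<tau>0" for \<tau> x
  proof -
    define st where "st = walk_step \<epsilon> q \<tau>"
    define n where "n = real CARD('n \<times> bool)"
    have n: "n > 0" by (simp add: n_def)
    have nst: "norm (st j) \<le> sqrt \<tau> * L" for j
      unfolding st_def L_def using \<tau> eps by (intro norm_walk_step_le) (auto simp: \<tau>0_def)
    have "sqrt \<tau> \<le> sqrt ((d / (2 * L))\<^sup>2)" using \<tau> unfolding \<tau>0_def by (intro real_sqrt_le_mono) auto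
    then have "sqrt \<tau> \<le> d / (2 * L)" using d L by simp
    then have "sqrt \<tau> * L \<le> d / 2" using L by (simp add: field_simps)
    then have std: "norm (st j) < d" for j using nst[of j] d by linarith
    define R where "R = (\<lambda>j. g (x + st j) - g x - G x \<bullet> st j - (1/2) * (st j \<bullet> (M x *v st j)))"
    have R: "\<bar>R j\<bar> \<le> \<tau> * (e / 2)" for j
    proof -
      have "\<bar>R j\<bar> \<le> K * e1 * (norm (st j))\<^sup>2"
        unfolding R_def K_def
      proof (rule taylor_remainder[OF g G])
        fix y assume "norm (y - x) \<le> norm (st j)"
        then have "dist y x < d" using std[of j] by (simp add: dist_norm)
        then show "norm (M y - M x) \<le> e1" using d(2) by (force simp: dist_norm)
      qed
      also have "\<dots> \<le> K * e1 * (sqrt \<tau> * L)\<^sup>2"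
        using K e1 nst[of j] by (intro mult_left_mono power_mono) auto
      also have "\<dots> = \<tau> * (e / 2)" using \<tau> K L by (simp add: e1_def power_mult_distrib)
      finally show ?thesis .
    qed
    have m1: "(\<Sum>j\<in>UNIV. st j) /\<^sub>R n = - (\<tau> *\<^sub>R q)" unfolding st_def n_def by (rule walk_step_mean)
    have m2: "(\<Sum>j\<in>UNIV. st j \<bullet> (M x *v st j)) /\<^sub>R n = 2 * \<epsilon> * \<tau> * trace (M x) + \<tau>\<^sup>2 * (q \<bullet> (M x *v q))"
      unfolding st_def n_def using eps \<tau> by (intro walk_step_quadratic) auto
    have "avg st g x = (\<Sum>j\<in>UNIV. g x + G x \<bullet> st j + (1/2) * (st j \<bullet> (M x *v st j)) + R j) /\<^sub>R n"
      unfolding avg_def R_def n_def by simp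
    also have "\<dots> = g x + G x \<bullet> ((\<Sum>j\<in>UNIV. st j) /\<^sub>R n) + (1/2) * ((\<Sum>j\<in>UNIV. st j \<bullet> (M x *v st j)) /\<^sub>R n) + (\<Sum>j\<in>UNIV. R j) /\<^sub>R n"
    proof -
      have "(\<Sum>j\<in>UNIV. g x + G x \<bullet> st j + (1/2) * (st j \<bullet> (M x *v st j)) + R j) =
          n * g x + G x \<bullet> (\<Sum>j\<in>UNIV. st j) + (1/2) * (\<Sum>j\<in>UNIV. st j \<bullet> (M x *v st j)) + (\<Sum>j\<in>UNIV. R j)"
        unfolding sum.distrib inner_sum_right n_def sum_distrib_left by simp
      then show ?thesis using n by (simp add: field_simps)
    qed
    finally have A: "avg st g x - g x - \<tau> * (\<epsilon> * trace (M x) - q \<bullet> G x) = (1/2) * \<tau>\<^sup>2 * (q \<bullet> (M x *v q)) + (\<Sum>j\<in>UNIV. R j) /\<^sub>R n"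
      unfolding m1 m2 by (simp add: algebra_simps inner_commute)
    have "norm (\<Sum>j\<in>UNIV. R j) \<le> (\<Sum>j\<in>(UNIV::('n\<times>bool) set). \<tau> * (e / 2))"
      using R by (intro sum_norm_le) auto
    then have "\<bar>\<Sum>j\<in>UNIV. R j\<bar> \<le> n * (\<tau> * (e / 2))" by (simp add: n_def)
    then have r1: "\<bar>(\<Sum>j\<in>UNIV. R j) /\<^sub>R n\<bar> \<le> \<tau> * (e / 2)"
      using n by (simp add: abs_mult field_simps)
    have "\<bar>q \<bullet> (M x *v q)\<bar> \<le> norm q * norm (M x *v q)" by (rule Cauchy_Schwarz_ineq2)
    also have "\<dots> \<le> norm q * (K * norm (M x) * norm q)"
      unfolding K_def by (intro mult_left_mono norm_matrix_vector_le) auto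
    also have "\<dots> \<le> D" unfolding D_def using B K by (intro mult_left_mono mult_right_mono) auto
    finally have q: "\<bar>q \<bullet> (M x *v q)\<bar> \<le> D" .
    have "\<tau> \<le> e / (D + 1)" using \<tau> by (simp add: \<tau>0_def)
    then have "\<tau> * (D + 1) \<le> e" using D by (simp add: field_simps)
    then have "\<tau> * D \<le> e" using \<tau> by (simp add: algebra_simps)
    have "\<bar>(1/2) * \<tau>\<^sup>2 * (q \<bullet> (M x *v q))\<bar> = (1/2) * \<tau> * (\<tau> * \<bar>q \<bullet> (M x *v q)\<bar>)"
      using \<tau> by (simp add: abs_mult power2_eq_square)
    also have "\<dots> \<le> (1/2) * \<tau> * (\<tau> * D)" using \<tau> q by (intro mult_left_mono) auto
    also have "\<dots> \<le> (1/2) * \<tau> * e" using \<tau> \<open>\<tau> * D \<le> e\<close> by (intro mult_left_mono) auto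
    finally show ?thesis unfolding A[unfolded st_def] using r1 by simp
  qed
  ultimately show ?thesis by blast
qed

section \<open>Mollification of viscosity subsolutions\<close>

text \<open>Viscosity form of \<open>q \<bullet> Du - \<epsilon> \<Delta>u \<le> H\<close>, a linear inequality with constant coefficients.\<close>

definition drift_sub ::
  "real \<Rightarrow> real ^ 'n \<Rightarrow> real \<Rightarrow> (real ^ 'n) set \<Rightarrow> (real ^ 'n \<Rightarrow> real) \<Rightarrow> bool" where
  "drift_sub \<epsilon> q H S u \<longleftrightarrow> (\<forall>x\<in>S. \<forall>\<phi> G M. jet_at \<phi> G M x \<longrightarrow>
     (\<forall>\<^sub>F y in nhds x. u y - \<phi> y \<le> u x - \<phi> x) \<longrightarrow> q \<bullet> G x - \<epsilon> * trace M \<le> H)"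

lemma linear_scaled_trace: "linear (\<lambda>N :: real ^ 'n ^ 'n. \<epsilon> * trace N)"
  by (auto simp: linear_iff trace_add trace_scaleR algebra_simps)

lemma avg_pow_generator:
  fixes G :: "real ^ 'n \<Rightarrow> real ^ 'n" and M :: "real ^ 'n \<Rightarrow> real ^ 'n ^ 'n" and st :: "'i::finite \<Rightarrow> real ^ 'n"
  shows "(avg st ^^ k) (\<lambda>x. \<epsilon> * trace (M x) - q \<bullet> G x) x = \<epsilon> * trace ((avg st ^^ k) M x) - q \<bullet> (avg st ^^ k) G x"
proof -
  have l1: "linear (\<lambda>N :: real ^ 'n ^ 'n. \<epsilon> * trace N)" by (rule linear_scaled_trace)
  have l2: "linear (\<lambda>v. q \<bullet> v)" by (simp add: linear_iff inner_simps)
  show ?thesis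
    using avg_pow_linear[OF l1, of k st M] avg_pow_linear[OF l2, of k st G]
    by (simp add: avg_pow_diff)
qed

text \<open>A small multiple of this function compensates errors on the sphere of radius \<open>R\<close> and has no effect
in the ball of half the radius.\<close>

lemma barrier_exists:
  fixes a :: "real ^ 'n"
  assumes "R > 0"
  shows "\<exists>\<eta> G M. C2_fun \<eta> G M \<and> (\<forall>x. \<eta> x \<ge> 0) \<and>
    (\<forall>x. norm (x - a) \<le> R / 2 \<longrightarrow> \<eta> x = 0) \<and> (\<forall>x. norm (x - a) = R \<longrightarrow> \<eta> x = 1)"
proof -
  define \<rho> where "\<rho> = R / 2"
  \<comment> \<open>normalises the value on the sphere of radius R to 1\<close>
  define c where "c = 1 / (3 * R\<^sup>2 / 4) ^ 3"
  have c: "c > 0" using assms by (simp add: c_def)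
  define \<eta> where "\<eta> = (\<lambda>x. c * bump (-1) \<rho> (x - a))"
  define G where "G = (\<lambda>x. c *\<^sub>R bump_grad (-1) \<rho> (x - a))"
  define D where "D = (\<lambda>x. c *\<^sub>R bump_hess (-1) \<rho> (x - a))"
  define M where "M = (\<lambda>x. matrix (blinfun_apply (D x)) :: real ^ 'n ^ 'n)"
  have sh: "((\<lambda>x. x - a) has_derivative (\<lambda>h. h)) (at x)" for x by (auto intro!: derivative_eq_intros)
  have "(\<eta> has_derivative (\<lambda>h. G x \<bullet> h)) (at x)" for x
    using has_derivative_mult_right[OF has_derivative_compose[OF sh[of x] bump_has_derivative[of "-1" \<rho> "x - a"]], of c]
    unfolding \<eta>_def G_def by simp
  moreover have "(G has_derivative (\<lambda>h. M x *v h)) (at x)" for x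
  proof -
    have "(\<lambda>h. M x *v h) = blinfun_apply (D x)"
      unfolding M_def by (rule matrix_vector_mul(3)[OF blinfun.bounded_linear_right])
    moreover have "(G has_derivative blinfun_apply (D x)) (at x)"
      using has_derivative_scaleR_right[OF has_derivative_compose[OF sh[of x] bump_grad_has_derivative[of "-1" \<rho> "x - a"]], of c]
      unfolding G_def D_def by (simp add: scaleR_blinfun.rep_eq)
    ultimately show ?thesis by simp
  qed
  moreover have cD: "continuous_on UNIV D"
    unfolding D_def by (intro continuous_intros continuous_on_compose2[OF bump_continuous(3)]) auto
  moreover have "continuous_on UNIV M"
    unfolding M_def matrix_def
    by (intro continuous_on_vec_lambda continuous_intros blinfun.continuous_on cD)
  moreover have "\<eta> x \<ge> 0" for x using c by (simp add: \<eta>_def bump_def)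
  moreover have "\<eta> x = 0" if "norm (x - a) \<le> R / 2" for x
  proof -
    have "(norm (x - a))\<^sup>2 \<le> (R / 2)\<^sup>2" using that by (intro power_mono) auto
    then show ?thesis by (simp add: \<eta>_def bump_def \<rho>_def dot_square_norm)
  qed
  moreover have "\<eta> x = 1" if "norm (x - a) = R" for x
  proof -
    have "(x - a) \<bullet> (x - a) = R\<^sup>2" using that by (simp add: dot_square_norm)
    then have "bump (-1) \<rho> (x - a) = (3 * R\<^sup>2 / 4) ^ 3"
      using assms by (simp add: bump_def \<rho>_def power_divide)
    then show ?thesis using assms by (simp add: \<eta>_def c_def)
  qed
  ultimately show ?thesis
    by (intro exI[of _ \<eta>] exI[of _ G] exI[of _ M]) (simp add: C2_fun_def)
qed

lemma mollification_approx:
  fixes u :: "real ^ 'n \<Rightarrow> real"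
  assumes u: "continuous_on UNIV u" and us: "\<forall>x. norm x > B \<longrightarrow> u x = 0" and m: "m > 0"
  shows "\<exists>g G M. C2_fun g G M \<and> uniformly_continuous_on UNIV M \<and> bounded (range M) \<and>
    uniformly_continuous_on UNIV G \<and> bounded (range G) \<and> (\<forall>x. \<bar>u x - g x\<bar> \<le> m)"
proof -
  obtain \<sigma> where \<sigma>: "\<sigma> > 0" "\<And>x x'. dist x' x < \<sigma> \<Longrightarrow> dist (u x') (u x) < m"
    using uniformly_continuous_compact_support(1)[OF u us[rule_format]] m unfolding uniformly_continuous_on_def by (metis UNIV_I)
  obtain \<rho> a b g G M where
    \<rho>0: "continuous_on UNIV \<rho>" "\<forall>y. \<rho> y \<ge> 0" "\<forall>y. norm y \<ge> \<sigma> \<longrightarrow> \<rho> y = 0" "integral (cbox a b) \<rho> = 1" and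
    g: "\<forall>x. g x = integral (cbox a b) (\<lambda>y. \<rho> y * u (x - y))" and
    C2: "C2_fun g G M" and z: "\<forall>x. norm x > B + \<sigma> \<longrightarrow> g x = 0 \<and> G x = 0 \<and> M x = 0"
    using mollification[where B = B, OF u us \<sigma>(1)] by (elim exE conjE) (rule that; assumption)
  note \<rho> = \<rho>0(1) \<rho>0(2)[rule_format] \<rho>0(3)[rule_format] \<rho>0(4)
  note ucs = uniformly_continuous_compact_support[where B = "B + \<sigma>"]
  have "\<bar>u x - g x\<bar> \<le> m" for x
  proof -
    have near: "\<bar>u (x - y) - u x\<bar> \<le> m" if "norm y < \<sigma>" for y
      using \<sigma>(2)[of "x - y" x] that by (simp add: dist_norm)
    have "integral (cbox a b) (\<lambda>y. \<rho> y * (\<lambda>_. u x) (x - y)) = u x"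
      using \<rho>(4) by simp
    moreover have "g x \<le> integral (cbox a b) (\<lambda>y. \<rho> y * (\<lambda>_. u x) (x - y)) + m"
      unfolding g[rule_format] by (rule mollification_close[OF \<rho> u]) (use near in \<open>force simp: abs_le_iff\<close>)+
    moreover have "integral (cbox a b) (\<lambda>y. \<rho> y * (\<lambda>_. u x) (x - y)) \<le> g x + m"
      unfolding g[rule_format] by (rule mollification_close[OF \<rho> _ u]) (use near in \<open>force simp: abs_le_iff\<close>)+
    ultimately show ?thesis by linarith
  qed
  then show ?thesis
    using C2 ucs[OF C2_funD(5)[OF C2]] ucs[OF C2_funD(4)[OF C2]] z
    by (intro exI[of _ g] exI[of _ G] exI[of _ M]) simp
qed

text \<open>For a smooth subsolution of \<open>- L u \<le> H\<close> the semigroup \<open>S_t\<close> of \<open>L\<close> gives \<open>u \<le> S_t u + t H\<close>.  For a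
viscosity subsolution the inequality is obtained up to \<open>t e\<close> on a smaller ball, with the random
walk in place of the semigroup.

The data are first smoothed to \<open>g\<close> with error \<open>m \<le> t e / 8\<close>, and \<open>u\<close> is compared with the iterates
\<open>A_k g\<close> by induction on \<open>k\<close>: at an interior maximum of \<open>u - A_(k+1) g - 3 \<delta> \<eta>\<close> the definition of a
subsolution bounds \<open>- L A_(k+1) g\<close>, hence \<open>A_k g - A_(k+1) g\<close>, from above.  On the boundary sphere
\<open>u\<close> and \<open>A_k g\<close> differ by at most \<open>2 \<delta>\<close>, where \<open>\<delta>\<close> is small for small \<open>t\<close>, and \<open>3 \<delta> \<eta>\<close> dominates.
The cost of the barrier in the equation is \<open>3 \<delta> \<Lambda> = e / 4\<close> per unit of time.\<close>

lemma walk_domination: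
  fixes u :: "real ^ 'n \<Rightarrow> real"
  assumes u: "continuous_on UNIV u" and us: "\<forall>x. norm x > B \<longrightarrow> u x = 0" and eps: "\<epsilon> > 0"
    and sub: "drift_sub \<epsilon> q H (ball a R) u" and R: "R > 0" and e: "e > 0"
  shows "\<exists>t1>0. \<forall>t>0. t \<le> t1 \<longrightarrow> (\<exists>\<tau>0>0. \<forall>\<tau>>0. \<forall>N. \<tau> \<le> \<tau>0 \<longrightarrow> real N * \<tau> = t \<longrightarrow>
     (\<forall>x\<in>cball a (R / 2). u x \<le> (avg (walk_step \<epsilon> q \<tau>) ^^ N) u x + t * (H + e)))"
proof -
  obtain \<eta> G\<eta> M\<eta> where C\<eta>: "C2_fun \<eta> G\<eta> M\<eta>" and \<eta>_nonneg: "\<forall>x. \<eta> x \<ge> 0"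
    and \<eta>_in: "\<forall>x. norm (x - a) \<le> R / 2 \<longrightarrow> \<eta> x = 0" and \<eta>_bd: "\<forall>x. norm (x - a) = R \<longrightarrow> \<eta> x = 1"
    using barrier_exists[OF R, of a] by (elim exE conjE) (rule that; assumption)
  define L\<eta> where "L\<eta> = (\<lambda>x. \<epsilon> * trace (M\<eta> x) - q \<bullet> G\<eta> x)"
  have "continuous_on UNIV L\<eta>" unfolding L\<eta>_def by (intro continuous_intros C2_funD[OF C\<eta>])
  then have "bounded (L\<eta> ` cball a R)"
    by (intro compact_imp_bounded compact_continuous_image) (auto intro: continuous_on_subset)
  then obtain \<Lambda> where \<Lambda>: "\<Lambda> > 0" "\<And>x. x \<in> cball a R \<Longrightarrow> \<bar>L\<eta> x\<bar> \<le> \<Lambda>"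
    unfolding bounded_pos by auto
  have c\<eta>: "continuous_on UNIV \<eta>" by (rule C2_funD[OF C\<eta>])
  \<comment> \<open>makes the total contribution of the barrier equal to e / 4\<close>
  define \<delta> where "\<delta> = e / (12 * \<Lambda>)"
  have \<delta>: "\<delta> > 0" "3 * \<delta> * \<Lambda> = e / 4" using e \<Lambda> by (auto simp: \<delta>_def)
  obtain t0 where t0: "t0 > 0"
    "\<And>\<tau> k x. \<tau> \<ge> 0 \<Longrightarrow> real k * \<tau> \<le> t0 \<Longrightarrow> \<bar>(avg (walk_step \<epsilon> q \<tau>) ^^ k) u x - u x\<bar> \<le> \<delta>"
    using walk_spread[OF uniformly_continuous_compact_support[OF u us[rule_format]] _ \<delta>(1), where \<epsilon> = \<epsilon> and q = q] eps by (metis less_imp_le)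
  define t1 where "t1 = min t0 (\<delta> / (\<bar>H\<bar> + 1))"
  have t1: "t1 > 0" "t1 \<le> t0" using t0 \<delta> by (auto simp: t1_def)
  have t1H: "t * \<bar>H\<bar> \<le> \<delta>" if "0 \<le> t" "t \<le> t1" for t
  proof -
    have "t * (\<bar>H\<bar> + 1) \<le> \<delta>" using that by (simp add: t1_def field_simps)
    then show ?thesis using that by (simp add: algebra_simps)
  qed
  have "\<exists>\<tau>0>0. \<forall>\<tau>>0. \<forall>N. \<tau> \<le> \<tau>0 \<longrightarrow> real N * \<tau> = t \<longrightarrow>
     (\<forall>x\<in>cball a (R / 2). u x \<le> (avg (walk_step \<epsilon> q \<tau>) ^^ N) u x + t * (H + e))"
    if t: "t > 0" "t \<le> t1" for t
  proof -
    define m where "m = min \<delta> (t * e / 8)"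
    have m: "m > 0" "m \<le> \<delta>" "m \<le> t * e / 8" using \<delta> t e by (auto simp: m_def)
    obtain g G M where C2: "C2_fun g G M"
      and M: "uniformly_continuous_on UNIV M" "bounded (range M)" "uniformly_continuous_on UNIV G" "bounded (range G)"
      and ug: "\<forall>x. \<bar>u x - g x\<bar> \<le> m"
      using mollification_approx[where B = B, OF u us m(1)] by (elim exE conjE) (rule that; assumption)
    note g = C2_funD(1,2)[OF C2]
    define w where "w = (\<lambda>x. \<epsilon> * trace (M x) - q \<bullet> G x)"
    have bl: "bounded_linear (\<lambda>N :: real ^ 'n ^ 'n. \<epsilon> * trace N)"
      using linear_scaled_trace linear_conv_bounded_linear by blast
    have uw: "uniformly_continuous_on UNIV w"
      unfolding w_def by (intro uniformly_continuous_on_diff bounded_linear.uniformly_continuous_on[OF bl]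
          bounded_linear.uniformly_continuous_on[OF bounded_linear_inner_right] M)
    have bw: "bounded (range w)"
      unfolding w_def
      using bounded_minus_comp[OF bounded_linear_image[OF M(2) bl, unfolded image_image]
          bounded_linear_image[OF M(4) bounded_linear_inner_right[of q], unfolded image_image]] .
    have e8: "e / 8 > 0" using e by simp
    obtain \<tau>1 where \<tau>1: "\<tau>1 > 0" "\<And>\<tau> x. \<tau> > 0 \<Longrightarrow> \<tau> \<le> \<tau>1 \<Longrightarrow> \<bar>avg (walk_step \<epsilon> q \<tau>) g x - g x - \<tau> * w x\<bar> \<le> \<tau> * (e / 8)"
      using walk_consistency[OF g M(1,2) eps e8, where q = q] unfolding w_def by metis
    obtain \<tau>2 where \<tau>2: "\<tau>2 > 0" "\<And>\<tau> k x. \<tau> \<ge> 0 \<Longrightarrow> real k * \<tau> \<le> \<tau>2 \<Longrightarrow> \<bar>(avg (walk_step \<epsilon> q \<tau>) ^^ k) w x - w x\<bar> \<le> e / 8"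
      using walk_spread[OF uw bw _ e8, where \<epsilon> = \<epsilon> and q = q] eps by (metis less_imp_le)
    define \<tau>0 where "\<tau>0 = min \<tau>1 \<tau>2"
    have "\<tau>0 > 0" using \<tau>1 \<tau>2 by (simp add: \<tau>0_def)
    moreover have "u x \<le> (avg (walk_step \<epsilon> q \<tau>) ^^ N) u x + t * (H + e)"
      if \<tau>: "\<tau> > 0" "\<tau> \<le> \<tau>0" and N: "real N * \<tau> = t" and x: "x \<in> cball a (R / 2)" for \<tau> N x
    proof -
      define st where "st = walk_step \<epsilon> q \<tau>"
      define A where "A = (\<lambda>k. (avg st ^^ k) g)"
      define E where "E = H + 3 * \<delta> * \<Lambda> + e / 4"
      have kt: "real k * \<tau> \<le> t" if "k \<le> N" for k using that \<tau> N by (metis mult_right_mono of_nat_le_iff less_imp_le)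
      have jump: "\<bar>A (Suc k) x - A k x - \<tau> * (avg st ^^ k) w x\<bar> \<le> \<tau> * (e / 8)" for k x
      proof -
        have "norm ((avg st ^^ k) (\<lambda>x. avg st g x - g x - \<tau> * w x) x) \<le> \<tau> * (e / 8)"
          using \<tau>1(2)[of \<tau>] \<tau> by (intro avg_pow_norm_le) (simp add: st_def \<tau>0_def)
        moreover have "linear (\<lambda>z::real. \<tau> * z)" by (simp add: linear_iff algebra_simps)
        ultimately show ?thesis
          by (simp add: avg_pow_diff avg_pow_linear A_def funpow_swap1[symmetric])
      qed
      have drift: "\<bar>(avg st ^^ Suc k) w x - (avg st ^^ k) w x\<bar> \<le> e / 8" for k x
      proof -
        have "norm ((avg st ^^ k) (\<lambda>x. avg st w x - w x) x) \<le> e / 8"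
          using \<tau>2(2)[of \<tau> 1] \<tau> by (intro avg_pow_norm_le) (simp add: st_def \<tau>0_def)
        then show ?thesis by (simp add: avg_pow_diff funpow_swap1[symmetric])
      qed
      have close: "u x - A k x \<le> 2 * \<delta>" if "k \<le> N" for k x
      proof -
        have "\<bar>(avg st ^^ k) u x - u x\<bar> \<le> \<delta>"
          unfolding st_def using kt[OF that] \<tau> t t1 by (intro t0) auto
        moreover have "norm ((avg st ^^ k) (\<lambda>x. u x - g x) x) \<le> m"
          using ug by (intro avg_pow_norm_le) simp
        ultimately show ?thesis using m(2) unfolding A_def avg_pow_diff by simp
      qed
      have main: "\<forall>x\<in>cball a R. u x \<le> A k x + m + real k * \<tau> * E + 3 * \<delta> * \<eta> x" if "k \<le> N" for k
        using that
      proof (induction k)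
        case 0
        have "u x \<le> g x + m" "0 \<le> 3 * \<delta> * \<eta> x" for x
          using ug[rule_format, of x] \<eta>_nonneg \<delta> by (auto simp: abs_le_iff)
        then show ?case by (force simp: A_def intro: add_increasing2)
      next
        case (Suc k)
        have IH: "\<forall>x\<in>cball a R. u x \<le> A k x + m + real k * \<tau> * E + 3 * \<delta> * \<eta> x" using Suc by simp
        define \<psi> where "\<psi> = (\<lambda>x. A (Suc k) x + 3 * \<delta> * \<eta> x)"
        have cA: "continuous_on UNIV (A (Suc k))"
          unfolding A_def by (intro avg_pow_continuous C2_funD[OF C2])
        have "continuous_on (cball a R) (\<lambda>x. u x - \<psi> x)"
          unfolding \<psi>_def by (intro continuous_intros continuous_on_subset[OF u] continuous_on_subset[OF cA]
              continuous_on_subset[OF c\<eta>]) auto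
        then obtain z where z: "z \<in> cball a R" "\<And>y. y \<in> cball a R \<Longrightarrow> u y - \<psi> y \<le> u z - \<psi> z"
          using continuous_attains_sup[of "cball a R" "\<lambda>x. u x - \<psi> x"] R by auto
        have "u z - \<psi> z \<le> m + real (Suc k) * \<tau> * E"
        proof (cases "norm (z - a) = R")
          case True
          then have "u z - \<psi> z \<le> - \<delta>" using close[OF Suc.prems, of z] \<eta>_bd by (simp add: \<psi>_def)
          also have "\<dots> \<le> - (real (Suc k) * \<tau> * \<bar>H\<bar>)"
            using t1H[of "real (Suc k) * \<tau>"] kt[OF Suc.prems] \<tau> t by simp
          also have "\<dots> \<le> real (Suc k) * \<tau> * H"
            using \<tau> mult_left_mono[of "- \<bar>H\<bar>" H "real (Suc k) * \<tau>"] by simp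
          also have "\<dots> \<le> real (Suc k) * \<tau> * E"
            using \<tau> e \<delta> \<Lambda> by (intro mult_left_mono) (auto simp: E_def)
          finally show ?thesis using m by simp
        next
          case False
          then have zb: "z \<in> ball a R" using z(1) by (auto simp: dist_norm norm_minus_commute)
          have "\<forall>\<^sub>F y in nhds z. y \<in> ball a R" by (rule eventually_nhds_in_open[OF open_ball zb])
          then have ev: "\<forall>\<^sub>F y in nhds z. u y - \<psi> y \<le> u z - \<psi> z"
            by eventually_elim (use z(2) in auto)
          define G\<psi> where "G\<psi> = (\<lambda>x. (avg st ^^ Suc k) G x + (3 * \<delta>) *\<^sub>R G\<eta> x)"
          define M\<psi> where "M\<psi> = (avg st ^^ Suc k) M z + (3 * \<delta>) *\<^sub>R M\<eta> z"
          have "jet_at \<psi> G\<psi> M\<psi> z"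
            unfolding jet_at_def
          proof
            have "(\<psi> has_derivative (\<lambda>h. (avg st ^^ Suc k) G y \<bullet> h + 3 * \<delta> * (G\<eta> y \<bullet> h))) (at y)" for y
              unfolding \<psi>_def A_def
              by (intro has_derivative_add avg_pow_has_derivative_gradient g has_derivative_mult_right C2_funD(1)[OF C\<eta>])
            moreover have "(\<lambda>h. (avg st ^^ Suc k) G y \<bullet> h + 3 * \<delta> * (G\<eta> y \<bullet> h)) = (\<lambda>h. G\<psi> y \<bullet> h)" for y
              by (rule ext) (simp add: G\<psi>_def inner_add_left del: funpow.simps)
            ultimately show "\<forall>\<^sub>F y in nhds z. (\<psi> has_derivative (\<lambda>h. G\<psi> y \<bullet> h)) (at y)" by simp
            have "(G\<psi> has_derivative (\<lambda>h. (avg st ^^ Suc k) M z *v h + (3 * \<delta>) *\<^sub>R (M\<eta> z *v h))) (at z)"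
              unfolding G\<psi>_def
              by (intro has_derivative_add avg_pow_has_derivative_hessian g has_derivative_scaleR_right C2_funD(2)[OF C\<eta>])
            moreover have "(\<lambda>h. (avg st ^^ Suc k) M z *v h + (3 * \<delta>) *\<^sub>R (M\<eta> z *v h)) = (\<lambda>h. M\<psi> *v h)"
              by (rule ext) (simp add: M\<psi>_def matrix_vector_mult_add_rdistrib scaleR_matrix_vector_assoc[symmetric] del: funpow.simps)
            ultimately show "(G\<psi> has_derivative (\<lambda>h. M\<psi> *v h)) (at z)" by simp
          qed
          then have "q \<bullet> G\<psi> z - \<epsilon> * trace M\<psi> \<le> H"
            using sub zb ev unfolding drift_sub_def by blast
          moreover have "q \<bullet> G\<psi> z - \<epsilon> * trace M\<psi> = - (avg st ^^ Suc k) w z - 3 * \<delta> * L\<eta> z"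
            unfolding w_def avg_pow_generator L\<eta>_def G\<psi>_def M\<psi>_def
            by (simp add: trace_add trace_scaleR inner_add_right algebra_simps del: funpow.simps)
          moreover have "3 * \<delta> * L\<eta> z \<le> 3 * \<delta> * \<Lambda>"
            using \<Lambda>(2)[OF z(1)] \<delta> by (intro mult_left_mono) auto
          ultimately have "- (avg st ^^ Suc k) w z \<le> H + 3 * \<delta> * \<Lambda>" by linarith
          then have "- (avg st ^^ k) w z \<le> H + 3 * \<delta> * \<Lambda> + e / 8"
            using drift[of k z] by linarith
          then have "\<tau> * - (avg st ^^ k) w z \<le> \<tau> * (H + 3 * \<delta> * \<Lambda> + e / 8)"
            using \<tau> by (intro mult_left_mono) auto
          moreover have "\<tau> * (H + 3 * \<delta> * \<Lambda> + e / 8) + \<tau> * (e / 8) = \<tau> * E" by (simp add: E_def algebra_simps)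
          ultimately have "A k z - A (Suc k) z \<le> \<tau> * E" using jump[of k z] by linarith
          moreover have "u z \<le> A k z + m + real k * \<tau> * E + 3 * \<delta> * \<eta> z" using IH z(1) by blast
          ultimately show ?thesis unfolding \<psi>_def by (simp add: algebra_simps del: funpow.simps)
        qed
        then show ?case
          using z(2) unfolding \<psi>_def by fastforce
      qed
      have "x \<in> cball a R" "\<eta> x = 0" using x R \<eta>_in by (auto simp: dist_norm norm_minus_commute)
      then have "u x \<le> A N x + m + t * E" using main[of N] N by fastforce
      moreover have "A N x \<le> (avg st ^^ N) u x + m"
      proof -
        have "norm ((avg st ^^ N) (\<lambda>x. u x - g x) x) \<le> m"
          using ug by (intro avg_pow_norm_le) simp
        then show ?thesis unfolding A_def avg_pow_diff by simp
      qed
      moreover have "E = H + e / 2" using \<delta>(2) unfolding E_def by linarith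
      then have "t * E = t * H + t * e / 2" by (simp add: algebra_simps)
      moreover have "t * e > 0" using t e by simp
      ultimately show ?thesis using m(3) unfolding st_def by (simp add: distrib_left)
    qed
    ultimately show ?thesis by blast
  qed
  then show ?thesis using t1 by blast
qed

text \<open>Convolving the inequality of \<open>walk_domination\<close> with the kernel gives the same inequality for the
smooth function \<open>g\<close>.  For it the walk can be expanded: \<open>A_N g - g\<close> is \<open>t (L g + o(1))\<close>, and division
by \<open>t\<close> yields the pointwise inequality.\<close>

lemma mollification_drift:
  fixes u :: "real ^ 'n \<Rightarrow> real"
  assumes u: "continuous_on UNIV u" and us: "\<forall>x. norm x > B \<longrightarrow> u x = 0" and eps: "\<epsilon> > 0"
    and sub: "drift_sub \<epsilon> q H (ball a R) u" and R: "R > 0"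
    and \<rho>: "continuous_on UNIV \<rho>" "\<And>y. \<rho> y \<ge> 0" "\<And>y. norm y \<ge> \<sigma> \<Longrightarrow> \<rho> y = 0" "integral (cbox c d) \<rho> = 1"
    and \<sigma>: "\<sigma> \<le> R / 2"
    and g: "\<forall>x. g x = integral (cbox c d) (\<lambda>y. \<rho> y * u (x - y))" and C2: "C2_fun g G M"
    and z: "\<forall>x. norm x > B' \<longrightarrow> g x = 0 \<and> G x = 0 \<and> M x = 0"
  shows "q \<bullet> G a - \<epsilon> * trace (M a) \<le> H"
proof (rule field_le_epsilon)
  fix e' :: real assume "e' > 0"
  define e where "e = e' / 3"
  have e: "e > 0" using \<open>e' > 0\<close> by (simp add: e_def)
  define w where "w = (\<lambda>x. \<epsilon> * trace (M x) - q \<bullet> G x)"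
  have cw: "continuous_on UNIV w" unfolding w_def by (intro continuous_intros C2_funD[OF C2])
  have w0: "\<And>x. norm x > B' \<Longrightarrow> w x = 0" using z by (simp add: w_def trace_def)
  note w = uniformly_continuous_compact_support[OF cw w0]
  have M: "uniformly_continuous_on UNIV M" "bounded (range M)"
    using uniformly_continuous_compact_support[where B = B', OF C2_funD(5)[OF C2]] z by auto
  obtain t1 where t1: "t1 > 0" "\<forall>t>0. t \<le> t1 \<longrightarrow> (\<exists>\<tau>0>0. \<forall>\<tau>>0. \<forall>N. \<tau> \<le> \<tau>0 \<longrightarrow> real N * \<tau> = t \<longrightarrow>
     (\<forall>x\<in>cball a (R / 2). u x \<le> (avg (walk_step \<epsilon> q \<tau>) ^^ N) u x + t * (H + e)))"
    using walk_domination[OF u us eps sub R e] by blast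
  obtain t2 where t2: "t2 > 0"
    "\<And>\<tau> k x. \<tau> \<ge> 0 \<Longrightarrow> real k * \<tau> \<le> t2 \<Longrightarrow> \<bar>(avg (walk_step \<epsilon> q \<tau>) ^^ k) w x - w x\<bar> \<le> e"
    using walk_spread[OF w _ e, where \<epsilon> = \<epsilon> and q = q] eps by (metis less_imp_le)
  obtain \<tau>1 where \<tau>1: "\<tau>1 > 0" "\<And>\<tau> x. \<tau> > 0 \<Longrightarrow> \<tau> \<le> \<tau>1 \<Longrightarrow> \<bar>avg (walk_step \<epsilon> q \<tau>) g x - g x - \<tau> * w x\<bar> \<le> \<tau> * e"
    using walk_consistency[OF C2_funD(1,2)[OF C2] M eps e, where q = q] unfolding w_def by metis
  define t where "t = min t1 t2"
  have t: "t > 0" "t \<le> t1" "t \<le> t2" using t1 t2 by (auto simp: t_def)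
  obtain \<tau>0 where \<tau>0: "\<tau>0 > 0" "\<forall>\<tau>>0. \<forall>N. \<tau> \<le> \<tau>0 \<longrightarrow> real N * \<tau> = t \<longrightarrow>
     (\<forall>x\<in>cball a (R / 2). u x \<le> (avg (walk_step \<epsilon> q \<tau>) ^^ N) u x + t * (H + e))"
    using t1(2) t by blast
  obtain N :: nat where N: "real N > t / min \<tau>0 \<tau>1" using reals_Archimedean2 by blast
  define \<tau> where "\<tau> = t / real N"
  have "t / min \<tau>0 \<tau>1 > 0" using t \<tau>0 \<tau>1 by simp
  then have N0: "real N > 0" using N by linarith
  have \<tau>: "\<tau> > 0" "real N * \<tau> = t" using t N0 by (auto simp: \<tau>_def)
  have "t < real N * min \<tau>0 \<tau>1" using N \<tau>0 \<tau>1 by (simp add: field_simps)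
  then have "\<tau> < min \<tau>0 \<tau>1" unfolding \<tau>_def pos_divide_less_eq[OF N0] by (simp only: mult.commute)
  then have \<tau>le: "\<tau> \<le> \<tau>0" "\<tau> \<le> \<tau>1" by auto
  define st where "st = walk_step \<epsilon> q \<tau>"
  have gA: "(avg st ^^ N) g = (\<lambda>x. integral (cbox c d) (\<lambda>y. \<rho> y * (avg st ^^ N) u (x - y)))"
  proof -
    have g': "g = (\<lambda>x. integral (cbox c d) (\<lambda>y. \<rho> y * u (x - y)))" by (rule ext) (rule g[rule_format])
    show ?thesis by (subst g') (rule avg_pow_convolution[OF \<rho>(1) u])
  qed
  have "g a \<le> (avg st ^^ N) g a + t * (H + e)"
    unfolding gA unfolding g[rule_format]
  proof (rule mollification_close[OF \<rho> u avg_pow_continuous[OF u]])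
    fix y :: "real ^ 'n" assume "norm y < \<sigma>"
    then have "a - y \<in> cball a (R / 2)" using \<sigma> by (simp add: dist_norm)
    then show "u (a - y) \<le> (avg st ^^ N) u (a - y) + t * (H + e)"
      using \<tau>0(2) \<tau> \<tau>le unfolding st_def by blast
  qed
  moreover have "(avg st ^^ k) g a - g a \<le> real k * \<tau> * (w a + 2 * e)" if "k \<le> N" for k
    using that
  proof (induction k)
    case (Suc k)
    have "real k * \<tau> \<le> t" using Suc.prems \<tau> by (metis Suc_leD mult_right_mono of_nat_le_iff less_imp_le)
    then have "(avg st ^^ k) w a \<le> w a + e" using t2(2)[of \<tau> k a] \<tau> t unfolding st_def by simp
    then have "\<tau> * (avg st ^^ k) w a \<le> \<tau> * (w a + e)" using \<tau> by simp
    moreover have "\<bar>(avg st ^^ Suc k) g a - (avg st ^^ k) g a - \<tau> * (avg st ^^ k) w a\<bar> \<le> \<tau> * e"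
    proof -
      have "norm ((avg st ^^ k) (\<lambda>x. avg st g x - g x - \<tau> * w x) a) \<le> \<tau> * e"
        using \<tau>1(2)[of \<tau>] \<tau> \<tau>le by (intro avg_pow_norm_le) (simp add: st_def)
      moreover have "linear (\<lambda>z::real. \<tau> * z)" by (simp add: linear_iff algebra_simps)
      ultimately show ?thesis
        by (simp add: avg_pow_diff avg_pow_linear funpow_swap1[symmetric])
    qed
    ultimately have "(avg st ^^ Suc k) g a - (avg st ^^ k) g a \<le> \<tau> * (w a + 2 * e)"
      by (simp add: algebra_simps del: funpow.simps)
    then show ?case using Suc by (simp add: algebra_simps del: funpow.simps)
  qed simp
  from this[of N] have "(avg st ^^ N) g a - g a \<le> t * (w a + 2 * e)" using \<tau> by simp
  ultimately have "0 \<le> t * (w a + 2 * e + H + e)" by (simp add: algebra_simps)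
  then have "0 \<le> w a + 2 * e + H + e" using t by (simp add: zero_le_mult_iff)
  then show "q \<bullet> G a - \<epsilon> * trace (M a) \<le> H + e'" by (simp add: w_def e_def)
qed

lemma powr_tangent_le:
  assumes "p > 1" "a \<ge> 0" "b \<ge> (0::real)"
  shows "a powr p + p * a powr (p - 1) * (b - a) \<le> b powr p"
proof (cases "a = 0")
  case False
  then have a: "a > 0" using assms by simp
  show ?thesis
  proof (cases "b = 0")
    case True
    have "a powr (p - 1) * a = a powr p" using a by (simp add: powr_diff)
    then show ?thesis using True assms a by (simp add: algebra_simps)
  next
    case False
    then have b: "b > 0" using assms by simp
    have conv: "convex_on {0<..} (\<lambda>x. x powr p)" by (rule powr_convex) (use assms in auto)
    have "p * a powr (p - 1) * (b - a) \<le> b powr p - a powr p"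
    proof (rule convex_on_imp_above_tangent[OF conv])
      show "connected {0::real<..}" by simp
      show "a \<in> interior {0<..}" using a by (simp add: interior_open)
      show "b \<in> {0<..}" using b by simp
      show "((\<lambda>x. x powr p) has_real_derivative p * a powr (p - 1)) (at a within {0<..})"
        by (rule has_field_derivative_at_within[OF has_real_derivative_powr[OF a]])
    qed
    then show ?thesis by simp
  qed
qed (use assms in simp)

lemma norm_powr_tangent_le:
  fixes \<zeta> \<xi> :: "'a::real_inner"
  assumes "p > 1"
  shows "norm \<zeta> powr p + (p * norm \<zeta> powr (p - 2)) *\<^sub>R \<zeta> \<bullet> (\<xi> - \<zeta>) \<le> norm \<xi> powr p"
proof (cases "\<zeta> = 0")
  case False
  then have n: "norm \<zeta> > 0" by simp
  have "\<zeta> \<bullet> (\<xi> - \<zeta>) \<le> norm \<zeta> * (norm \<xi> - norm \<zeta>)"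
    using norm_cauchy_schwarz[of \<zeta> \<xi>] by (simp add: inner_diff_right dot_square_norm power2_eq_square algebra_simps)
  then have "(p * norm \<zeta> powr (p - 2)) * (\<zeta> \<bullet> (\<xi> - \<zeta>)) \<le> (p * norm \<zeta> powr (p - 2)) * (norm \<zeta> * (norm \<xi> - norm \<zeta>))"
    using assms by (intro mult_left_mono) auto
  also have "\<dots> = p * norm \<zeta> powr (p - 1) * (norm \<xi> - norm \<zeta>)"
  proof -
    have "norm \<zeta> powr (p - 1) = norm \<zeta> powr (p - 2) * norm \<zeta>"
      using powr_add[of "norm \<zeta>" "p - 2" 1] n by simp
    then show ?thesis by (simp only: mult.assoc)
  qed
  finally show ?thesis
    unfolding inner_scaleR_left using powr_tangent_le[OF assms norm_ge_zero norm_ge_zero, of \<zeta> \<xi>] by linarith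
qed simp

text \<open>Replacing \<open>|Dw|^p\<close> by its tangent at \<open>\<zeta>\<close>, which lies below it, weakens the inequality to a linear
one with constant drift \<open>q\<close>.\<close>

lemma visc_le_imp_drift_sub:
  fixes \<zeta> :: "real ^ 'n"
  assumes "visc_le \<epsilon> p h A w" "open A" "S \<subseteq> A" "open S" "\<epsilon> \<ge> 0" "p > 1"
    and H: "\<And>x. x \<in> S \<Longrightarrow> h x \<le> c" and eq: "\<And>x. x \<in> S \<Longrightarrow> u x = w x"
  defines "q \<equiv> (p * norm \<zeta> powr (p - 2)) *\<^sub>R \<zeta>"
  shows "drift_sub \<epsilon> q (c - norm \<zeta> powr p + q \<bullet> \<zeta>) S u"
  unfolding drift_sub_def
proof (intro ballI allI impI)
  fix x \<phi> G M
  assume x: "x \<in> S" and j: "jet_at \<phi> G M x" and m: "\<forall>\<^sub>F y in nhds x. u y - \<phi> y \<le> u x - \<phi> x"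
  have "\<forall>\<^sub>F y in nhds x. y \<in> S" by (rule eventually_nhds_in_open[OF \<open>open S\<close> x])
  with m have "\<forall>\<^sub>F y in nhds x. w y - \<phi> y \<le> w x - \<phi> x"
    by eventually_elim (use eq x in auto)
  from visc_le_jet_at[OF assms(1,2) subsetD[OF assms(3) x] j this assms(5)]
  have "norm (G x) powr p - \<epsilon> * trace M \<le> c" using H[OF x] by linarith
  moreover have "norm \<zeta> powr p + q \<bullet> (G x - \<zeta>) \<le> norm (G x) powr p"
    unfolding q_def by (rule norm_powr_tangent_le[OF assms(6)])
  ultimately show "q \<bullet> G x - \<epsilon> * trace M \<le> c - norm \<zeta> powr p + q \<bullet> \<zeta>"
    by (simp add: inner_diff_right)
qed

text \<open>One mollification serves for all tangents.  At a point \<open>x\<close> the tangent at \<open>\<zeta> = G x\<close>, the gradient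
of the mollified function itself, turns the linear inequality back into the nonlinear one.\<close>

lemma smooth_subsolution_exists:
  fixes w :: "real ^ 'n \<Rightarrow> real"
  assumes sub: "visc_le \<epsilon> p h A w" and A: "open A" and w: "continuous_on A w" and h: "continuous_on A h"
    and K: "compact K" "K \<subseteq> A" and eps: "\<epsilon> > 0" and p: "p > 1" and e: "e > 0"
  shows "\<exists>g G M. C2_fun g G M \<and> (\<forall>x\<in>K. norm (G x) powr p - \<epsilon> * trace (M x) \<le> h x + e)"
proof -
  obtain d where d: "d > 0" "(\<Union>x\<in>K. cball x d) \<subseteq> A"
    using compact_subset_open_imp_cball_epsilon_subset[OF K(1) A K(2)] by blast
  define K2 where "K2 = {x + y | x y. x \<in> K \<and> y \<in> cball 0 d}"
  have K2: "compact K2" unfolding K2_def by (rule compact_sums[OF K(1) compact_cball])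
  have K2A: "K2 \<subseteq> A"
  proof
    fix z assume "z \<in> K2"
    then obtain x y where "x \<in> K" "norm y \<le> d" "z = x + y" by (auto simp: K2_def)
    then have "z \<in> cball x d" by (simp add: dist_norm)
    then show "z \<in> A" using d(2) \<open>x \<in> K\<close> by blast
  qed
  have inK2: "y \<in> K2" if "x \<in> K" "y \<in> cball x d" for x y
    using that unfolding K2_def mem_Collect_eq
    by (intro exI[of _ x] exI[of _ "y - x"]) (simp add: dist_norm norm_minus_commute)
  have "continuous_on K2 w" by (rule continuous_on_subset[OF w K2A])
  then obtain W where W: "continuous_on UNIV W" "\<And>x. x \<in> K2 \<Longrightarrow> W x = w x"
    using Tietze_unbounded[of K2 w UNIV] compact_imp_closed[OF K2] by auto
  define u where "u = (\<lambda>x. max 0 (1 - infdist x K2) * W x)"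
  have u: "continuous_on UNIV u" unfolding u_def by (intro continuous_intros W)
  have u_eq: "u x = w x" if "x \<in> K2" for x
    using that W by (simp add: u_def)
  obtain B0 where B0: "\<And>x. x \<in> K2 \<Longrightarrow> norm x \<le> B0" using compact_imp_bounded[OF K2] unfolding bounded_iff by blast
  show ?thesis
  proof (cases "K = {}")
    case True
    have "C2_fun (\<lambda>_. 0) (\<lambda>_. 0) (\<lambda>_. 0 :: real ^ 'n ^ 'n)" by (simp add: C2_fun_def)
    then show ?thesis using True by blast
  next
    case False
    then obtain x0 where "x0 \<in> K" by blast
    then have "x0 \<in> K2" using inK2[of x0 x0] d(1) by simp
    then have ne: "K2 \<noteq> {}" by blast
    have us: "\<forall>x. norm x > B0 + 1 \<longrightarrow> u x = 0"
    proof (intro allI impI)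
      fix x :: "real ^ 'n" assume x: "norm x > B0 + 1"
      obtain y where y: "y \<in> K2" "infdist x K2 = dist x y"
        using infdist_attains_inf[OF compact_imp_closed[OF K2] ne, where y = x] by blast
      have "norm x \<le> norm y + dist x y" using norm_triangle_sub[of x y] by (simp add: dist_norm)
      then have "infdist x K2 > 1" using x y B0[OF y(1)] by linarith
      then show "u x = 0" by (simp add: u_def)
    qed
    have "uniformly_continuous_on K2 h"
      by (rule compact_uniformly_continuous[OF continuous_on_subset[OF h K2A] K2])
    then obtain d3 where d3: "d3 > 0" "\<And>x x'. x \<in> K2 \<Longrightarrow> x' \<in> K2 \<Longrightarrow> dist x' x < d3 \<Longrightarrow> dist (h x') (h x) < e"
      using e unfolding uniformly_continuous_on_def by metis
    define R where "R = min d d3"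
    have R: "R > 0" using d d3 by (simp add: R_def)
    then have "R / 2 > 0" by simp
    from mollification[OF u us this] obtain \<rho> a b g G M where
      \<rho>: "continuous_on UNIV \<rho>" "\<forall>y. \<rho> y \<ge> 0" "\<forall>y. norm y \<ge> R / 2 \<longrightarrow> \<rho> y = 0" "integral (cbox a b) \<rho> = 1" and
      g: "\<forall>x. g x = integral (cbox a b) (\<lambda>y. \<rho> y * u (x - y))" and
      C2: "C2_fun g G M" and z: "\<forall>x. norm x > B0 + 1 + R / 2 \<longrightarrow> g x = 0 \<and> G x = 0 \<and> M x = 0"
      by (elim exE conjE) (rule that; assumption)
    have "norm (G x) powr p - \<epsilon> * trace (M x) \<le> h x + e" if x: "x \<in> K" for x
    proof -
      have in2: "y \<in> K2" if "y \<in> ball x R" for y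
        using inK2[OF x, of y] that by (simp add: R_def)
      have xK2: "x \<in> K2" using in2[of x] R by simp
      define q where "q = (p * norm (G x) powr (p - 2)) *\<^sub>R G x"
      have "drift_sub \<epsilon> q (h x + e - norm (G x) powr p + q \<bullet> G x) (ball x R) u"
        unfolding q_def
      proof (rule visc_le_imp_drift_sub[OF sub A])
        fix y assume y: "y \<in> ball x R"
        show "u y = w y" using u_eq in2[OF y] by simp
        have "dist (h y) (h x) < e" using d3(2)[OF xK2 in2[OF y]] y by (simp add: R_def dist_commute)
        then show "h y \<le> h x + e" by (simp add: dist_real_def)
      qed (use in2 K2A eps p in auto)
      \<comment> \<open>The scale R / 2 of the mollification is common to all points of K and to all tangents.\<close>
      from mollification_drift[OF u us eps this R \<rho>(1) \<rho>(2,3)[rule_format] \<rho>(4) order_refl g C2 z]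
      show ?thesis by simp
    qed
    then show ?thesis using C2 by blast
  qed
qed

section \<open>Comparison of averaged subsolutions with a supersolution\<close>

lemma norm_powr_midpoint:
  fixes a b :: "'a::real_inner"
  assumes "p > 1"
  shows "norm ((1/2) *\<^sub>R (a + b)) powr p \<le> (1/2) * (norm a powr p + norm b powr p)"
proof -
  define \<zeta> where "\<zeta> = (1/2) *\<^sub>R (a + b)"
  define q where "q = (p * norm \<zeta> powr (p - 2)) *\<^sub>R \<zeta>"
  have "norm \<zeta> powr p + q \<bullet> (a - \<zeta>) \<le> norm a powr p" "norm \<zeta> powr p + q \<bullet> (b - \<zeta>) \<le> norm b powr p"
    unfolding q_def by (rule norm_powr_tangent_le[OF assms])+
  moreover have "q \<bullet> (a - \<zeta>) + q \<bullet> (b - \<zeta>) = q \<bullet> ((a - \<zeta>) + (b - \<zeta>))" by (simp only: inner_add_right)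
  moreover have "(a - \<zeta>) + (b - \<zeta>) = 0"
    by (simp add: \<zeta>_def algebra_simps flip: scaleR_add_left)
  ultimately show ?thesis unfolding \<zeta>_def[symmetric] by simp
qed

text \<open>Both subsolutions live in a neighbourhood of the closed domain, so that the mean of their smooth
versions is an admissible test function up to the boundary.  The supersolution is tested where
its difference from this mean is minimal.\<close>

lemma supersolution_test:
  fixes v :: "real ^ 'n \<Rightarrow> real"
  assumes sup: "viscosity_supersolution_closure \<epsilon> (hamiltonian p f) \<delta> 0 A v"
    and v: "continuous_on (closure A) v" and A: "bounded A" "A \<noteq> {}"
    and sub1: "visc_le \<epsilon> p h1 A1 w1" "open A1" "continuous_on A1 w1" "continuous_on A1 h1" "closure A \<subseteq> A1"
    and sub2: "visc_le \<epsilon> p h2 A2 w2" "open A2" "continuous_on A2 w2" "continuous_on A2 h2" "closure A \<subseteq> A2"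
    and eps: "\<epsilon> > 0" and p: "p > 1" and e: "e > 0"
  shows "\<exists>x\<in>closure A. f x - \<delta> * v x \<le> (1/2) * (h1 x + h2 x) + e"
proof -
  have K: "compact (closure A)" using A by (simp add: compact_closure)
  obtain g1 G1 M1 where 1: "C2_fun g1 G1 M1" "\<forall>x\<in>closure A. norm (G1 x) powr p - \<epsilon> * trace (M1 x) \<le> h1 x + e"
    using smooth_subsolution_exists[OF sub1(1-4) K sub1(5) eps p e] by blast
  obtain g2 G2 M2 where 2: "C2_fun g2 G2 M2" "\<forall>x\<in>closure A. norm (G2 x) powr p - \<epsilon> * trace (M2 x) \<le> h2 x + e"
    using smooth_subsolution_exists[OF sub2(1-4) K sub2(5) eps p e] by blast
  define g where "g = (\<lambda>x. (1/2) * (g1 x + g2 x))"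
  define G where "G = (\<lambda>x. (1/2) *\<^sub>R (G1 x + G2 x))"
  define M where "M = (\<lambda>x. (1/2) *\<^sub>R (M1 x + M2 x))"
  have dg: "(g has_derivative (\<lambda>h. G x \<bullet> h)) (at x)" for x
    unfolding g_def G_def
    by (rule has_derivative_eq_rhs[OF has_derivative_mult_right[OF has_derivative_add[OF C2_funD(1)[OF 1(1)] C2_funD(1)[OF 2(1)]]]])
      (simp add: fun_eq_iff inner_add_left)
  have dG: "(G has_derivative (\<lambda>h. M x *v h)) (at x)" for x
    unfolding G_def M_def
    by (rule has_derivative_eq_rhs[OF has_derivative_scaleR_right[OF has_derivative_add[OF C2_funD(2)[OF 1(1)] C2_funD(2)[OF 2(1)]]]])
      (simp add: fun_eq_iff matrix_vector_mult_add_rdistrib scaleR_matrix_vector_assoc[symmetric])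
  have cM: "continuous_on UNIV M" unfolding M_def by (intro continuous_intros C2_funD[OF 1(1)] C2_funD[OF 2(1)])
  have C2: "C2_fun g G M" unfolding C2_fun_def using dg dG cM by blast
  note cg = C2_funD(3-5)[OF C2, THEN continuous_on_subset, OF subset_UNIV]
  have jet: "C2_jet A (closure A) g G M"
    unfolding C2_jet_def using cg dg dG by blast
  have cont: "continuous_on (closure A) (\<lambda>x. v x - g x)" by (intro continuous_intros v cg)
  have "closure A \<noteq> {}" using A by simp
  from continuous_attains_inf[OF K this cont]
  obtain x where x: "x \<in> closure A" "\<forall>y\<in>closure A. v x - g x \<le> v y - g y" by blast
  have "local_min_on (\<lambda>y. v y - g y) (closure A) x"
    unfolding local_min_on_def using x by (auto simp: eventually_at_filter intro: always_eventually)
  then have "\<delta> * v x + hamiltonian p f x (G x) - \<epsilon> * trace (M x) \<ge> 0"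
    using sup jet x(1) unfolding viscosity_supersolution_closure_def by blast
  then have "f x - \<delta> * v x \<le> norm (G x) powr p - \<epsilon> * trace (M x)" by (simp add: hamiltonian_def)
  also have "\<dots> \<le> (1/2) * (norm (G1 x) powr p + norm (G2 x) powr p) - \<epsilon> * ((1/2) * (trace (M1 x) + trace (M2 x)))"
    using norm_powr_midpoint[OF p, of "G1 x" "G2 x"] by (simp add: G_def M_def trace_scaleR trace_add)
  also have "\<dots> = (1/2) * ((norm (G1 x) powr p - \<epsilon> * trace (M1 x)) + (norm (G2 x) powr p - \<epsilon> * trace (M2 x)))"
    by (simp add: algebra_simps)
  also have "\<dots> \<le> (1/2) * ((h1 x + e) + (h2 x + e))"
    using 1(2) 2(2) x(1) by (intro mult_left_mono add_mono) auto
  finally show ?thesis using x(1) by (intro bexI[of _ x]) (simp_all add: field_simps)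
qed

section \<open>Interior estimate for subsolutions\<close>

lemma jet_at_radial:
  fixes z :: "real ^ 'n"
  assumes d1: "\<forall>\<^sub>F t in nhds (z \<bullet> z). (\<chi>0 has_real_derivative \<chi>1 t) (at t)"
    and d2: "(\<chi>1 has_real_derivative c) (at (z \<bullet> z))"
  shows "jet_at (\<lambda>y. \<chi>0 (y \<bullet> y)) (\<lambda>y. (2 * \<chi>1 (y \<bullet> y)) *\<^sub>R y)
    ((2 * \<chi>1 (z \<bullet> z)) *\<^sub>R mat 1 + (4 * c) *\<^sub>R (\<chi> i j. z $ i * z $ j)) z"
  unfolding jet_at_def
proof
  have i: "((\<lambda>y. y \<bullet> y) has_derivative (\<lambda>h. 2 * (y \<bullet> h))) (at y)" for y :: "real ^ 'n"
    by (auto intro!: derivative_eq_intros simp: inner_commute)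
  have "filterlim (\<lambda>y. y \<bullet> y) (nhds (z \<bullet> z)) (nhds z)"
    by (intro tendsto_intros filterlim_ident)
  then have "\<forall>\<^sub>F y in nhds z. (\<chi>0 has_real_derivative \<chi>1 (y \<bullet> y)) (at (y \<bullet> y))"
    using d1 unfolding filterlim_iff by blast
  then show "\<forall>\<^sub>F y in nhds z. ((\<lambda>y. \<chi>0 (y \<bullet> y)) has_derivative (\<lambda>h. ((2 * \<chi>1 (y \<bullet> y)) *\<^sub>R y) \<bullet> h)) (at y)"
  proof eventually_elim
    case (elim y)
    show ?case
      by (rule has_derivative_eq_rhs[OF has_derivative_compose[OF i elim[unfolded has_field_derivative_def]]])
        (simp add: fun_eq_iff)
  qed
  have D: "((\<lambda>y. 2 * \<chi>1 (y \<bullet> y)) has_derivative (\<lambda>h. 2 * (c * (2 * (z \<bullet> h))))) (at z)"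
    by (rule has_derivative_mult_right[OF has_derivative_compose[OF i d2[unfolded has_field_derivative_def]]])
  have outer: "(\<chi> i j. z $ i * z $ j) *v h = (z \<bullet> h) *\<^sub>R z" for h
    by (simp add: vec_eq_iff matrix_vector_mult_def inner_vec_def sum_distrib_left mult_ac)
  show "((\<lambda>y. (2 * \<chi>1 (y \<bullet> y)) *\<^sub>R y) has_derivative
      (\<lambda>h. ((2 * \<chi>1 (z \<bullet> z)) *\<^sub>R mat 1 + (4 * c) *\<^sub>R (\<chi> i j. z $ i * z $ j)) *v h)) (at z)"
    by (rule has_derivative_eq_rhs[OF has_derivative_scaleR[OF D has_derivative_ident]])
      (simp add: fun_eq_iff matrix_vector_mult_add_rdistrib scaleR_matrix_vector_assoc[symmetric] outer)
qed

lemma trace_outer: "trace (\<chi> i j. z $ i * z $ j) = z \<bullet> (z :: real ^ 'n)"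
  by (simp add: trace_def inner_vec_def)

text \<open>For a barrier \<open>K \<phi>(|z|^2)\<close> with \<open>\<phi>(t) = t^b + 1 / (1 - t)\<close> the gradient term must dominate the
Laplacian up to a constant factor.  Near \<open>t = 0\<close> both are of order \<open>t^(b - 1)\<close>, which is what
determines \<open>b = \<alpha> / 2\<close>.  Near \<open>t = 1\<close> the gradient term is of order \<open>(1 - t)^(- 2p)\<close> and the
Laplacian of order \<open>(1 - t)^(- 3)\<close>.\<close>

lemma profile_inequality:
  fixes p n :: real
  assumes p: "p > 2" and n: "n \<ge> 1"
  defines "b \<equiv> (p - 2) / (p - 1) / 2"
  obtains c where "c > 0" "\<And>t. 0 < t \<Longrightarrow> t < 1 \<Longrightarrow>
     c * (2 * n * (b * t powr (b - 1) + 1 / (1 - t)\<^sup>2) + 8 * t / (1 - t) ^ 3 + 1)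
       \<le> (2 * sqrt t * (b * t powr (b - 1) + 1 / (1 - t)\<^sup>2)) powr p"
proof -
  have b: "0 < b" "b < 1" using p by (auto simp: b_def field_simps)
  define c1 where "c1 = (2 * b) powr p / (2 * n * b + 8 * n + 33)"
  define c2 where "c2 = 1 / (6 * n + 9)"
  define c where "c = min c1 c2"
  have "c1 > 0" using b n by (simp add: c1_def add_pos_pos)
  moreover have "c2 > 0" using n by (simp add: c2_def)
  ultimately have c: "c > 0" by (simp add: c_def)
  show ?thesis
  proof (rule that[OF c])
    fix t :: real assume t: "0 < t" "t < 1"
    define X where "X = b * t powr (b - 1) + 1 / (1 - t)\<^sup>2"
    define s where "s = 1 / (1 - t)"
    have s: "s \<ge> 1" using t by (simp add: s_def)
    have X_s: "X = b * t powr (b - 1) + s\<^sup>2" by (simp add: X_def s_def power_divide)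
    have tb: "t powr (b - 1) \<ge> 1" using t b powr_mono'[of "b - 1" 0 t] by simp
    define Y where "Y = 2 * n * X + 8 * t * s ^ 3 + 1"
    have Xpos: "X > 0" unfolding X_s using t b s by (intro add_pos_pos mult_pos_pos) auto
    have Y0: "Y > 0" using Xpos n t s by (simp add: Y_def add_nonneg_pos)
    have "c * Y \<le> (2 * sqrt t * X) powr p"
    proof (cases "t \<le> 1 / 2")
      case True
      have s2: "s \<le> 2" using True t by (simp add: s_def field_simps)
      have s22: "s\<^sup>2 \<le> 4" using power_mono[of s 2 2] s s2 by simp
      have s23: "s ^ 3 \<le> 8" using power_mono[of s 2 3] s s2 by simp
      have "8 * t * s ^ 3 \<le> 4 * 8" using True t s23 s by (intro mult_mono) auto
      moreover have "2 * n * X \<le> 2 * n * (b * t powr (b - 1) + 4)"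
        using s22 n by (intro mult_left_mono) (auto simp: X_s)
      ultimately have "Y \<le> 2 * n * b * t powr (b - 1) + (8 * n + 33) * 1"
        by (simp add: Y_def algebra_simps)
      also have "\<dots> \<le> 2 * n * b * t powr (b - 1) + (8 * n + 33) * t powr (b - 1)"
        using tb n by (intro add_left_mono mult_left_mono) auto
      also have "\<dots> = (2 * n * b + 8 * n + 33) * t powr (b - 1)" by (simp add: algebra_simps)
      finally have Y: "Y \<le> (2 * n * b + 8 * n + 33) * t powr (b - 1)" .
      have "c * Y \<le> c1 * ((2 * n * b + 8 * n + 33) * t powr (b - 1))"
        using Y Y0 c by (intro mult_mono) (auto simp: c_def)
      also have "\<dots> = (2 * b) powr p * t powr (b - 1)"
      proof -
        have "2 * n * b + 8 * n + 33 > 0" using n b by (simp add: add_pos_pos)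
        then show ?thesis by (simp add: c1_def)
      qed
      also have "b - 1 = (b - 1/2) * p" using p by (simp add: b_def field_simps)
      also have "(2 * b) powr p * t powr ((b - 1/2) * p) = (2 * b * t powr (b - 1/2)) powr p"
        using b by (simp add: powr_mult powr_powr)
      also have "\<dots> \<le> (2 * sqrt t * X) powr p"
      proof (rule powr_mono2)
        have "t powr (b - 1/2) = t powr (1/2) * t powr (b - 1)" by (simp flip: powr_add)
        then have "2 * b * t powr (b - 1/2) = 2 * sqrt t * (b * t powr (b - 1))"
          using t by (simp add: powr_half_sqrt)
        also have "\<dots> \<le> 2 * sqrt t * X" using t by (intro mult_left_mono) (auto simp: X_s)
        finally show "2 * b * t powr (b - 1/2) \<le> 2 * sqrt t * X" .
      qed (use p b in auto)
      finally show ?thesis .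
    next
      case False
      have "t powr (b - 1) \<le> t powr (-1)" using t b by (intro powr_mono') auto
      also have "\<dots> \<le> 2" using False t by (simp add: powr_minus field_simps)
      finally have tb2: "t powr (b - 1) \<le> 2" .
      have "b * t powr (b - 1) \<le> 1 * 2" using b tb2 tb by (intro mult_mono) auto
      moreover have "s\<^sup>2 \<le> s ^ 3" "1 \<le> s ^ 3" using s by (auto intro: power_increasing)
      ultimately have "X \<le> 3 * s ^ 3" by (simp add: X_s)
      then have "2 * n * X \<le> 2 * n * (3 * s ^ 3)" using n by (intro mult_left_mono) auto
      moreover have "8 * t * s ^ 3 \<le> 8 * s ^ 3" using t s by (intro mult_right_mono) auto
      ultimately have "Y \<le> (6 * n + 9) * s ^ 3" using \<open>1 \<le> s ^ 3\<close> by (simp add: Y_def algebra_simps)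
      then have "c * Y \<le> c2 * ((6 * n + 9) * s ^ 3)"
        using Y0 c by (intro mult_mono) (auto simp: c_def)
      also have "\<dots> = s ^ 3" using n by (simp add: c2_def)
      also have "\<dots> \<le> s ^ 4" using s by (intro power_increasing) auto
      also have "\<dots> = (s\<^sup>2) powr 2" using s by (simp add: powr_numeral flip: power_mult)
      also have "\<dots> \<le> (s\<^sup>2) powr p" using s p by (intro powr_mono) auto
      also have "\<dots> \<le> (2 * sqrt t * X) powr p"
      proof (rule powr_mono2)
        have "sqrt (1/4) \<le> sqrt t" using False by (intro real_sqrt_le_mono) auto
        then have "1 \<le> 2 * sqrt t" by (simp add: real_sqrt_divide)
        moreover have "s\<^sup>2 \<le> X" using b tb by (simp add: X_s)
        ultimately show "s\<^sup>2 \<le> 2 * sqrt t * X" using mult_mono[of 1 "2 * sqrt t" "s\<^sup>2" X] s t by simp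
      qed (use p in auto)
      finally show ?thesis .
    qed
    then show "c * (2 * n * (b * t powr (b - 1) + 1 / (1 - t)\<^sup>2) + 8 * t / (1 - t) ^ 3 + 1)
       \<le> (2 * sqrt t * (b * t powr (b - 1) + 1 / (1 - t)\<^sup>2)) powr p"
      by (simp add: Y_def X_def s_def power_divide)
  qed
qed

text \<open>For large \<open>K\<close> the barrier \<open>\<Phi>\<close> is a strict supersolution away from the centre and is infinite on the
unit sphere.  Hence \<open>w - \<Phi>\<close> can be maximal only at the centre, whatever the values of \<open>w\<close> near the
sphere.\<close>

lemma unit_ball_bound:
  assumes eps: "\<epsilon> > 0" and p: "p > 2" and C: "C \<ge> 0"
  shows "\<exists>B\<ge>0. \<forall>w :: real ^ 'n \<Rightarrow> real. continuous_on (cball 0 1) w \<longrightarrow> visc_le \<epsilon> p (\<lambda>_. C) (ball 0 1) w \<longrightarrow>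
    (\<forall>z\<in>cball 0 (1/2). w z \<le> w 0 + B)"
proof -
  define n where "n = real CARD('n)"
  have n: "n \<ge> 1" by (simp add: n_def Suc_leI)
  define b where "b = (p - 2) / (p - 1) / 2"
  have b: "0 < b" "b < 1" using p by (auto simp: b_def field_simps)
  obtain c where c: "c > 0" "\<And>t. 0 < t \<Longrightarrow> t < 1 \<Longrightarrow>
     c * (2 * n * (b * t powr (b - 1) + 1 / (1 - t)\<^sup>2) + 8 * t / (1 - t) ^ 3 + 1)
       \<le> (2 * sqrt t * (b * t powr (b - 1) + 1 / (1 - t)\<^sup>2)) powr p"
    using profile_inequality[OF p n, folded b_def] by blast
  \<comment> \<open>K^p grows faster than K, so the gradient term wins for large K.\<close>
  define K where "K = max 1 (((\<epsilon> + C + 1) / c) powr (1 / (p - 1)))"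
  have K: "K \<ge> 1" by (simp add: K_def)
  have Kp: "K powr (p - 1) * c \<ge> \<epsilon> + C + 1"
  proof -
    have "(\<epsilon> + C + 1) / c = (((\<epsilon> + C + 1) / c) powr (1 / (p - 1))) powr (p - 1)"
      using eps C c p by (simp add: powr_powr)
    also have "\<dots> \<le> K powr (p - 1)" using p by (intro powr_mono2) (auto simp: K_def)
    finally show ?thesis using c by (simp add: field_simps)
  qed
  define \<chi>0 where "\<chi>0 = (\<lambda>t. K * (t powr b + 1 / (1 - t)))"
  define X where "X = (\<lambda>t. b * t powr (b - 1) + 1 / (1 - t)\<^sup>2)"
  define X' where "X' = (\<lambda>t. b * ((b - 1) * t powr (b - 2)) + 2 / (1 - t) ^ 3)"
  define \<chi>1 where "\<chi>1 = (\<lambda>t. K * X t)"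
  define \<Phi> where "\<Phi> = (\<lambda>z :: real ^ 'n. \<chi>0 (z \<bullet> z))"
  have d1: "(\<chi>0 has_real_derivative \<chi>1 t) (at t)" if "0 < t" "t < 1" for t
    unfolding \<chi>0_def \<chi>1_def X_def using that
    by (auto intro!: derivative_eq_intros simp: power2_eq_square field_simps)
  have d2: "(\<chi>1 has_real_derivative K * X' t) (at t)" if "0 < t" "t < 1" for t
  proof -
    have u: "2 * u / (u\<^sup>2 * u\<^sup>2) = 2 / u ^ 3" if "u \<noteq> 0" for u :: real
      using that by (simp add: power2_eq_square power3_eq_cube)
    have "((\<lambda>t. 1 / (1 - t)\<^sup>2) has_real_derivative 2 * (1 - t) / ((1 - t)\<^sup>2 * (1 - t)\<^sup>2)) (at t)"
      using that by (auto intro!: derivative_eq_intros simp: power2_eq_square)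
    then have "((\<lambda>t. 1 / (1 - t)\<^sup>2) has_real_derivative 2 / (1 - t) ^ 3) (at t)"
      using u[of "1 - t"] that by simp
    moreover have "((\<lambda>t. t powr (b - 1)) has_real_derivative (b - 1) * t powr (b - 2)) (at t)"
      using has_real_derivative_powr[of t "b - 1"] that by simp
    ultimately show ?thesis
      unfolding \<chi>1_def X_def X'_def by (intro DERIV_cmult DERIV_add)
  qed
  have strict: "False" if z: "z \<noteq> 0" "norm z < 1" and sub: "visc_le \<epsilon> p (\<lambda>_. C) (ball 0 1) w"
    and max: "\<forall>\<^sub>F y in nhds z. w y - \<Phi> y \<le> w z - \<Phi> z" for z w
  proof -
    define t where "t = z \<bullet> z"
    have t: "0 < t" "t < 1" using z by (auto simp: t_def dot_square_norm power_less_one_iff abs_square_less_1)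
    have st: "sqrt t = norm z" by (simp add: t_def norm_eq_sqrt_inner)
    have "\<forall>\<^sub>F s in nhds t. (\<chi>0 has_real_derivative \<chi>1 s) (at s)"
      using eventually_nhds_in_open[of "{0<..<1}" t] t by (auto elim!: eventually_mono intro: d1)
    from jet_at_radial[OF this[unfolded t_def] d2[OF t, unfolded t_def]]
    have "norm ((2 * \<chi>1 t) *\<^sub>R z) powr p - \<epsilon> * trace ((2 * \<chi>1 t) *\<^sub>R mat 1 + (4 * (K * X' t)) *\<^sub>R (\<chi> i j. z $ i * z $ j)) \<le> C"
      unfolding t_def using max z eps by (intro visc_le_jet_at[OF sub open_ball]) (auto simp: \<Phi>_def)
    then have F: "(2 * sqrt t * \<chi>1 t) powr p - \<epsilon> * (2 * n * \<chi>1 t + 4 * t * (K * X' t)) \<le> C"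
      using K b t by (simp add: trace_add trace_scaleR trace_mat_1 trace_outer t_def[symmetric] n_def st \<chi>1_def X_def mult_ac abs_mult)
    define Y where "Y = 2 * n * X t + 8 * t / (1 - t) ^ 3 + 1"
    have Xt: "X t > 0" using t b by (simp add: X_def add_pos_pos)
    have Y1: "Y \<ge> 1" using Xt n t by (simp add: Y_def)
    have "(2 * sqrt t * \<chi>1 t) powr p = K powr p * (2 * sqrt t * X t) powr p"
      using K Xt t by (simp add: \<chi>1_def powr_mult[symmetric] mult_ac)
    also have "\<dots> \<ge> K powr p * (c * Y)"
      using c(2)[OF t] by (intro mult_left_mono) (auto simp: Y_def X_def)
    finally have 1: "K powr p * (c * Y) \<le> (2 * sqrt t * \<chi>1 t) powr p" .
    have "4 * t * X' t \<le> 8 * t / (1 - t) ^ 3"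
    proof -
      have "b * ((b - 1) * t powr (b - 2)) \<le> 0" using b by (intro mult_nonneg_nonpos mult_nonpos_nonneg) auto
      then have "X' t \<le> 2 / (1 - t) ^ 3" by (simp add: X'_def)
      then have "4 * t * X' t \<le> 4 * t * (2 / (1 - t) ^ 3)" using t by (intro mult_left_mono) auto
      then show ?thesis by simp
    qed
    then have "2 * n * X t + 4 * t * X' t \<le> Y" by (simp add: Y_def)
    then have "K * (2 * n * X t + 4 * t * X' t) \<le> K * Y" using K by (intro mult_left_mono) auto
    then have "\<epsilon> * (2 * n * \<chi>1 t + 4 * t * (K * X' t)) \<le> \<epsilon> * (K * Y)"
      using eps by (intro mult_left_mono) (auto simp: \<chi>1_def algebra_simps)
    then have "K powr p * (c * Y) - \<epsilon> * (K * Y) \<le> C" using F 1 by linarith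
    moreover have "K powr p = K * K powr (p - 1)" using K powr_add[of K 1 "p - 1"] by simp
    ultimately have "K * Y * (K powr (p - 1) * c - \<epsilon>) \<le> C" by (simp add: algebra_simps)
    moreover have "1 * (C + 1) \<le> K * Y * (K powr (p - 1) * c - \<epsilon>)"
      using Kp K Y1 C mult_mono[of 1 K 1 Y] by (intro mult_mono) auto
    ultimately show False by simp
  qed
  have "w z \<le> w 0 + 2 * K" if w: "continuous_on (cball 0 1) w" and sub: "visc_le \<epsilon> p (\<lambda>_. C) (ball 0 1) w"
    and z: "z \<in> cball 0 (1/2)" for w :: "real ^ 'n \<Rightarrow> real" and z
  proof -
    have "bounded (w ` cball 0 1)" by (intro compact_imp_bounded compact_continuous_image w) auto
    then obtain W where W: "W > 0" "\<And>x. x \<in> cball 0 1 \<Longrightarrow> \<bar>w x\<bar> \<le> W" unfolding bounded_pos by auto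
    \<comment> \<open>On the sphere of radius \<rho> the barrier is at least K m = 2 W + 3 K, more than the oscillation of w.\<close>
    define m where "m = (2 * W + K) / K + 2"
    have m: "m \<ge> 2" using W K by (simp add: m_def)
    define \<rho> where "\<rho> = sqrt (1 - 1 / m)"
    have \<rho>2: "\<rho>\<^sup>2 = 1 - 1 / m" using m by (simp add: \<rho>_def)
    have \<rho>1: "\<rho> < 1" "\<rho> > 0" using m by (auto simp: \<rho>_def)
    have "1/2 \<le> \<rho>"
    proof (rule power2_le_imp_le)
      have "1 / m \<le> 1 / 2" using m by (intro divide_left_mono) auto
      then show "(1/2)\<^sup>2 \<le> \<rho>\<^sup>2" unfolding \<rho>2 by (simp add: power2_eq_square)
    qed (use \<rho>1 in auto)
    have c\<Phi>: "continuous_on (cball 0 \<rho>) \<Phi>"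
    proof -
      have lt: "z \<bullet> z < 1" if "z \<in> cball 0 \<rho>" for z :: "real ^ 'n"
      proof -
        have "norm z < 1" using that \<rho>1 by simp
        then show ?thesis by (simp add: dot_square_norm power_less_one_iff abs_square_less_1)
      qed
      have "1 - z \<bullet> z \<noteq> 0" if "z \<in> cball 0 \<rho>" for z :: "real ^ 'n" using lt[OF that] by simp
      then show ?thesis unfolding \<Phi>_def \<chi>0_def using b
        by (intro continuous_intros continuous_on_powr') auto
    qed
    have "continuous_on (cball 0 \<rho>) (\<lambda>x. w x - \<Phi> x)"
      using \<rho>1 by (intro continuous_intros c\<Phi> continuous_on_subset[OF w]) auto
    then obtain z0 where z0: "z0 \<in> cball 0 \<rho>" "\<And>y. y \<in> cball 0 \<rho> \<Longrightarrow> w y - \<Phi> y \<le> w z0 - \<Phi> z0"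
      using continuous_attains_sup[of "cball 0 \<rho>" "\<lambda>x. w x - \<Phi> x"] \<rho>1 by auto
    have \<Phi>0: "\<Phi> 0 = K" using b by (simp add: \<Phi>_def \<chi>0_def)
    have "norm z0 \<noteq> \<rho>"
    proof
      assume "norm z0 = \<rho>"
      then have "z0 \<bullet> z0 = 1 - 1 / m" by (simp add: dot_square_norm \<rho>2)
      then have "\<Phi> z0 = K * ((1 - 1 / m) powr b + m)" by (simp add: \<Phi>_def \<chi>0_def)
      then have "\<Phi> z0 \<ge> K * m" using K by simp
      moreover have "K * m = 2 * W + 3 * K" using K by (simp add: m_def field_simps)
      moreover have "w 0 - \<Phi> 0 \<le> w z0 - \<Phi> z0" using z0(2)[of 0] \<rho>1 by simp
      ultimately show False using W(2)[of 0] W(2)[of z0] z0(1) \<rho>1 \<Phi>0 K by simp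
    qed
    then have z0b: "z0 \<in> ball 0 \<rho>" using z0(1) by simp
    have "z0 = 0"
    proof (rule ccontr)
      assume "z0 \<noteq> 0"
      have "\<forall>\<^sub>F y in nhds z0. y \<in> ball 0 \<rho>" by (rule eventually_nhds_in_open[OF open_ball z0b])
      then have "\<forall>\<^sub>F y in nhds z0. w y - \<Phi> y \<le> w z0 - \<Phi> z0"
        by eventually_elim (use z0(2) in auto)
      then show False using strict[OF \<open>z0 \<noteq> 0\<close> _ sub] z0b \<rho>1 by simp
    qed
    then have "w z - \<Phi> z \<le> w 0 - K" using z0(2)[of z] z \<open>1/2 \<le> \<rho>\<close> \<Phi>0 by simp
    moreover have "\<Phi> z \<le> K * 3"
    proof -
      have "norm z \<le> 1/2" using z by simp
      then have "(norm z)\<^sup>2 \<le> (1/2)\<^sup>2" by (intro power_mono) auto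
      then have t: "0 \<le> z \<bullet> z" "z \<bullet> z \<le> 1/4" by (auto simp: dot_square_norm power2_eq_square)
      have "(z \<bullet> z) powr b \<le> 1" using t b by (intro powr_le1) auto
      moreover have "1 / (1 - z \<bullet> z) \<le> 2" using t by (simp add: field_simps)
      ultimately show ?thesis unfolding \<Phi>_def \<chi>0_def using K by (intro mult_left_mono) auto
    qed
    ultimately show ?thesis by simp
  qed
  then show ?thesis using K by (intro exI[of _ "2 * K"]) auto
qed

text \<open>The scaled form of \<open>unit_ball_bound\<close>: a Hoelder estimate in balls inside the domain, with a
constant that does not depend on the size of the function.\<close>

lemma interior_bound:
  assumes eps: "\<epsilon> > 0" and p: "p > 2" and C: "C \<ge> 0" and D: "D > 0"
  shows "\<exists>B\<ge>0. \<forall>(w :: real ^ 'n \<Rightarrow> real) A x d. open A \<longrightarrow> continuous_on A w \<longrightarrow> visc_le \<epsilon> p (\<lambda>_. C) A w \<longrightarrow>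
    0 < d \<longrightarrow> d \<le> D \<longrightarrow> cball x d \<subseteq> A \<longrightarrow> (\<forall>y\<in>cball x (d / 2). w y \<le> w x + B * d powr ((p - 2) / (p - 1)))"
proof -
  define \<alpha> where "\<alpha> = (p - 2) / (p - 1)"
  have \<alpha>: "0 < \<alpha>" "\<alpha> < 1" using p by (auto simp: \<alpha>_def field_simps)
  define C' where "C' = D powr (2 - \<alpha>) * C"
  have C': "C' \<ge> 0" using C by (simp add: C'_def)
  obtain B where B: "B \<ge> 0" "\<forall>w :: real ^ 'n \<Rightarrow> real. continuous_on (cball 0 1) w \<longrightarrow> visc_le \<epsilon> p (\<lambda>_. C') (ball 0 1) w \<longrightarrow>
    (\<forall>z\<in>cball 0 (1/2). w z \<le> w 0 + B)"
    using unit_ball_bound[OF eps p C'] by blast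
  have "w y \<le> w x + B * d powr \<alpha>"
    if A: "open A" and w: "continuous_on A w" and sub: "visc_le \<epsilon> p (\<lambda>_. C) A w"
      and d: "0 < d" "d \<le> D" and x: "cball x d \<subseteq> A" and y: "y \<in> cball x (d / 2)"
    for w :: "real ^ 'n \<Rightarrow> real" and A x d y
  proof -
    define r where "r = 1 / d"
    define b where "b = - ((1 / d) *\<^sub>R x)"
    define S where "S = (\<lambda>z. (1 / r) *\<^sub>R (z - b))"
    have S: "S z = x + d *\<^sub>R z" for z using d by (simp add: S_def r_def b_def algebra_simps)
    define w' where "w' = (\<lambda>z. r powr \<alpha> * w (S z))"
    have r: "r > 0" using d by (simp add: r_def)
    have "visc_le \<epsilon> p (\<lambda>z. r powr (\<alpha> - 2) * C) {z. S z \<in> A} w'"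
      unfolding w'_def S_def \<alpha>_def
      using visc_le_scale[OF sub A r _ p, of "{z. (1 / r) *\<^sub>R (z - b) \<in> A}" b] eps by simp
    then have v1: "visc_le \<epsilon> p (\<lambda>z. C') {z. S z \<in> A} w'"
    proof (rule visc_le_mono)
      have "r powr (\<alpha> - 2) = d powr (2 - \<alpha>)" using d by (simp add: r_def powr_divide powr_minus[symmetric] flip: powr_minus_divide)
      also have "\<dots> \<le> D powr (2 - \<alpha>)" using d \<alpha> by (intro powr_mono2) auto
      finally show "r powr (\<alpha> - 2) * C \<le> C'" unfolding C'_def using C by (intro mult_right_mono)
    qed
    have contS: "continuous_on X S" for X unfolding S_def by (intro continuous_intros)
    then have o1: "open {z. S z \<in> A}" using A open_vimage[of A S] by (simp add: vimage_def)
    have Sb: "S z \<in> A" if "norm z \<le> 1" for z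
    proof -
      have "norm (d *\<^sub>R z) \<le> d" using that d by simp
      then have "S z \<in> cball x d" by (simp add: S dist_norm)
      then show ?thesis using x by blast
    qed
    have "ball 0 1 \<subseteq> {z. S z \<in> A}"
    proof
      fix z :: "real ^ 'n" assume "z \<in> ball 0 1"
      then show "z \<in> {z. S z \<in> A}" using Sb[of z] by simp
    qed
    then have "visc_le \<epsilon> p (\<lambda>z. C') (ball 0 1) w'"
      using eps by (intro visc_le_subset[OF v1 o1 open_ball]) simp_all
    moreover have "continuous_on (cball 0 1) w'"
      unfolding w'_def using Sb by (intro continuous_intros continuous_on_compose2[OF w contS]) auto
    moreover have "(1 / d) *\<^sub>R (y - x) \<in> cball 0 (1/2)"
    proof -
      have "norm ((1 / d) *\<^sub>R (y - x)) = norm (y - x) / d" using d by simp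
      then show ?thesis using y d by (simp add: dist_norm norm_minus_commute pos_divide_le_eq)
    qed
    ultimately have "w' ((1 / d) *\<^sub>R (y - x)) \<le> w' 0 + B" using B(2) by blast
    then have "r powr \<alpha> * w y \<le> r powr \<alpha> * w x + B" using d by (simp add: w'_def S)
    then have "d powr \<alpha> * (r powr \<alpha> * w y) \<le> d powr \<alpha> * (r powr \<alpha> * w x + B)" by (rule mult_left_mono) simp
    moreover have "d powr \<alpha> * r powr \<alpha> = 1" using d by (simp add: r_def flip: powr_mult)
    then have "d powr \<alpha> * (r powr \<alpha> * z) = z" for z by (simp only: mult.assoc[symmetric] mult_1_left)
    ultimately show ?thesis by (simp only: distrib_left mult.commute[of B])
  qed
  then show ?thesis using B(1) unfolding \<alpha>_def by blast
qed

section \<open>Estimate up to the boundary\<close>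

text \<open>The domain contains, for each point of its closure, the cone with this point as vertex and a
ball around the origin as base; the vertex itself is excluded.\<close>

definition coned :: "real \<Rightarrow> (real ^ 'n) set \<Rightarrow> bool" where
  "coned \<kappa> A \<longleftrightarrow> (\<forall>y\<in>closure A. \<forall>t. 0 < t \<longrightarrow> t \<le> 1 \<longrightarrow> ball ((1 - t) *\<^sub>R y) (\<kappa> * t) \<subseteq> A)"

lemma mem_dilate_iff: "r \<noteq> 0 \<Longrightarrow> x \<in> dilate r S \<longleftrightarrow> (1 / r) *\<^sub>R x \<in> S"
  unfolding dilate_def by (auto simp: image_iff intro!: bexI[of _ "(1 / r) *\<^sub>R x"])

lemma closure_dilate: "closure (dilate r S) = dilate r (closure S)"
  unfolding dilate_def by (rule closure_scaleR[symmetric])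

lemma dilate_1: "dilate 1 S = S"
  by (simp add: dilate_def)

lemma open_dilate:
  assumes "r \<noteq> 0" "open S" shows "open (dilate r S)"
  unfolding dilate_def by (rule open_scaling[OF assms])

lemma bounded_dilate: "bounded S \<Longrightarrow> bounded (dilate r S)"
  unfolding dilate_def by (rule bounded_scaling)

text \<open>A point \<open>z\<close> outside \<open>\<Omega>\<close> lies on a ray at or beyond a boundary point.  Dividing \<open>z\<close> by \<open>1 - t\<close> moves it
further out to a dilated boundary, whose distance from the closure of \<open>\<Omega>\<close> is known.\<close>

lemma coned_if_frontier_infdist:
  fixes \<Omega> :: "(real ^ 'n) set"
  assumes op: "open \<Omega>" and \<kappa>: "\<kappa> > 0" "cball 0 \<kappa> \<subseteq> \<Omega>"
    and far: "\<forall>s>0. \<forall>x\<in>dilate (1 + s) (frontier \<Omega>). infdist x (closure \<Omega>) \<ge> \<kappa> * s"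
  shows "coned \<kappa> \<Omega>"
  unfolding coned_def
proof (intro ballI allI impI subsetI)
  fix y t z assume y: "y \<in> closure \<Omega>" and t: "0 < t" "t \<le> 1" and z: "z \<in> ball ((1 - t) *\<^sub>R y) (\<kappa> * t)"
  show "z \<in> \<Omega>"
  proof (cases "t = 1")
    case True
    then show ?thesis using z \<kappa> by auto
  next
    case False
    then have t1: "1 - t > 0" using t by simp
    show ?thesis
    proof (rule ccontr)
      assume nz: "z \<notin> \<Omega>"
      have "0 \<in> \<Omega>" using \<kappa> by auto
      then have "closed_segment 0 z \<inter> frontier \<Omega> \<noteq> {}"
        using nz by (intro connected_Int_frontier) auto
      then obtain b where b: "b \<in> closed_segment 0 z" "b \<in> frontier \<Omega>" by blast
      then obtain a where a: "0 \<le> a" "a \<le> 1" "b = a *\<^sub>R z" by (auto simp: in_segment)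
      have "b \<notin> \<Omega>" using b(2) op by (simp add: frontier_def interior_open)
      then have "a \<noteq> 0" using a \<open>0 \<in> \<Omega>\<close> by auto
      then have a0: "a > 0" using a by simp
      define s where "s = 1 / (a * (1 - t)) - 1"
      have "1 / (1 - t) \<le> 1 / (a * (1 - t))"
        using a a0 t1 by (intro divide_left_mono) (auto simp: mult_le_cancel_right1)
      moreover have "1 / (1 - t) - 1 = t / (1 - t)" using t1 by (simp add: field_simps)
      ultimately have s: "s \<ge> t / (1 - t)" by (simp add: s_def)
      have s0: "s > 0" using s t t1 by (metis divide_pos_pos less_le_trans)
      define w where "w = (1 / (1 - t)) *\<^sub>R z"
      have "w = (1 + s) *\<^sub>R b" using a0 t1 by (simp add: w_def s_def a(3))
      then have "w \<in> dilate (1 + s) (frontier \<Omega>)" using b(2) by (auto simp: dilate_def)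
      then have "\<kappa> * s \<le> infdist w (closure \<Omega>)" using far s0 by blast
      also have "\<dots> \<le> dist w y" by (rule infdist_le[OF y])
      also have "\<dots> = norm ((1 / (1 - t)) *\<^sub>R (z - (1 - t) *\<^sub>R y))"
        using t1 by (simp add: w_def dist_norm scaleR_diff_right)
      also have "\<dots> = norm (z - (1 - t) *\<^sub>R y) / (1 - t)" using t1 by simp
      also have "\<dots> < \<kappa> * t / (1 - t)"
        using z t1 by (intro divide_strict_right_mono) (auto simp: dist_norm norm_minus_commute)
      also have "\<dots> \<le> \<kappa> * s" using mult_left_mono[OF s, of \<kappa>] \<kappa> by simp
      finally show False by simp
    qed
  qed
qed

lemma coned_dilate:
  assumes "coned \<kappa> A" "r > 0"
  shows "coned (\<kappa> * r) (dilate r A)"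
  unfolding coned_def
proof (intro ballI allI impI subsetI)
  fix y t z assume y: "y \<in> closure (dilate r A)" and t: "0 < t" "t \<le> 1" and z: "z \<in> ball ((1 - t) *\<^sub>R y) (\<kappa> * r * t)"
  obtain y' where y': "y' \<in> closure A" "y = r *\<^sub>R y'" using y[unfolded closure_dilate] unfolding dilate_def by auto
  have "(1 - t) *\<^sub>R y - z = r *\<^sub>R ((1 - t) *\<^sub>R y' - (1 / r) *\<^sub>R z)"
    using assms(2) by (simp add: y' scaleR_diff_right mult.commute)
  then have "r * norm ((1 - t) *\<^sub>R y' - (1 / r) *\<^sub>R z) < r * (\<kappa> * t)"
    using z assms(2) by (simp add: dist_norm mult_ac)
  then have "(1 / r) *\<^sub>R z \<in> ball ((1 - t) *\<^sub>R y') (\<kappa> * t)" using assms(2) by (simp add: dist_norm)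
  then have "(1 / r) *\<^sub>R z \<in> A" using assms(1) y' t unfolding coned_def by blast
  then show "z \<in> dilate r A" using mem_dilate_iff[of r z A] assms(2) by simp
qed

lemma coned_shrink_mem:
  assumes "coned \<kappa> A" "\<kappa> > 0" "y \<in> closure A" "0 < t" "t \<le> 1"
  shows "(1 - t) *\<^sub>R y \<in> A"
proof -
  have "(1 - t) *\<^sub>R y \<in> ball ((1 - t) *\<^sub>R y) (\<kappa> * t)" using assms by simp
  then show ?thesis using assms unfolding coned_def by blast
qed

lemma closure_dilate_subset:
  assumes "coned \<kappa> A" "\<kappa> > 0" "0 < r1" "r1 < r2"
  shows "closure (dilate r1 A) \<subseteq> dilate r2 A"
proof
  fix x assume "x \<in> closure (dilate r1 A)"
  then have "x \<in> dilate r1 (closure A)" unfolding closure_dilate .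
  then obtain y where y: "y \<in> closure A" "x = r1 *\<^sub>R y" unfolding dilate_def by auto
  have "(1 - (1 - r1 / r2)) *\<^sub>R y \<in> A"
    by (rule coned_shrink_mem[OF assms(1,2) y(1)]) (use assms in auto)
  then show "x \<in> dilate r2 A" using mem_dilate_iff[of r2 x A] assms y by simp
qed

text \<open>The points \<open>(1 - t q^j) y\<close> approach \<open>y\<close> geometrically, and so do their distances from the boundary
because of the cone condition.  The interior estimate for consecutive points produces a
convergent geometric series.\<close>

lemma boundary_modulus:
  assumes eps: "\<epsilon> > 0" and p: "p > 2" and C: "C \<ge> 0" and \<kappa>: "\<kappa> > 0" and R: "R > 0"
  shows "\<exists>B\<ge>0. \<forall>(w :: real ^ 'n \<Rightarrow> real) A. open A \<longrightarrow> coned \<kappa> A \<longrightarrow> A \<subseteq> cball 0 R \<longrightarrow> continuous_on A w \<longrightarrow>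
    visc_le \<epsilon> p (\<lambda>_. C) A w \<longrightarrow>
    (\<forall>y\<in>A. \<forall>t. 0 < t \<longrightarrow> t \<le> 1 \<longrightarrow> \<bar>w y - w ((1 - t) *\<^sub>R y)\<bar> \<le> B * t powr ((p - 2) / (p - 1)))"
proof -
  define \<alpha> where "\<alpha> = (p - 2) / (p - 1)"
  have \<alpha>: "0 < \<alpha>" "\<alpha> < 1" using p by (auto simp: \<alpha>_def field_simps)
  obtain B0 where B0: "B0 \<ge> 0" "\<forall>(w :: real ^ 'n \<Rightarrow> real) A x d. open A \<longrightarrow> continuous_on A w \<longrightarrow> visc_le \<epsilon> p (\<lambda>_. C) A w \<longrightarrow>
    0 < d \<longrightarrow> d \<le> \<kappa> \<longrightarrow> cball x d \<subseteq> A \<longrightarrow> (\<forall>y\<in>cball x (d / 2). w y \<le> w x + B0 * d powr \<alpha>)"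
    using interior_bound[OF eps p C \<kappa>] unfolding \<alpha>_def by blast
  \<comment> \<open>With this ratio, consecutive points are close compared with their distances from the boundary.\<close>
  define q where "q = R / (R + \<kappa> / 4)"
  have q: "0 < q" "q < 1" using R \<kappa> by (auto simp: q_def)
  have qR: "(1 - q) * R = q * (\<kappa> / 4)" using R \<kappa> by (simp add: q_def field_simps)
  define \<theta> where "\<theta> = q powr \<alpha>"
  have \<theta>: "0 < \<theta>" "\<theta> < 1" using q \<alpha> powr_less_mono2[of \<alpha> q 1] by (auto simp: \<theta>_def)
  define B where "B = B0 * (\<kappa> / 2) powr \<alpha> / (1 - \<theta>)"
  have B: "B \<ge> 0" using B0 \<theta> by (simp add: B_def)
  have "\<bar>w y - w ((1 - t) *\<^sub>R y)\<bar> \<le> B * t powr \<alpha>"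
    if A: "open A" "coned \<kappa> A" "A \<subseteq> cball 0 R" and w: "continuous_on A w" and sub: "visc_le \<epsilon> p (\<lambda>_. C) A w"
      and y: "y \<in> A" and t: "0 < t" "t \<le> 1" for w :: "real ^ 'n \<Rightarrow> real" and A y t
  proof -
    define x where "x = (\<lambda>j::nat. (1 - t * q ^ j) *\<^sub>R y)"
    define d where "d = (\<lambda>j::nat. \<kappa> * (t * q ^ j) / 2)"
    have tq: "0 < t * q ^ j" "t * q ^ j \<le> 1" for j
    proof -
      show "0 < t * q ^ j" using t q by simp
      have "q ^ j \<le> 1" using q by (intro power_le_one) auto
      then show "t * q ^ j \<le> 1" using t q by (metis mult_le_one zero_le_power less_imp_le)
    qed
    have d: "0 < d j" "d j \<le> \<kappa>" "d (Suc j) \<le> d j" for j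
    proof -
      show "0 < d j" unfolding d_def using tq(1)[of j] \<kappa> by simp
      have "\<kappa> * (t * q ^ j) \<le> \<kappa> * 1" using tq(2)[of j] \<kappa> by (intro mult_left_mono) auto
      then show "d j \<le> \<kappa>" using \<kappa> by (simp add: d_def)
      have "\<kappa> * (t * (q * q ^ j)) \<le> \<kappa> * (t * (1 * q ^ j))" using q t \<kappa> by (intro mult_left_mono mult_right_mono) auto
      then show "d (Suc j) \<le> d j" by (simp add: d_def)
    qed
    have ball: "cball (x j) (d j) \<subseteq> A" for j
    proof -
      have "d j < \<kappa> * (t * q ^ j)" unfolding d_def using tq(1)[of j] \<kappa> by simp
      then have "cball (x j) (d j) \<subseteq> ball ((1 - t * q ^ j) *\<^sub>R y) (\<kappa> * (t * q ^ j))" by (auto simp: x_def)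
      also have "\<dots> \<subseteq> A" using A(2) tq[of j] closure_subset y unfolding coned_def by blast
      finally show ?thesis .
    qed
    have step: "dist (x j) (x (Suc j)) \<le> d (Suc j) / 2" for j
    proof -
      have "x (Suc j) - x j = (t * q ^ j * (1 - q)) *\<^sub>R y"
        unfolding x_def scaleR_diff_left[symmetric] by (simp add: algebra_simps)
      then have "dist (x j) (x (Suc j)) = t * q ^ j * (1 - q) * norm y"
        using q t by (simp add: dist_norm norm_minus_commute[of "x j"] abs_mult)
      also have "\<dots> \<le> t * q ^ j * (1 - q) * R" using q t y A(3) by (intro mult_left_mono) auto
      also have "\<dots> = t * q ^ j * (q * (\<kappa> / 4))" using qR by (simp add: mult.assoc)
      also have "\<dots> = d (Suc j) / 2" by (simp add: d_def)
      finally show ?thesis .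
    qed
    define D where "D = B0 * (\<kappa> * t / 2) powr \<alpha>"
    have D: "D \<ge> 0" using B0 by (simp add: D_def)
    have dp: "B0 * d j powr \<alpha> = D * \<theta> ^ j" for j
    proof -
      have "d j = (\<kappa> * t / 2) * q ^ j" by (simp add: d_def)
      then have "d j powr \<alpha> = (\<kappa> * t / 2) powr \<alpha> * (q ^ j) powr \<alpha>" by (simp only: powr_mult)
      moreover have "(q ^ j) powr \<alpha> = \<theta> ^ j" unfolding \<theta>_def using q
        by (simp add: powr_realpow[symmetric] powr_powr mult.commute)
      ultimately show ?thesis by (simp add: D_def)
    qed
    have inc: "\<bar>w (x (Suc j)) - w (x j)\<bar> \<le> D * \<theta> ^ j" for j
    proof -
      have "w (x (Suc j)) \<le> w (x j) + B0 * d j powr \<alpha>"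
        using B0(2) A(1) w sub d[of j] ball[of j] step[of j] by simp
      moreover have "w (x j) \<le> w (x (Suc j)) + B0 * d (Suc j) powr \<alpha>"
        using B0(2) A(1) w sub d[of "Suc j"] ball[of "Suc j"] step[of j] by (simp add: dist_commute)
      moreover have "B0 * d (Suc j) powr \<alpha> \<le> B0 * d j powr \<alpha>"
        using d[of j] d[of "Suc j"] \<alpha> B0 by (intro mult_left_mono powr_mono2) auto
      ultimately show ?thesis unfolding dp by simp
    qed
    have sum: "\<bar>w (x J) - w (x 0)\<bar> \<le> D * (\<Sum>j<J. \<theta> ^ j)" for J
    proof (induction J)
      case (Suc J)
      then show ?case using inc[of J] by (simp add: distrib_left)
    qed simp
    have "(\<Sum>j<J. \<theta> ^ j) \<le> 1 / (1 - \<theta>)" for J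
      using \<theta> by (simp add: sum_gp_strict divide_right_mono)
    then have "D * (\<Sum>j<J. \<theta> ^ j) \<le> D * (1 / (1 - \<theta>))" for J using D by (intro mult_left_mono)
    then have bd: "\<bar>w (x J) - w (x 0)\<bar> \<le> D / (1 - \<theta>)" for J using sum[of J] by (metis order_trans times_divide_eq_right mult.right_neutral)
    have "(\<lambda>J. x J) \<longlonglongrightarrow> (1 - t * 0) *\<^sub>R y"
      unfolding x_def using q by (intro tendsto_intros LIMSEQ_power_zero) auto
    then have xy: "x \<longlonglongrightarrow> y" by simp
    have "x j \<in> A" for j using ball[of j] d(1)[of j] by (auto simp: subset_iff)
    then have "(\<lambda>J. w (x J)) \<longlonglongrightarrow> w y"
      by (intro continuous_on_tendsto_compose[OF w xy y] always_eventually allI)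
    then have "(\<lambda>J. \<bar>w (x J) - w (x 0)\<bar>) \<longlonglongrightarrow> \<bar>w y - w (x 0)\<bar>" by (intro tendsto_intros)
    from tendsto_upperbound[OF this, of "D / (1 - \<theta>)"] have "\<bar>w y - w (x 0)\<bar> \<le> D / (1 - \<theta>)"
      using bd by simp
    also have "D = B0 * (\<kappa> / 2) powr \<alpha> * t powr \<alpha>"
    proof -
      have "\<kappa> * t / 2 = (\<kappa> / 2) * t" by simp
      then show ?thesis unfolding D_def by (simp only: powr_mult mult.assoc)
    qed
    finally show ?thesis by (simp add: x_def B_def)
  qed
  then show ?thesis using B unfolding \<alpha>_def by blast
qed

lemma boundary_modulus_closure:
  assumes eps: "\<epsilon> > 0" and p: "p > 2" and C: "C \<ge> 0" and \<kappa>: "\<kappa> > 0" and R: "R > 0"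
  shows "\<exists>B\<ge>0. \<forall>(w :: real ^ 'n \<Rightarrow> real) A. open A \<longrightarrow> coned \<kappa> A \<longrightarrow> A \<subseteq> cball 0 R \<longrightarrow> continuous_on (closure A) w \<longrightarrow>
    visc_le \<epsilon> p (\<lambda>_. C) A w \<longrightarrow>
    (\<forall>y\<in>closure A. \<forall>t. 0 < t \<longrightarrow> t \<le> 1 \<longrightarrow> \<bar>w y - w ((1 - t) *\<^sub>R y)\<bar> \<le> B * t powr ((p - 2) / (p - 1)))"
proof -
  obtain B where B: "B \<ge> 0" "\<forall>(w :: real ^ 'n \<Rightarrow> real) A. open A \<longrightarrow> coned \<kappa> A \<longrightarrow> A \<subseteq> cball 0 R \<longrightarrow> continuous_on A w \<longrightarrow>
    visc_le \<epsilon> p (\<lambda>_. C) A w \<longrightarrow>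
    (\<forall>y\<in>A. \<forall>t. 0 < t \<longrightarrow> t \<le> 1 \<longrightarrow> \<bar>w y - w ((1 - t) *\<^sub>R y)\<bar> \<le> B * t powr ((p - 2) / (p - 1)))"
    using boundary_modulus[OF assms] by blast
  have "\<bar>w y - w ((1 - t) *\<^sub>R y)\<bar> \<le> B * t powr ((p - 2) / (p - 1))"
    if A: "open A" "coned \<kappa> A" "A \<subseteq> cball 0 R" and w: "continuous_on (closure A) w" and sub: "visc_le \<epsilon> p (\<lambda>_. C) A w"
      and y: "y \<in> closure A" and t: "0 < t" "t \<le> 1" for w :: "real ^ 'n \<Rightarrow> real" and A y t
  proof -
    have wA: "continuous_on A w" by (rule continuous_on_subset[OF w closure_subset])
    define z where "z = (\<lambda>k::nat. (1 - 1 / real (Suc k)) *\<^sub>R y)"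
    have zA: "z k \<in> A" for k unfolding z_def by (rule coned_shrink_mem[OF A(2) \<kappa> y]) auto
    have "(\<lambda>k. z k) \<longlonglongrightarrow> (1 - 0) *\<^sub>R y"
      unfolding z_def by (intro tendsto_intros LIMSEQ_Suc[OF lim_1_over_n])
    then have z: "z \<longlonglongrightarrow> y" by simp
    have in1: "(1 - t) *\<^sub>R z k \<in> A" for k
      using coned_shrink_mem[OF A(2) \<kappa> _ t] zA closure_subset by blast
    have in2: "(1 - t) *\<^sub>R y \<in> A" by (rule coned_shrink_mem[OF A(2) \<kappa> y t])
    have 1: "(\<lambda>k. w (z k)) \<longlonglongrightarrow> w y"
      by (intro continuous_on_tendsto_compose[OF w z y] always_eventually allI subsetD[OF closure_subset zA])
    have 2: "(\<lambda>k. w ((1 - t) *\<^sub>R z k)) \<longlonglongrightarrow> w ((1 - t) *\<^sub>R y)"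
      using in1 by (intro continuous_on_tendsto_compose[OF wA _ in2] tendsto_intros z) auto
    have "(\<lambda>k. \<bar>w (z k) - w ((1 - t) *\<^sub>R z k)\<bar>) \<longlonglongrightarrow> \<bar>w y - w ((1 - t) *\<^sub>R y)\<bar>"
      by (intro tendsto_intros 1 2)
    moreover have "\<bar>w (z k) - w ((1 - t) *\<^sub>R z k)\<bar> \<le> B * t powr ((p - 2) / (p - 1))" for k
      using B(2) A wA sub zA t by blast
    ultimately show ?thesis by (intro tendsto_upperbound) auto
  qed
  then show ?thesis using B(1) by blast
qed

section \<open>Attainment of the additive eigenvalue\<close>

lemma visc_le_shift:
  assumes "visc_le \<epsilon> p h A w"
  shows "visc_le \<epsilon> p h A (\<lambda>x. w x - c)"
proof -
  have "local_max_on (\<lambda>y. w y - c - \<phi> y) A x = local_max_on (\<lambda>y. w y - \<phi> y) A x" for \<phi> x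
    unfolding local_max_on_def by (simp add: algebra_simps)
  then show ?thesis using assms unfolding visc_le_def by simp
qed

lemma bounded_seq_limsup:
  fixes X :: "nat \<Rightarrow> real"
  assumes B: "\<And>k. \<bar>X k\<bar> \<le> B"
  shows "\<exists>l. (\<forall>e>0. \<forall>\<^sub>F k in sequentially. X k \<le> l + e) \<and> (\<forall>e>0. \<forall>k0. \<exists>k\<ge>k0. X k \<ge> l - e)"
proof -
  define T where "T = {a. \<forall>\<^sub>F k in sequentially. X k \<le> a}"
  have BT: "B \<in> T" unfolding T_def using B by (auto simp: abs_le_iff intro: always_eventually)
  have lb: "- B \<le> a" if "a \<in> T" for a
  proof -
    have "\<exists>k. X k \<le> a" using that unfolding T_def eventually_sequentially by blast
    then show ?thesis using B by (meson abs_le_iff minus_le_iff order_trans)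
  qed
  then have bdd: "bdd_below T" by (auto simp: bdd_below_def)
  have "\<forall>\<^sub>F k in sequentially. X k \<le> Inf T + e" if "e > 0" for e
  proof -
    obtain a where "a \<in> T" "a < Inf T + e"
      using cInf_lessD[of T "Inf T + e"] BT \<open>e > 0\<close> by (metis empty_iff less_add_same_cancel1)
    then show ?thesis unfolding T_def by (auto elim: eventually_mono)
  qed
  moreover have "\<exists>k\<ge>k0. X k \<ge> Inf T - e" if "e > 0" for e k0
  proof (rule ccontr)
    assume "\<not> (\<exists>k\<ge>k0. X k \<ge> Inf T - e)"
    then have "\<forall>k\<ge>k0. X k \<le> Inf T - e" by (meson not_le less_imp_le)
    then have "\<forall>\<^sub>F k in sequentially. X k \<le> Inf T - e" unfolding eventually_sequentially by blast
    then have "Inf T - e \<in> T" by (simp add: T_def)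
    then have "Inf T \<le> Inf T - e" using bdd by (rule cInf_lower)
    then show False using that by simp
  qed
  ultimately show ?thesis by blast
qed

text \<open>Stability of subsolutions under upper limits.  A quadratic term makes the maximum at \<open>x\<close> strict;
then \<open>W k\<close> minus the test function has a maximum at a point near \<open>x\<close>, where the inequality for
\<open>W k\<close> is available.\<close>

lemma upper_limit_subsolution:
  fixes w :: "real ^ 'n \<Rightarrow> real" and W :: "nat \<Rightarrow> real ^ 'n \<Rightarrow> real"
  assumes A: "open A" and f: "continuous_on A f" and eps: "\<epsilon> > 0" and p: "p > 0"
    and W: "\<And>k. continuous_on A (W k)" "\<And>k. visc_le \<epsilon> p (\<lambda>x. f x + c k) A (W k)"
    and c: "c \<longlonglongrightarrow> c0"
    and low: "\<And>x e k0. x \<in> A \<Longrightarrow> e > 0 \<Longrightarrow> \<exists>k\<ge>k0. W k x \<ge> w x - e"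
    and up: "\<And>K e. compact K \<Longrightarrow> K \<subseteq> A \<Longrightarrow> e > 0 \<Longrightarrow> \<forall>\<^sub>F k in sequentially. \<forall>y\<in>K. W k y \<le> w y + e"
  shows "visc_le \<epsilon> p (\<lambda>x. f x + c0) A w"
  unfolding visc_le_def
proof (intro ballI allI impI)
  fix x \<phi> G M
  assume x: "x \<in> A" and jet: "C2_jet A A \<phi> G M" and max: "local_max_on (\<lambda>y. w y - \<phi> y) A x"
  define n where "n = real CARD('n)"
  have cont: "continuous_on A \<phi>" "continuous_on A G" "continuous_on A M"
    and d1: "\<And>y. y \<in> A \<Longrightarrow> (\<phi> has_derivative (\<lambda>h. G y \<bullet> h)) (at y)"
    and d2: "\<And>y. y \<in> A \<Longrightarrow> (G has_derivative (\<lambda>h. M y *v h)) (at y)"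
    using jet unfolding C2_jet_def by auto
  have "\<forall>\<^sub>F y in nhds x. w y - \<phi> y \<le> w x - \<phi> x"
    by (rule iffD1[OF local_max_on_open_iff[OF A x] max])
  then obtain r1 where r1: "r1 > 0" "\<And>y. dist y x < r1 \<Longrightarrow> w y - \<phi> y \<le> w x - \<phi> x"
    unfolding eventually_nhds_metric by blast
  obtain r2 where r2: "r2 > 0" "cball x r2 \<subseteq> A" using A x open_contains_cball by blast
  define r where "r = min (r1 / 2) r2"
  have r: "r > 0" "cball x r \<subseteq> A" "\<And>y. y \<in> cball x r \<Longrightarrow> w y - \<phi> y \<le> w x - \<phi> x"
    using r1 r2 by (auto simp: r_def dist_commute subset_iff)
  have key: "norm (G x) powr p - \<epsilon> * trace (M x) - f x - \<epsilon> * (2 * \<eta> * n) \<le> c0" if \<eta>: "\<eta> > 0" for \<eta>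
  proof (rule field_le_epsilon)
    fix e :: real assume e: "e > 0"
    define E where "E = (\<lambda>y. norm (G y + (2 * \<eta>) *\<^sub>R (y - x)) powr p - \<epsilon> * trace (M y) - f y)"
    have "continuous_on A E"
      unfolding E_def using p by (intro continuous_intros cont f continuous_on_powr') auto
    then have "isCont E x" using A x continuous_on_eq_continuous_at by blast
    then obtain d where d: "d > 0" "\<And>y. dist y x < d \<Longrightarrow> \<bar>E y - E x\<bar> < e / 2"
      unfolding continuous_at_eps_delta using e by (metis dist_real_def half_gt_zero)
    define \<delta> where "\<delta> = min r d"
    have \<delta>: "\<delta> > 0" using r d by (simp add: \<delta>_def)
    \<comment> \<open>small enough to keep the maximum point within \<delta> of x\<close>
    define e' where "e' = \<eta> * \<delta>\<^sup>2 / 4"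
    have e': "e' > 0" using \<eta> \<delta> by (simp add: e'_def)
    have K: "compact (cball x r)" by simp
    have ev1: "\<forall>\<^sub>F k in sequentially. \<forall>y\<in>cball x r. W k y \<le> w y + e'" by (rule up[OF K r(2) e'])
    have ev2: "\<forall>\<^sub>F k in sequentially. c k < c0 + e / 2" using order_tendstoD(2)[OF c, of "c0 + e / 2"] e by simp
    obtain k0 where k0: "\<forall>k\<ge>k0. (\<forall>y\<in>cball x r. W k y \<le> w y + e') \<and> c k < c0 + e / 2"
      using eventually_conj[OF ev1 ev2] unfolding eventually_sequentially by blast
    obtain k where k: "k \<ge> k0" "W k x \<ge> w x - e'" using low[OF x e'] by blast
    define \<psi> where "\<psi> = (\<lambda>y. \<phi> y + \<eta> * ((y - x) \<bullet> (y - x)))"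
    have cont\<psi>: "continuous_on (cball x r) (\<lambda>y. W k y - \<psi> y)"
      unfolding \<psi>_def by (intro continuous_intros continuous_on_subset[OF W(1) r(2)] continuous_on_subset[OF cont(1) r(2)])
    have "cball x r \<noteq> {}" using r(1) by simp
    from continuous_attains_sup[OF K this cont\<psi>]
    obtain z where z: "z \<in> cball x r" "\<And>y. y \<in> cball x r \<Longrightarrow> W k y - \<psi> y \<le> W k z - \<psi> z" by blast
    have "w x - e' - \<phi> x \<le> W k x - \<psi> x" using k by (simp add: \<psi>_def)
    also have "\<dots> \<le> W k z - \<psi> z" using z(2)[of x] r(1) by simp
    also have "\<dots> \<le> w z + e' - \<psi> z" using k0 k(1) z(1) by simp
    also have "\<dots> \<le> w x - \<phi> x + e' - \<eta> * (norm (z - x))\<^sup>2"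
      using r(3)[OF z(1)] by (simp add: \<psi>_def dot_square_norm)
    finally have "\<eta> * (norm (z - x))\<^sup>2 \<le> \<eta> * (\<delta>\<^sup>2 / 2)" by (simp add: e'_def)
    then have "(norm (z - x))\<^sup>2 \<le> \<delta>\<^sup>2 / 2" using \<eta> by simp
    also have "\<dots> < \<delta>\<^sup>2" using \<delta> by simp
    finally have "norm (z - x) < \<delta>" using \<delta> by (simp add: power_less_imp_less_base less_imp_le)
    then have zr: "dist z x < r" "dist z x < d" by (auto simp: \<delta>_def dist_norm)
    have zA: "z \<in> A" using z(1) r(2) by blast
    have evA: "\<forall>\<^sub>F y in nhds z. y \<in> A" by (rule eventually_nhds_in_open[OF A zA])
    have "jet_at \<psi> (\<lambda>y. G y + (2 * \<eta>) *\<^sub>R (y - x)) (M z + (2 * \<eta>) *\<^sub>R mat 1) z"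
      unfolding jet_at_def
    proof
      show "\<forall>\<^sub>F y in nhds z. (\<psi> has_derivative (\<lambda>h. (G y + (2 * \<eta>) *\<^sub>R (y - x)) \<bullet> h)) (at y)"
        using evA
      proof eventually_elim
        case (elim y)
        have "((\<lambda>y. (y - x) \<bullet> (y - x)) has_derivative (\<lambda>h. 2 * ((y - x) \<bullet> h))) (at y)"
          by (auto intro!: derivative_eq_intros simp: inner_commute)
        from has_derivative_add[OF d1[OF elim] has_derivative_mult_right[OF this, of \<eta>]]
        show ?case unfolding \<psi>_def by (rule has_derivative_eq_rhs) (simp add: fun_eq_iff inner_add_left)
      qed
      have "((\<lambda>y. (2 * \<eta>) *\<^sub>R (y - x)) has_derivative (\<lambda>h. (2 * \<eta>) *\<^sub>R h)) (at z)"
        by (auto intro!: derivative_eq_intros)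
      from has_derivative_add[OF d2[OF zA] this]
      show "((\<lambda>y. G y + (2 * \<eta>) *\<^sub>R (y - x)) has_derivative (\<lambda>h. (M z + (2 * \<eta>) *\<^sub>R mat 1) *v h)) (at z)"
        by (rule has_derivative_eq_rhs)
          (simp add: fun_eq_iff matrix_vector_mult_add_rdistrib scaleR_matrix_vector_assoc[symmetric])
    qed
    moreover have "\<forall>\<^sub>F y in nhds z. W k y - \<psi> y \<le> W k z - \<psi> z"
    proof -
      have "z \<in> ball x r" using zr by (simp add: dist_commute)
      from eventually_nhds_in_open[OF open_ball this] show ?thesis
        by eventually_elim (use z(2) in auto)
    qed
    ultimately have "norm (G z + (2 * \<eta>) *\<^sub>R (z - x)) powr p - \<epsilon> * trace (M z + (2 * \<eta>) *\<^sub>R mat 1) \<le> f z + c k"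
      using eps by (intro visc_le_jet_at[OF W(2) A zA]) auto
    then have "E z - \<epsilon> * (2 * \<eta> * n) \<le> c k" by (simp add: E_def trace_add trace_scaleR trace_mat_1 n_def algebra_simps)
    moreover have "c k < c0 + e / 2" using k0 k(1) by blast
    moreover have "\<bar>E z - E x\<bar> < e / 2" by (rule d(2)[OF zr(2)])
    ultimately have "E x - \<epsilon> * (2 * \<eta> * n) \<le> c0 + e" by linarith
    then show "norm (G x) powr p - \<epsilon> * trace (M x) - f x - \<epsilon> * (2 * \<eta> * n) \<le> c0 + e" by (simp add: E_def)
  qed
  have lim: "((\<lambda>\<eta>. norm (G x) powr p - \<epsilon> * trace (M x) - f x - \<epsilon> * (2 * \<eta> * n)) \<longlongrightarrow>
      norm (G x) powr p - \<epsilon> * trace (M x) - f x - \<epsilon> * (2 * 0 * n)) (at_right 0)"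
    by (intro tendsto_intros)
  have "\<forall>\<^sub>F \<eta> in at_right 0. norm (G x) powr p - \<epsilon> * trace (M x) - f x - \<epsilon> * (2 * \<eta> * n) \<le> c0"
    by (rule eventually_mono[OF eventually_at_right_less[of "0::real"] key])
  from tendsto_upperbound[OF lim this] show "norm (G x) powr p - \<epsilon> * trace (M x) \<le> f x + c0" by simp
qed

text \<open>Take subsolutions for constants decreasing to the infimum, normalised at the origin.  The cone
estimate bounds them and the interior estimate makes them equicontinuous, so their upper limit
is a continuous subsolution for the infimum.\<close>

lemma additive_eigenvalue_attained:
  fixes A :: "(real ^ 'n) set"
  assumes eps: "\<epsilon> > 0" and p: "p > 2" and A: "open A" "coned \<kappa> A" "bounded A" and \<kappa>: "\<kappa> > 0"
    and f: "continuous_on A f" "bounded (f ` A)" and ne: "A \<noteq> {}"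
    and ex: "\<exists>c w. continuous_on A w \<and> visc_le \<epsilon> p (\<lambda>x. f x + c) A w"
    and lb: "\<And>c w. continuous_on A w \<Longrightarrow> visc_le \<epsilon> p (\<lambda>x. f x + c) A w \<Longrightarrow> L \<le> c"
  shows "\<exists>w. continuous_on A w \<and> visc_le \<epsilon> p (\<lambda>x. f x + additive_eigenvalue \<epsilon> (hamiltonian p f) A) A w"
proof -
  define \<alpha> where "\<alpha> = (p - 2) / (p - 1)"
  have \<alpha>: "0 < \<alpha>" using p by (simp add: \<alpha>_def)
  define S where "S = {c. \<exists>w. continuous_on A w \<and> visc_le \<epsilon> p (\<lambda>x. f x + c) A w}"
  have Sne: "S \<noteq> {}" using ex by (auto simp: S_def)
  have bdd: "bdd_below S" using lb by (auto simp: S_def bdd_below_def)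
  define c0 where "c0 = Inf S"
  have "\<exists>c w. continuous_on A w \<and> visc_le \<epsilon> p (\<lambda>x. f x + c) A w \<and> c0 \<le> c \<and> c < c0 + 1 / real (Suc k)" for k
  proof -
    obtain c where "c \<in> S" "c < c0 + 1 / real (Suc k)"
      using cInf_lessD[OF Sne, of "c0 + 1 / real (Suc k)"] by (auto simp: c0_def)
    moreover from \<open>c \<in> S\<close> have "c0 \<le> c" unfolding c0_def using bdd by (rule cInf_lower)
    ultimately show ?thesis by (auto simp: S_def)
  qed
  then obtain c w0 where w0: "\<And>k. continuous_on A (w0 k)" "\<And>k. visc_le \<epsilon> p (\<lambda>x. f x + c k) A (w0 k)"
    and c: "\<And>k. c0 \<le> c k" "\<And>k. c k < c0 + 1 / real (Suc k)" by metis
  define W where "W = (\<lambda>k x. w0 k x - w0 k 0)"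
  have W: "continuous_on A (W k)" "visc_le \<epsilon> p (\<lambda>x. f x + c k) A (W k)" for k
    unfolding W_def by (intro continuous_intros w0 visc_le_shift)+
  have clim: "c \<longlonglongrightarrow> c0"
  proof (rule tendsto_sandwich[of "\<lambda>_. c0" _ _ "\<lambda>k. c0 + 1 / real (Suc k)"])
    have "(\<lambda>k. c0 + 1 / real (Suc k)) \<longlonglongrightarrow> c0 + 0" by (intro tendsto_intros LIMSEQ_Suc[OF lim_1_over_n])
    then show "(\<lambda>k. c0 + 1 / real (Suc k)) \<longlonglongrightarrow> c0" by simp
  qed (use c in \<open>auto intro!: always_eventually less_imp_le\<close>)
  obtain F where F: "\<And>x. x \<in> A \<Longrightarrow> \<bar>f x\<bar> \<le> F" using f(2) unfolding bounded_iff by auto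
  obtain R0 where R0: "\<And>x. x \<in> A \<Longrightarrow> norm x \<le> R0" using A(3) unfolding bounded_iff by auto
  define R where "R = max 1 R0"
  have R: "R > 0" "A \<subseteq> cball 0 R" using R0 by (force simp: R_def)+
  define C where "C = \<bar>F\<bar> + \<bar>c0\<bar> + 1"
  have C: "C \<ge> 0" by (simp add: C_def)
  have WC: "visc_le \<epsilon> p (\<lambda>_. C) A (W k)" for k
  proof (rule visc_le_mono[OF W(2)])
    fix x assume x: "x \<in> A"
    have "1 / real (Suc k) \<le> 1" by simp
    then have "c k \<le> c0 + 1" using c(2)[of k] by linarith
    then show "f x + c k \<le> C" unfolding C_def using F[OF x] by linarith
  qed
  obtain B where B: "B \<ge> 0" "\<forall>(w :: real ^ 'n \<Rightarrow> real) A. open A \<longrightarrow> coned \<kappa> A \<longrightarrow> A \<subseteq> cball 0 R \<longrightarrow> continuous_on A w \<longrightarrow>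
    visc_le \<epsilon> p (\<lambda>_. C) A w \<longrightarrow>
    (\<forall>y\<in>A. \<forall>t. 0 < t \<longrightarrow> t \<le> 1 \<longrightarrow> \<bar>w y - w ((1 - t) *\<^sub>R y)\<bar> \<le> B * t powr ((p - 2) / (p - 1)))"
    using boundary_modulus[OF eps p C \<kappa> R(1)] by blast
  have Wb: "\<bar>W k y\<bar> \<le> B" if "y \<in> A" for k y
  proof -
    have "\<bar>W k y - W k ((1 - 1) *\<^sub>R y)\<bar> \<le> B * 1 powr ((p - 2) / (p - 1))"
      using B(2) A R(2) W(1) WC that zero_less_one order_refl by blast
    then show ?thesis by (simp add: W_def)
  qed
  obtain B1 where B1: "B1 \<ge> 0" "\<forall>(w :: real ^ 'n \<Rightarrow> real) A x d. open A \<longrightarrow> continuous_on A w \<longrightarrow> visc_le \<epsilon> p (\<lambda>_. C) A w \<longrightarrow>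
    0 < d \<longrightarrow> d \<le> 1 \<longrightarrow> cball x d \<subseteq> A \<longrightarrow> (\<forall>y\<in>cball x (d / 2). w y \<le> w x + B1 * d powr \<alpha>)"
    using interior_bound[OF eps p C zero_less_one] unfolding \<alpha>_def by blast
  have equi: "\<exists>d>0. ball x d \<subseteq> A \<and> (\<forall>y\<in>ball x d. \<forall>k. \<bar>W k y - W k x\<bar> \<le> e)" if x: "x \<in> A" and e: "e > 0" for x e
  proof -
    obtain d0 where d0: "d0 > 0" "cball x d0 \<subseteq> A" using A(1) x open_contains_cball by blast
    define d where "d = min (min 1 d0) ((e / (B1 + 1)) powr (1 / \<alpha>))"
    have d: "0 < d" "d \<le> 1" "d \<le> d0" using d0 e B1 by (auto simp: d_def)
    have "d powr \<alpha> \<le> ((e / (B1 + 1)) powr (1 / \<alpha>)) powr \<alpha>" using d \<alpha> by (intro powr_mono2) (auto simp: d_def)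
    also have "\<dots> = e / (B1 + 1)" using \<alpha> e B1 by (simp add: powr_powr)
    finally have "B1 * d powr \<alpha> \<le> B1 * (e / (B1 + 1))" using B1 by (intro mult_left_mono)
    also have "\<dots> \<le> e" using B1 e by (simp add: field_simps)
    finally have de: "B1 * d powr \<alpha> \<le> e" .
    have "\<bar>W k y - W k x\<bar> \<le> e" if y: "y \<in> ball x (d / 4)" for y k
    proof -
      have "cball x d \<subseteq> A" using d0 d by auto
      moreover have "y \<in> cball x (d / 2)" using y d by simp
      ultimately have "W k y \<le> W k x + B1 * d powr \<alpha>" using B1(2) A(1) W(1) WC d by blast
      moreover have "cball y (d / 2) \<subseteq> A"
      proof
        fix v assume "v \<in> cball y (d / 2)"
        then have "dist x v \<le> d0" using y d dist_triangle[of x v y] by simp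
        then show "v \<in> A" using d0 by auto
      qed
      moreover have "x \<in> cball y (d / 2 / 2)" using y by (simp add: dist_commute)
      ultimately have "W k x \<le> W k y + B1 * (d / 2) powr \<alpha>" using B1(2) A(1) W(1) WC[of k] d by simp
      moreover have "B1 * (d / 2) powr \<alpha> \<le> B1 * d powr \<alpha>" using d \<alpha> B1 by (intro mult_left_mono powr_mono2) auto
      ultimately show ?thesis using de \<open>W k y \<le> W k x + B1 * d powr \<alpha>\<close> by linarith
    qed
    moreover have "ball x (d / 4) \<subseteq> A" using d0 d by (auto simp: subset_iff)
    ultimately show ?thesis using d by (intro exI[of _ "d / 4"]) auto
  qed
  have "\<forall>x\<in>A. \<exists>l. (\<forall>e>0. \<forall>\<^sub>F k in sequentially. W k x \<le> l + e) \<and> (\<forall>e>0. \<forall>k0. \<exists>k\<ge>k0. W k x \<ge> l - e)"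
    using bounded_seq_limsup[of "\<lambda>k. W k x" B for x] Wb by blast
  then obtain w where up: "\<And>x e. x \<in> A \<Longrightarrow> e > 0 \<Longrightarrow> \<forall>\<^sub>F k in sequentially. W k x \<le> w x + e"
    and low: "\<And>x e k0. x \<in> A \<Longrightarrow> e > 0 \<Longrightarrow> \<exists>k\<ge>k0. W k x \<ge> w x - e"
    by metis
  have weq: "w x \<le> w y + e" if x: "x \<in> A" and y: "y \<in> A" and e: "e > 0"
    and close: "\<And>k. \<bar>W k y - W k x\<bar> \<le> e" for x y e
  proof (rule field_le_epsilon)
    fix e' :: real assume e': "e' > 0"
    then have h: "e' / 2 > 0" by simp
    obtain k0 where k0: "\<And>k. k \<ge> k0 \<Longrightarrow> W k y \<le> w y + e' / 2" using up[OF y h] unfolding eventually_sequentially by blast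
    obtain k where k: "k \<ge> k0" "W k x \<ge> w x - e' / 2" using low[OF x h] by blast
    show "w x \<le> w y + e + e'" using k0[OF k(1)] k(2) close[of k] by linarith
  qed
  have cw: "continuous_on A w"
    unfolding continuous_on_iff
  proof (intro ballI allI impI)
    fix x and e :: real assume x: "x \<in> A" and e: "e > 0"
    have "e / 2 > 0" using e by simp
    from equi[OF x this] obtain d where d: "d > 0" "ball x d \<subseteq> A" "\<And>y k. y \<in> ball x d \<Longrightarrow> \<bar>W k y - W k x\<bar> \<le> e / 2" by blast
    have "dist (w y) (w x) < e" if y: "y \<in> A" "dist y x < d" for y
    proof -
      have yb: "y \<in> ball x d" using y by (simp add: dist_commute)
      have "w x \<le> w y + e / 2" using d(3)[OF yb] x y e by (intro weq) auto
      moreover have "w y \<le> w x + e / 2" using d(3)[OF yb] x y e by (intro weq) (auto simp: abs_minus_commute)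
      ultimately show ?thesis using e by (simp add: dist_real_def abs_le_iff)
    qed
    then show "\<exists>d>0. \<forall>x'\<in>A. dist x' x < d \<longrightarrow> dist (w x') (w x) < e" using d(1) by blast
  qed
  have "visc_le \<epsilon> p (\<lambda>x. f x + c0) A w"
  proof (rule upper_limit_subsolution[OF A(1) f(1) eps _ W clim low])
    fix K e assume K: "compact K" "K \<subseteq> A" and e: "(e::real) > 0"
    have e3: "e / 3 > 0" using e by simp
    have "\<forall>x\<in>K. \<exists>d>0. ball x d \<subseteq> A \<and> (\<forall>y\<in>ball x d. \<forall>k. \<bar>W k y - W k x\<bar> \<le> e / 3)"
      using equi[OF _ e3] K(2) by blast
    then obtain d where d: "\<And>x. x \<in> K \<Longrightarrow> d x > 0" "\<And>x. x \<in> K \<Longrightarrow> ball x (d x) \<subseteq> A"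
      "\<And>x y k. x \<in> K \<Longrightarrow> y \<in> ball x (d x) \<Longrightarrow> \<bar>W k y - W k x\<bar> \<le> e / 3" by metis
    obtain D where D: "D \<subseteq> K" "finite D" "K \<subseteq> (\<Union>x\<in>D. ball x (d x))"
      using compactE_image[OF K(1), of K "\<lambda>x. ball x (d x)"] d(1) by (metis (no_types, lifting) UN_I centre_in_ball open_ball subsetI)
    have "\<forall>\<^sub>F k in sequentially. \<forall>x\<in>D. W k x \<le> w x + e / 3"
      using D K(2) up e3 by (intro eventually_ball_finite) auto
    then show "\<forall>\<^sub>F k in sequentially. \<forall>y\<in>K. W k y \<le> w y + e"
    proof eventually_elim
      case (elim k)
      show ?case
      proof
        fix y assume y: "y \<in> K"
        then obtain x where x: "x \<in> D" "y \<in> ball x (d x)" using D(3) by blast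
        have xK: "x \<in> K" using x D(1) by blast
        have "W k y \<le> W k x + e / 3" using d(3)[OF xK x(2), of k] by linarith
        moreover have "W k x \<le> w x + e / 3" using elim x(1) by blast
        moreover have "w x \<le> w y + e / 3" using d(3)[OF xK x(2)] xK y K(2) e3 by (intro weq) auto
        ultimately show "W k y \<le> w y + e" by linarith
      qed
    qed
  qed (use p in auto)
  then have mem: "c0 \<in> S" using cw by (auto simp: S_def)
  have "additive_eigenvalue \<epsilon> (hamiltonian p f) A = (LEAST c. c \<in> S)"
    unfolding additive_eigenvalue_def viscosity_subsolution_iff_visc_le by (simp add: S_def)
  also have "\<dots> = c0"
    using mem cInf_lower[OF _ bdd] by (intro Least_equality) (auto simp: c0_def)
  finally show ?thesis using mem by (simp add: S_def)
qed

section \<open>Discounted solutions on dilated domains\<close>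

lemma coned_mono: "coned \<kappa> A \<Longrightarrow> \<kappa>' \<le> \<kappa> \<Longrightarrow> coned \<kappa>' A"
  unfolding coned_def by (meson mult_right_mono less_imp_le subset_ball subset_trans)

lemma difference_quotient_sequence:
  fixes g :: "real \<Rightarrow> real"
  assumes "(g has_real_derivative D) (at 0)" and "l \<longlonglongrightarrow> 0" and "\<And>k. l k \<noteq> 0"
  shows "(\<lambda>k. (g (l k) - g 0) / l k) \<longlonglongrightarrow> D"
proof -
  have "((\<lambda>h. (g h - g 0) / h) \<longlongrightarrow> D) (at 0)" using assms(1) by (simp add: DERIV_def)
  moreover have "filterlim l (at 0) sequentially"
    using assms by (auto simp: filterlim_at)
  ultimately show ?thesis by (rule filterlim_compose)
qed

text \<open>The mean value theorem on the segment from \<open>x k\<close> to \<open>s k x k\<close>, applied along sequences in order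
to allow a moving base point.\<close>

lemma radial_difference_quotient:
  fixes f :: "'a::euclidean_space \<Rightarrow> real" and x :: "nat \<Rightarrow> 'a"
  assumes U: "open U" and z: "z \<in> U"
    and f: "\<And>y. y \<in> U \<Longrightarrow> (f has_derivative (\<lambda>h. G y \<bullet> h)) (at y)" and G: "continuous_on U G"
    and x: "x \<longlonglongrightarrow> z" and s: "s \<longlonglongrightarrow> 1" and l: "\<And>k. l k \<noteq> 0" and \<sigma>: "(\<lambda>k. (s k - 1) / l k) \<longlonglongrightarrow> \<sigma>"
  shows "(\<lambda>k. (f (s k *\<^sub>R x k) - f (x k)) / l k) \<longlonglongrightarrow> \<sigma> * (z \<bullet> G z)"
proof -
  obtain e where e: "e > 0" "ball z e \<subseteq> U" using U z open_contains_ball by blast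
  have sx: "(\<lambda>k. s k *\<^sub>R x k) \<longlonglongrightarrow> z" using tendsto_scaleR[OF s x] by simp
  have ev: "\<forall>\<^sub>F k in sequentially. x k \<in> ball z e \<and> s k *\<^sub>R x k \<in> ball z e"
    using tendstoD[OF x e(1)] tendstoD[OF sx e(1)] by eventually_elim (simp add: dist_commute)
  have ex: "\<exists>y. y \<in> closed_segment (x k) (s k *\<^sub>R x k) \<and>
      (x k \<in> ball z e \<and> s k *\<^sub>R x k \<in> ball z e \<longrightarrow> f (s k *\<^sub>R x k) - f (x k) = G y \<bullet> ((s k - 1) *\<^sub>R x k))" for k
  proof (cases "x k \<in> ball z e \<and> s k *\<^sub>R x k \<in> ball z e")
    case True
    define v where "v = s k *\<^sub>R x k - x k"
    have seg: "x k + \<tau> *\<^sub>R v \<in> closed_segment (x k) (s k *\<^sub>R x k)" if "0 \<le> \<tau>" "\<tau> \<le> 1" for \<tau>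
      using that unfolding closed_segment_def v_def by (auto intro!: exI[of _ \<tau>] simp: algebra_simps)
    have "closed_segment (x k) (s k *\<^sub>R x k) \<subseteq> ball z e"
      using True by (intro closed_segment_subset) auto
    then have inU: "x k + \<tau> *\<^sub>R v \<in> U" if "0 \<le> \<tau>" "\<tau> \<le> 1" for \<tau> using seg[OF that] e(2) by blast
    have lin: "((\<lambda>\<tau>. x k + \<tau> *\<^sub>R v) has_derivative (\<lambda>h. h *\<^sub>R v)) (at \<tau>)" for \<tau>
      by (auto intro!: derivative_eq_intros)
    have D: "((\<lambda>\<tau>. f (x k + \<tau> *\<^sub>R v)) has_real_derivative G (x k + \<tau> *\<^sub>R v) \<bullet> v) (at \<tau>)" if "0 \<le> \<tau>" "\<tau> \<le> 1" for \<tau>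
      by (rule has_derivative_imp_has_field_derivative[OF has_derivative_compose[OF lin f[OF inU[OF that]]]]) simp
    obtain \<tau> where \<tau>: "0 < \<tau>" "\<tau> < 1" "f (x k + 1 *\<^sub>R v) - f (x k + 0 *\<^sub>R v) = (1 - 0) * (G (x k + \<tau> *\<^sub>R v) \<bullet> v)"
      using MVT2[of 0 1 "\<lambda>\<tau>. f (x k + \<tau> *\<^sub>R v)" "\<lambda>\<tau>. G (x k + \<tau> *\<^sub>R v) \<bullet> v"] D by auto
    have "f (s k *\<^sub>R x k) - f (x k) = G (x k + \<tau> *\<^sub>R v) \<bullet> ((s k - 1) *\<^sub>R x k)"
      using \<tau>(3) by (simp add: v_def scaleR_diff_left)
    then show ?thesis using seg[of \<tau>] \<tau> by (intro exI[of _ "x k + \<tau> *\<^sub>R v"]) auto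
  qed auto
  have "\<forall>k. \<exists>y. y \<in> closed_segment (x k) (s k *\<^sub>R x k) \<and>
      (x k \<in> ball z e \<and> s k *\<^sub>R x k \<in> ball z e \<longrightarrow> f (s k *\<^sub>R x k) - f (x k) = G y \<bullet> ((s k - 1) *\<^sub>R x k))"
    using ex by blast
  from choice[OF this] obtain y where
    y: "\<And>k. y k \<in> closed_segment (x k) (s k *\<^sub>R x k)"
    "\<And>k. x k \<in> ball z e \<and> s k *\<^sub>R x k \<in> ball z e \<Longrightarrow> f (s k *\<^sub>R x k) - f (x k) = G (y k) \<bullet> ((s k - 1) *\<^sub>R x k)"
    by blast
  have le: "norm (y k - x k) \<le> dist (s k *\<^sub>R x k) (x k)" for k
    using segment_bound(1)[OF y(1)[of k]] by (simp add: dist_norm norm_minus_commute)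
  have "(\<lambda>k. dist (s k *\<^sub>R x k) (x k)) \<longlonglongrightarrow> 0" using tendsto_dist[OF sx x] by simp
  then have "(\<lambda>k. y k - x k) \<longlonglongrightarrow> 0"
    by (rule Lim_null_comparison[OF always_eventually[OF allI[OF le]]])
  from tendsto_add[OF this x] have yz: "y \<longlonglongrightarrow> z" by simp
  then have "\<forall>\<^sub>F k in sequentially. y k \<in> U" using U z topological_tendstoD by blast
  then have Gy: "(\<lambda>k. G (y k)) \<longlonglongrightarrow> G z" by (rule continuous_on_tendsto_compose[OF G yz z])
  have "(\<lambda>k. (s k - 1) / l k * (x k \<bullet> G (y k))) \<longlonglongrightarrow> \<sigma> * (z \<bullet> G z)"
    by (intro tendsto_intros \<sigma> x Gy)
  moreover have "\<forall>\<^sub>F k in sequentially. (s k - 1) / l k * (x k \<bullet> G (y k)) = (f (s k *\<^sub>R x k) - f (x k)) / l k"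
    using ev by eventually_elim (simp add: y(2) inner_commute)
  ultimately show ?thesis by (rule Lim_transform_eventually)
qed

locale changing_domains =
  fixes \<epsilon> p \<kappa> c' :: real
    and U \<Omega> :: "(real ^ 'n) set"
    and f :: "real ^ 'n \<Rightarrow> real"
    and u_disc :: "real \<Rightarrow> real \<Rightarrow> real ^ 'n \<Rightarrow> real"
    and u :: "real \<Rightarrow> real ^ 'n \<Rightarrow> real"
  assumes eps: "\<epsilon> > 0" and p: "p > 2"
    and opU: "open U" and bdU: "bounded U" and f_C1: "C1_closure U f"
    and op\<Omega>: "open \<Omega>" and bd\<Omega>: "bounded \<Omega>" and \<Omega>U: "closure \<Omega> \<subseteq> U"
    and \<kappa>: "\<kappa> > 0" and \<kappa>\<Omega>: "cball 0 \<kappa> \<subseteq> \<Omega>"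
    and far: "\<forall>s>0. \<forall>x\<in>dilate (1 + s) (frontier \<Omega>). infdist x (closure \<Omega>) \<ge> \<kappa> * s"
    and u_disc: "\<forall>\<gamma>. \<forall>\<^sub>F l in at_right 0.
      state_constraint_solution \<epsilon> (hamiltonian p f) l 0 (dilate (1 + \<gamma> * l) \<Omega>) (u_disc \<gamma> l)"
    and u_cont: "\<forall>\<gamma>. continuous_on (closure \<Omega>) (u \<gamma>)"
    and u_limit: "\<forall>\<gamma>. \<forall>e>0. \<forall>\<^sub>F l in at_right 0.
      \<forall>x\<in>closure \<Omega> \<inter> closure (dilate (1 + \<gamma> * l) \<Omega>).
        \<bar>u_disc \<gamma> l x + additive_eigenvalue \<epsilon> (hamiltonian p f) \<Omega> / l - u \<gamma> x\<bar> < e"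
    and c': "((\<lambda>\<theta>. additive_eigenvalue \<epsilon> (hamiltonian p f) (dilate (1 + \<theta>) \<Omega>))
      has_real_derivative c') (at 0)"
begin

definition eig :: "real \<Rightarrow> real" where
  "eig \<theta> = additive_eigenvalue \<epsilon> (hamiltonian p f) (dilate (1 + \<theta>) \<Omega>)"

lemma eig_0: "eig 0 = additive_eigenvalue \<epsilon> (hamiltonian p f) \<Omega>"
  by (simp add: eig_def dilate_1)

lemma cone: "coned \<kappa> \<Omega>"
  by (rule coned_if_frontier_infdist[OF op\<Omega> \<kappa> \<kappa>\<Omega> far])

lemma zero_in: "0 \<in> \<Omega>" using \<kappa> \<kappa>\<Omega> by auto

lemma f_cont: "continuous_on (closure U) f"
  using f_C1 by (simp add: C1_closure_def)

lemma gradient_exists: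
  "\<exists>G. continuous_on U G \<and> (\<forall>x\<in>U. (f has_derivative (\<lambda>h. G x \<bullet> h)) (at x))"
  using f_C1 continuous_on_subset[OF _ closure_subset] unfolding C1_closure_def by blast

definition F where "F = (SUP x\<in>closure U. \<bar>f x\<bar>)"

lemma f_bound:
  assumes "x \<in> closure U"
  shows "\<bar>f x\<bar> \<le> F"
proof -
  have "compact (closure U)" using bdU by (simp add: compact_closure)
  then have "bounded (f ` closure U)" by (intro compact_imp_bounded compact_continuous_image f_cont)
  then have "bdd_above ((\<lambda>x. \<bar>f x\<bar>) ` closure U)" unfolding bounded_iff bdd_above_def by auto
  then show ?thesis unfolding F_def using assms by (intro cSUP_upper)
qed

lemma radius_exists: "\<exists>R>0. \<Omega> \<subseteq> cball 0 R"
  using bd\<Omega> unfolding bounded_pos subset_iff by auto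

text \<open>The bounds on \<open>r\<close> make the cone condition and the diameter of the dilated domain uniform.\<close>

definition good_radius :: "real \<Rightarrow> bool" where
  "good_radius r \<longleftrightarrow> 1 / 2 \<le> r \<and> r \<le> 2 \<and> closure (dilate r \<Omega>) \<subseteq> U"

lemma good_radius_eventually: "\<forall>\<^sub>F r in nhds 1. good_radius r"
proof -
  obtain R where R: "R > 0" "\<Omega> \<subseteq> cball 0 R" using radius_exists by blast
  then have Rc: "closure \<Omega> \<subseteq> cball 0 R" by (simp add: closure_minimal)
  have "compact (closure \<Omega>)" using bd\<Omega> by (simp add: compact_closure)
  then obtain d where d: "d > 0" "(\<Union>x\<in>closure \<Omega>. cball x d) \<subseteq> U"
    using compact_subset_open_imp_cball_epsilon_subset[OF _ opU \<Omega>U] by blast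
  have "good_radius r" if r: "dist r 1 < min (1 / 2) (d / R)" for r
  proof -
    have "closure (dilate r \<Omega>) \<subseteq> U"
    proof
      fix x assume "x \<in> closure (dilate r \<Omega>)"
      then have "x \<in> dilate r (closure \<Omega>)" unfolding closure_dilate .
      then obtain y where y: "y \<in> closure \<Omega>" "x = r *\<^sub>R y" unfolding dilate_def by auto
      have "norm y \<le> R" using y(1) Rc by auto
      have "y - x = (1 - r) *\<^sub>R y" by (simp add: y(2) scaleR_diff_left)
      then have "dist y x = \<bar>1 - r\<bar> * norm y" by (simp add: dist_norm)
      also have "\<dots> \<le> (d / R) * R" using r R \<open>norm y \<le> R\<close> by (intro mult_mono) (auto simp: dist_real_def)
      also have "\<dots> = d" using R by simp
      finally have "x \<in> cball y d" by simp
      then show "x \<in> U" using d(2) y(1) by blast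
    qed
    moreover have "\<bar>r - 1\<bar> < 1 / 2" using r by (simp add: dist_real_def)
    then have "1 / 2 \<le> r" "r \<le> 2" by linarith+
    ultimately show ?thesis by (simp add: good_radius_def)
  qed
  then show ?thesis unfolding eventually_nhds_metric
    using R d by (intro exI[of _ "min (1 / 2) (d / R)"]) auto
qed

lemma at_right_affine:
  fixes \<gamma> :: real
  assumes "\<forall>\<^sub>F r in nhds 1. P r"
  shows "\<forall>\<^sub>F l in at_right 0. P (1 + \<gamma> * l)"
proof -
  have "((\<lambda>l. 1 + \<gamma> * l) \<longlongrightarrow> 1) (at_right 0)" by (auto intro!: tendsto_eq_intros)
  then show ?thesis using assms unfolding filterlim_iff by simp
qed

lemma dilated_domain:
  assumes "good_radius r"
  shows "open (dilate r \<Omega>)" "bounded (dilate r \<Omega>)" "0 \<in> dilate r \<Omega>" "coned (\<kappa> / 2) (dilate r \<Omega>)" "r > 0"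
    "dilate r \<Omega> \<subseteq> U" "closure (dilate r \<Omega>) \<subseteq> closure U"
proof -
  show r: "r > 0" using assms by (simp add: good_radius_def)
  show "open (dilate r \<Omega>)" using open_dilate[OF _ op\<Omega>] r by simp
  show "bounded (dilate r \<Omega>)" by (rule bounded_dilate[OF bd\<Omega>])
  show "0 \<in> dilate r \<Omega>" using zero_in r by (simp add: mem_dilate_iff)
  have "\<kappa> / 2 \<le> \<kappa> * r" using assms \<kappa> by (simp add: good_radius_def)
  then show "coned (\<kappa> / 2) (dilate r \<Omega>)" by (rule coned_mono[OF coned_dilate[OF cone r]])
  show "dilate r \<Omega> \<subseteq> U" "closure (dilate r \<Omega>) \<subseteq> closure U"
    using assms closure_subset unfolding good_radius_def by blast+
qed

text \<open>At a minimum of the solution over the closed domain, constants are admissible test functions,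
also on the boundary.\<close>

lemma discounted_lower_bound:
  assumes r: "good_radius r" and sol: "state_constraint_solution \<epsilon> (hamiltonian p f) l 0 (dilate r \<Omega>) v"
    and l: "l > 0" and x: "x \<in> closure (dilate r \<Omega>)"
  shows "- F \<le> l * v x"
proof -
  define A where "A = dilate r \<Omega>"
  have K: "compact (closure A)" using dilated_domain(2)[OF r] by (simp add: A_def compact_closure)
  have ne: "closure A \<noteq> {}" using x by (auto simp: A_def)
  have v: "continuous_on (closure A) v" using sol by (simp add: state_constraint_solution_def A_def)
  from continuous_attains_inf[OF K ne v]
  obtain z where z: "z \<in> closure A" "\<forall>y\<in>closure A. v z \<le> v y" by blast
  have "C2_jet A (closure A) (\<lambda>_. 0) (\<lambda>_. 0) (\<lambda>_. 0)" by (simp add: C2_jet_def)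
  moreover have "local_min_on (\<lambda>y. v y - 0) (closure A) z"
    unfolding local_min_on_def using z by (auto simp: eventually_at_filter intro: always_eventually)
  moreover have "viscosity_supersolution_closure \<epsilon> (hamiltonian p f) l 0 A v"
    using sol by (simp add: state_constraint_solution_def A_def)
  ultimately have "l * v z + hamiltonian p f z 0 - \<epsilon> * trace (0 :: real ^ 'n ^ 'n) \<ge> 0"
    using z(1) unfolding viscosity_supersolution_closure_def by blast
  then have "f z \<le> l * v z" by (simp add: hamiltonian_def trace_def)
  moreover have "\<bar>f z\<bar> \<le> F" using z(1) dilated_domain(7)[OF r] by (intro f_bound) (auto simp: A_def)
  moreover have "l * v z \<le> l * v x" using z(2) x l by (intro mult_left_mono) (auto simp: A_def)
  ultimately show ?thesis by linarith
qed

lemma discounted_solution: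
  assumes r: "good_radius r" and sol: "state_constraint_solution \<epsilon> (hamiltonian p f) l 0 (dilate r \<Omega>) v" and l: "l > 0"
  shows "continuous_on (closure (dilate r \<Omega>)) v" "continuous_on (dilate r \<Omega>) v"
    "visc_le \<epsilon> p (\<lambda>x. f x - l * v x) (dilate r \<Omega>) v"
    "visc_le \<epsilon> p (\<lambda>x. f x + F) (dilate r \<Omega>) v" "visc_le \<epsilon> p (\<lambda>x. 2 * F) (dilate r \<Omega>) v"
    "viscosity_supersolution_closure \<epsilon> (hamiltonian p f) l 0 (dilate r \<Omega>) v"
proof -
  show v: "continuous_on (closure (dilate r \<Omega>)) v" using sol by (simp add: state_constraint_solution_def)
  then show "continuous_on (dilate r \<Omega>) v" by (rule continuous_on_subset[OF _ closure_subset])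
  show sub: "visc_le \<epsilon> p (\<lambda>x. f x - l * v x) (dilate r \<Omega>) v"
    using sol by (simp add: state_constraint_solution_def viscosity_subsolution_iff_visc_le)
  show sub2: "visc_le \<epsilon> p (\<lambda>x. f x + F) (dilate r \<Omega>) v"
  proof (rule visc_le_mono[OF sub])
    fix x assume "x \<in> dilate r \<Omega>"
    then show "f x - l * v x \<le> f x + F"
      using discounted_lower_bound[OF r sol l, of x] closure_subset by fastforce
  qed
  show "visc_le \<epsilon> p (\<lambda>x. 2 * F) (dilate r \<Omega>) v"
  proof (rule visc_le_mono[OF sub2])
    fix x assume "x \<in> dilate r \<Omega>"
    then have "x \<in> closure U" using dilated_domain(7)[OF r] closure_subset by blast
    then show "f x + F \<le> 2 * F" using f_bound[of x] by linarith
  qed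
  show "viscosity_supersolution_closure \<epsilon> (hamiltonian p f) l 0 (dilate r \<Omega>) v"
    using sol by (simp add: state_constraint_solution_def)
qed

lemma F_nonneg: "F \<ge> 0"
proof -
  have "0 \<in> closure U" using zero_in \<Omega>U closure_subset[of \<Omega>] closure_subset[of U] by blast
  from f_bound[OF this] show ?thesis by linarith
qed

text \<open>The limit of the discounted solutions is given only on \<open>\<Omega>\<close>, whereas the comparison may touch in
the thin layer between \<open>\<Omega>\<close> and the dilated domain.  The points are moved by the factor \<open>1 - t k\<close>
into \<open>\<Omega>\<close>, and \<open>boundary_modulus_closure\<close> controls the change uniformly in \<open>k\<close>.\<close>

lemma discounted_limit_up_to_boundary:
  assumes l: "l \<longlonglongrightarrow> 0" "\<And>k. l k > 0" and x: "\<And>k. x k \<in> closure (dilate (1 + \<gamma> * l k) \<Omega>)" "x \<longlonglongrightarrow> z"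
  shows "z \<in> closure \<Omega>" "(\<lambda>k. u_disc \<gamma> (l k) (x k) + eig 0 / l k) \<longlonglongrightarrow> u \<gamma> z"
proof -
  have "l k \<noteq> 0" for k using l(2)[of k] by simp
  then have lr: "filterlim l (at_right 0) sequentially"
    using l by (auto simp: filterlim_at intro: always_eventually)
  \<comment> \<open>This contraction outweighs the dilation by 1 + \<gamma> l, whatever the sign of \<gamma>.\<close>
  define t where "t = (\<lambda>k. (\<bar>\<gamma>\<bar> + 1) * l k)"
  have "t \<longlonglongrightarrow> (\<bar>\<gamma>\<bar> + 1) * 0" unfolding t_def by (intro tendsto_intros l)
  then have t0: "t \<longlonglongrightarrow> 0" by simp
  have tpos: "t k > 0" for k unfolding t_def using l(2)[of k] by (simp add: add_nonneg_pos)
  have t1: "\<forall>\<^sub>F k in sequentially. t k \<le> 1"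
    using order_tendstoD(2)[OF t0, of 1] by (auto elim: eventually_mono)
  define y where "y = (\<lambda>k. (1 - t k) *\<^sub>R x k)"
  have "y \<longlonglongrightarrow> (1 - 0) *\<^sub>R z" unfolding y_def by (intro tendsto_intros t0 x)
  then have yz: "y \<longlonglongrightarrow> z" by simp
  have gr: "\<forall>\<^sub>F k in sequentially. good_radius (1 + \<gamma> * l k)"
    using at_right_affine[OF good_radius_eventually] lr unfolding filterlim_iff by blast
  have sol: "\<forall>\<^sub>F k in sequentially. state_constraint_solution \<epsilon> (hamiltonian p f) (l k) 0 (dilate (1 + \<gamma> * l k) \<Omega>) (u_disc \<gamma> (l k))"
    using u_disc lr unfolding filterlim_iff by blast
  have y_mem: "\<forall>\<^sub>F k in sequentially. y k \<in> \<Omega> \<and> y k \<in> dilate (1 + \<gamma> * l k) \<Omega>"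
    using gr t1
  proof eventually_elim
    case (elim k)
    define r where "r = 1 + \<gamma> * l k"
    have r: "r > 0" using dilated_domain(5)[OF elim(1)] by (simp add: r_def)
    have "x k \<in> dilate r (closure \<Omega>)" using x(1)[of k] unfolding closure_dilate r_def .
    then obtain w where w: "w \<in> closure \<Omega>" "x k = r *\<^sub>R w" unfolding dilate_def by auto
    have "\<gamma> * l k \<le> \<bar>\<gamma>\<bar> * l k" using l(2)[of k] by (intro mult_right_mono) auto
    then have "r \<le> 1 + t k" unfolding r_def t_def distrib_right using l(2)[of k] by linarith
    then have "(1 - t k) * r \<le> (1 - t k) * (1 + t k)" using elim(2) by (intro mult_left_mono) auto
    also have "\<dots> < 1" using tpos[of k] by (simp add: algebra_simps)
    finally have s: "(1 - t k) * r < 1" .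
    have "0 \<le> (1 - t k) * r" using r elim(2) by simp
    then have "(1 - (1 - (1 - t k) * r)) *\<^sub>R w \<in> \<Omega>"
      using s by (intro coned_shrink_mem[OF cone \<kappa> w(1)]) auto
    then have "y k \<in> \<Omega>" by (simp add: y_def w(2))
    moreover have "y k \<in> dilate r \<Omega>"
      unfolding y_def r_def using tpos elim \<kappa>
      by (intro coned_shrink_mem[OF dilated_domain(4)[OF elim(1)] _ x(1)]) auto
    ultimately show ?case by (simp add: r_def)
  qed
  show z: "z \<in> closure \<Omega>"
  proof (rule Lim_in_closed_set[OF closed_closure _ _ yz])
    show "\<forall>\<^sub>F k in sequentially. y k \<in> closure \<Omega>" using y_mem closure_subset by (fastforce elim: eventually_mono)
  qed simp
  have 1: "(\<lambda>k. u \<gamma> (y k)) \<longlonglongrightarrow> u \<gamma> z"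
    using y_mem closure_subset by (intro continuous_on_tendsto_compose[OF u_cont[rule_format] yz z]) (fastforce elim: eventually_mono)
  have 2: "(\<lambda>k. u_disc \<gamma> (l k) (y k) + eig 0 / l k - u \<gamma> (y k)) \<longlonglongrightarrow> 0"
  proof (rule tendstoI)
    fix e :: real assume "e > 0"
    then have "\<forall>\<^sub>F k in sequentially. \<forall>x\<in>closure \<Omega> \<inter> closure (dilate (1 + \<gamma> * l k) \<Omega>). \<bar>u_disc \<gamma> (l k) x + eig 0 / l k - u \<gamma> x\<bar> < e"
      using u_limit lr unfolding eig_0 filterlim_iff by blast
    then show "\<forall>\<^sub>F k in sequentially. dist (u_disc \<gamma> (l k) (y k) + eig 0 / l k - u \<gamma> (y k)) 0 < e"
      using y_mem
    proof eventually_elim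
      case (elim k)
      then have "y k \<in> closure \<Omega> \<inter> closure (dilate (1 + \<gamma> * l k) \<Omega>)" using closure_subset by blast
      then show ?case using elim(1) by simp
    qed
  qed
  obtain R where R: "R > 0" "\<Omega> \<subseteq> cball 0 R" using radius_exists by blast
  define \<alpha> where "\<alpha> = (p - 2) / (p - 1)"
  have \<alpha>: "\<alpha> > 0" using p by (simp add: \<alpha>_def)
  have "\<kappa> / 2 > 0" "2 * R > 0" "2 * F \<ge> 0" using \<kappa> R F_nonneg by auto
  from boundary_modulus_closure[OF eps p this(3,1,2)]
  obtain B where B: "B \<ge> 0" "\<forall>(w :: real ^ 'n \<Rightarrow> real) A. open A \<longrightarrow> coned (\<kappa> / 2) A \<longrightarrow> A \<subseteq> cball 0 (2 * R) \<longrightarrow> continuous_on (closure A) w \<longrightarrow>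
    visc_le \<epsilon> p (\<lambda>_. 2 * F) A w \<longrightarrow>
    (\<forall>y\<in>closure A. \<forall>t. 0 < t \<longrightarrow> t \<le> 1 \<longrightarrow> \<bar>w y - w ((1 - t) *\<^sub>R y)\<bar> \<le> B * t powr \<alpha>)"
    unfolding \<alpha>_def by blast
  have 3: "(\<lambda>k. u_disc \<gamma> (l k) (x k) - u_disc \<gamma> (l k) (y k)) \<longlonglongrightarrow> 0"
  proof (rule Lim_null_comparison)
    show "\<forall>\<^sub>F k in sequentially. norm (u_disc \<gamma> (l k) (x k) - u_disc \<gamma> (l k) (y k)) \<le> B * t k powr \<alpha>"
      using gr sol t1
    proof eventually_elim
      case (elim k)
      define A where "A = dilate (1 + \<gamma> * l k) \<Omega>"
      have "A \<subseteq> cball 0 (2 * R)"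
      proof
        fix v assume "v \<in> A"
        then obtain w where w: "w \<in> \<Omega>" "v = (1 + \<gamma> * l k) *\<^sub>R w" by (auto simp: A_def dilate_def)
        have "norm w \<le> R" using w(1) R(2) by auto
        moreover have "\<bar>1 + \<gamma> * l k\<bar> \<le> 2" using elim(1) by (simp add: good_radius_def)
        ultimately show "v \<in> cball 0 (2 * R)" using w(2) mult_mono[of "\<bar>1 + \<gamma> * l k\<bar>" 2 "norm w" R] by simp
      qed
      moreover note dd = dilated_domain[OF elim(1), folded A_def] and ds = discounted_solution[OF elim(1,2) l(2), folded A_def]
      moreover have "x k \<in> closure A" using x(1) by (simp add: A_def)
      ultimately have "\<bar>u_disc \<gamma> (l k) (x k) - u_disc \<gamma> (l k) ((1 - t k) *\<^sub>R x k)\<bar> \<le> B * t k powr \<alpha>"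
        using B(2) dd(1,4) ds(1,5) tpos[of k] elim(3) by blast
      then show ?case by (simp add: y_def)
    qed
    have "((\<lambda>k. t k powr \<alpha>) \<longlongrightarrow> 0)  sequentially"
      using tendsto_powr'[OF t0 tendsto_const, of \<alpha>] \<alpha> tpos by (simp add: less_imp_le)
    then have "(\<lambda>k. B * t k powr \<alpha>) \<longlonglongrightarrow> B * 0" by (intro tendsto_intros)
    then show "(\<lambda>k. B * t k powr \<alpha>) \<longlonglongrightarrow> 0" by simp
  qed
  have "(\<lambda>k. u \<gamma> (y k) + (u_disc \<gamma> (l k) (y k) + eig 0 / l k - u \<gamma> (y k)) + (u_disc \<gamma> (l k) (x k) - u_disc \<gamma> (l k) (y k))) \<longlonglongrightarrow> u \<gamma> z + 0 + 0"
    by (intro tendsto_add 1 2 3)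
  then show "(\<lambda>k. u_disc \<gamma> (l k) (x k) + eig 0 / l k) \<longlonglongrightarrow> u \<gamma> z" by (simp add: algebra_simps)
qed

text \<open>The discounted solution on a larger domain provides a subsolution of the ergodic inequality, and
the one on a smaller domain bounds all admissible constants from below.\<close>

lemma eigenfunction_exists:
  "\<forall>\<^sub>F \<theta> in nhds 0. \<exists>w. continuous_on (dilate (1 + \<theta>) \<Omega>) w \<and> visc_le \<epsilon> p (\<lambda>x. f x + eig \<theta>) (dilate (1 + \<theta>) \<Omega>) w"
proof -
  have "\<exists>l>0. l < 1 \<and> good_radius (1 + \<gamma> * l) \<and>
      state_constraint_solution \<epsilon> (hamiltonian p f) l 0 (dilate (1 + \<gamma> * l) \<Omega>) (u_disc \<gamma> l)" for \<gamma>
  proof -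
    have "\<forall>\<^sub>F l in at_right 0. l < (1::real)" by (rule order_tendstoD(2)[OF tendsto_ident_at]) simp
    then have "\<forall>\<^sub>F l in at_right 0. l > 0 \<and> l < 1 \<and> good_radius (1 + \<gamma> * l) \<and>
      state_constraint_solution \<epsilon> (hamiltonian p f) l 0 (dilate (1 + \<gamma> * l) \<Omega>) (u_disc \<gamma> l)"
      using u_disc[rule_format, of \<gamma>] at_right_affine[OF good_radius_eventually, of \<gamma>] eventually_at_right_less[of "0::real"]
      by eventually_elim auto
    then show ?thesis using eventually_happens'[OF trivial_limit_at_right_real] by blast
  qed
  then obtain l1 l2 where l1: "l1 > 0" "good_radius (1 + 1 * l1)"
      "state_constraint_solution \<epsilon> (hamiltonian p f) l1 0 (dilate (1 + 1 * l1) \<Omega>) (u_disc 1 l1)"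
    and l2: "l2 > 0" "l2 < 1" "good_radius (1 + (-1) * l2)"
      "state_constraint_solution \<epsilon> (hamiltonian p f) l2 0 (dilate (1 + (-1) * l2) \<Omega>) (u_disc (-1) l2)" by metis
  note s1 = discounted_solution[OF l1(2,3,1)]
  note s2 = discounted_solution[OF l2(3,4,1)]
  define A2 where "A2 = dilate (1 + (-1) * l2) \<Omega>"
  have "compact (closure A2)" using dilated_domain(2)[OF l2(3)] by (simp add: compact_closure A2_def)
  then have "bounded (u_disc (-1) l2 ` closure A2)"
    using s2(1) by (intro compact_imp_bounded compact_continuous_image) (simp_all add: A2_def)
  then obtain V where V: "\<And>x. x \<in> closure A2 \<Longrightarrow> \<bar>u_disc (-1) l2 x\<bar> \<le> V" unfolding bounded_iff by auto
  have "((\<lambda>\<theta>::real. 1 + \<theta>) \<longlongrightarrow> 1 + 0) (nhds 0)" by (intro tendsto_intros filterlim_ident)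
  then have "filterlim (\<lambda>\<theta>::real. 1 + \<theta>) (nhds 1) (nhds 0)" by simp
  then have ev: "\<forall>\<^sub>F \<theta> in nhds 0. good_radius (1 + \<theta>)"
    using good_radius_eventually unfolding filterlim_iff by blast
  have "\<forall>\<^sub>F \<theta> in nhds 0. \<theta> \<in> {- l2<..<l1}"
    using l1 l2 by (intro eventually_nhds_in_open) auto
  with ev show ?thesis
  proof eventually_elim
    case (elim \<theta>)
    define A where "A = dilate (1 + \<theta>) \<Omega>"
    note A = dilated_domain[OF elim(1), folded A_def]
    have fA: "continuous_on A f" by (rule continuous_on_subset[OF f_cont]) (use A(7) closure_subset in blast)
    have fb: "bounded (f ` A)" using f_bound A(7) closure_subset unfolding bounded_iff by (intro exI[of _ F]) force
    have "\<exists>w. continuous_on A w \<and> visc_le \<epsilon> p (\<lambda>x. f x + additive_eigenvalue \<epsilon> (hamiltonian p f) A) A w"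
    proof (rule additive_eigenvalue_attained[OF eps p A(1,4,2) _ fA fb])
      have "closure (dilate (1 + \<theta>) \<Omega>) \<subseteq> dilate (1 + 1 * l1) \<Omega>"
        using A(5) elim(2) by (intro closure_dilate_subset[OF cone \<kappa>]) auto
      then have "A \<subseteq> dilate (1 + 1 * l1) \<Omega>" using closure_subset unfolding A_def by blast
      then have "continuous_on A (u_disc 1 l1)" "visc_le \<epsilon> p (\<lambda>x. f x + F) A (u_disc 1 l1)"
        using continuous_on_subset[OF s1(2)] visc_le_subset[OF s1(4) dilated_domain(1)[OF l1(2)] A(1)] eps by auto
      then show "\<exists>c w. continuous_on A w \<and> visc_le \<epsilon> p (\<lambda>x. f x + c) A w" by blast
      have sub: "closure A2 \<subseteq> A"
        unfolding A_def A2_def using l2 elim(2) by (intro closure_dilate_subset[OF cone \<kappa>]) auto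
      fix c w assume w: "continuous_on A w" "visc_le \<epsilon> p (\<lambda>x. f x + c) A w"
      have cf: "continuous_on A (\<lambda>x. f x + c)" by (intro continuous_intros fA)
      have "\<exists>x\<in>closure A2. f x - l2 * u_disc (-1) l2 x \<le> 1 / 2 * (f x + c + (f x + c)) + 1"
        using s2(1,6) dilated_domain(2,3)[OF l2(3)] p
        by (intro supersolution_test[OF _ _ _ _ w(2) A(1) w(1) cf sub w(2) A(1) w(1) cf sub eps]) (auto simp: A2_def)
      then obtain x where x: "x \<in> closure A2" "f x - l2 * u_disc (-1) l2 x \<le> 1 / 2 * (f x + c + (f x + c)) + 1"
        by blast
      have "l2 * u_disc (-1) l2 x \<le> l2 * V" using V[OF x(1)] l2 by (intro mult_left_mono) auto
      then show "- l2 * V - 1 \<le> c" using x(2) by (simp add: field_simps)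
    qed (use \<kappa> A in auto)
    then show ?case by (simp add: A_def eig_def)
  qed
qed

end

section \<open>The superadditivity inequality\<close>

lemma dilate_subsolution:
  fixes w :: "real ^ 'n \<Rightarrow> real"
  assumes sub: "visc_le \<epsilon> p h (dilate r \<Omega>) w" and w: "continuous_on (dilate r \<Omega>) w" and h: "continuous_on (dilate r \<Omega>) h"
    and op: "open \<Omega>" and r: "r > 0" "s > 0" and eps: "\<epsilon> > 0" and p: "p > 2"
  defines "\<rho> \<equiv> s / r" and "\<alpha> \<equiv> (p - 2) / (p - 1)"
  shows "visc_le \<epsilon> p (\<lambda>x. \<rho> powr (\<alpha> - 2) * h ((1 / \<rho>) *\<^sub>R x)) (dilate s \<Omega>) (\<lambda>x. \<rho> powr \<alpha> * w ((1 / \<rho>) *\<^sub>R x))"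
    and "continuous_on (dilate s \<Omega>) (\<lambda>x. \<rho> powr \<alpha> * w ((1 / \<rho>) *\<^sub>R x))"
    and "continuous_on (dilate s \<Omega>) (\<lambda>x. \<rho> powr (\<alpha> - 2) * h ((1 / \<rho>) *\<^sub>R x))"
    and "x \<in> dilate s \<Omega> \<Longrightarrow> (1 / \<rho>) *\<^sub>R x \<in> dilate r \<Omega>"
proof -
  have \<rho>: "\<rho> > 0" using r by (simp add: \<rho>_def)
  have mem: "x \<in> dilate s \<Omega> \<longleftrightarrow> (1 / \<rho>) *\<^sub>R x \<in> dilate r \<Omega>" for x
    using r by (simp add: mem_dilate_iff \<rho>_def)
  then show "x \<in> dilate s \<Omega> \<Longrightarrow> (1 / \<rho>) *\<^sub>R x \<in> dilate r \<Omega>" by simp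
  have "open (dilate r \<Omega>)" using open_dilate[OF _ op] r by simp
  from visc_le_scale[OF sub this \<rho> _ p, of "dilate s \<Omega>" 0]
  show "visc_le \<epsilon> p (\<lambda>x. \<rho> powr (\<alpha> - 2) * h ((1 / \<rho>) *\<^sub>R x)) (dilate s \<Omega>) (\<lambda>x. \<rho> powr \<alpha> * w ((1 / \<rho>) *\<^sub>R x))"
    using eps mem unfolding \<alpha>_def by simp
  have c: "continuous_on (dilate s \<Omega>) (\<lambda>x. (1 / \<rho>) *\<^sub>R x)" by (intro continuous_intros)
  have sub: "(\<lambda>x. (1 / \<rho>) *\<^sub>R x) ` dilate s \<Omega> \<subseteq> dilate r \<Omega>" using mem by auto
  show "continuous_on (dilate s \<Omega>) (\<lambda>x. \<rho> powr \<alpha> * w ((1 / \<rho>) *\<^sub>R x))"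
    by (intro continuous_on_mult continuous_on_const continuous_on_compose2[OF w c sub])
  show "continuous_on (dilate s \<Omega>) (\<lambda>x. \<rho> powr (\<alpha> - 2) * h ((1 / \<rho>) *\<^sub>R x))"
    by (intro continuous_on_mult continuous_on_const continuous_on_compose2[OF h c sub])
qed

context changing_domains
begin

definition \<alpha> :: real where "\<alpha> = (p - 2) / (p - 1)"

text \<open>The dilation factor from \<open>(1 + 2 a l) \<Omega>\<close> to a domain slightly larger than \<open>(1 + t l) \<Omega>\<close>: the factor
\<open>1 + l^2\<close> leaves room for smoothing and does not contribute to first order.\<close>

definition ratio :: "real \<Rightarrow> real \<Rightarrow> real \<Rightarrow> real" where
  "ratio t a l = (1 + t * l) * (1 + l\<^sup>2) / (1 + a * (2 * l))"

lemma comparison_point: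
  "\<forall>\<^sub>F l in at_right 0. \<exists>x\<in>closure (dilate (1 + (a + b) * l) \<Omega>).
     (1 / ratio (a + b) a l) *\<^sub>R x \<in> closure (dilate (1 + a * (2 * l)) \<Omega>) \<and>
     f x - l * u_disc (a + b) l x \<le> (1/2) *
       (ratio (a + b) a l powr (\<alpha> - 2) * (f ((1 / ratio (a + b) a l) *\<^sub>R x) - 2 * l * u_disc a (2 * l) ((1 / ratio (a + b) a l) *\<^sub>R x)) +
        ratio (a + b) b l powr (\<alpha> - 2) * (f ((1 / ratio (a + b) b l) *\<^sub>R x) + eig (b * (2 * l)))) + l\<^sup>2"
proof -
  define t where "t = a + b"
  have two: "filterlim (\<lambda>l::real. 2 * l) (at_right 0) (at_right 0)"
  proof -
    have "((\<lambda>l::real. 2 * l) \<longlongrightarrow> 0) (at_right 0)" by (auto intro!: tendsto_eq_intros)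
    moreover have "\<forall>\<^sub>F l in at_right 0. (2 * l :: real) \<in> {0<..} \<and> 2 * l \<noteq> 0"
      by (rule eventually_mono[OF eventually_at_right_less[of "0::real"]]) auto
    ultimately show ?thesis unfolding filterlim_at by blast
  qed
  have "((\<lambda>l::real. b * (2 * l)) \<longlongrightarrow> 0) (at_right 0)" by (auto intro!: tendsto_eq_intros)
  then have e4: "\<forall>\<^sub>F l in at_right 0. \<exists>w. continuous_on (dilate (1 + b * (2 * l)) \<Omega>) w \<and>
      visc_le \<epsilon> p (\<lambda>x. f x + eig (b * (2 * l))) (dilate (1 + b * (2 * l)) \<Omega>) w"
    using eigenfunction_exists unfolding filterlim_iff by blast
  have e1: "\<forall>\<^sub>F l in at_right 0. good_radius (1 + t * l)" by (rule at_right_affine[OF good_radius_eventually])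
  have e2: "\<forall>\<^sub>F l in at_right 0. good_radius (1 + \<gamma> * (2 * l))" for \<gamma>
    using at_right_affine[OF good_radius_eventually, of \<gamma>] two unfolding filterlim_iff by blast
  have e3: "\<forall>\<^sub>F l in at_right 0. state_constraint_solution \<epsilon> (hamiltonian p f) (2 * l) 0 (dilate (1 + a * (2 * l)) \<Omega>) (u_disc a (2 * l))"
    using u_disc[rule_format, of a] two unfolding filterlim_iff by blast
  have "\<forall>\<^sub>F l in at_right 0. l > (0::real)" by (rule eventually_at_right_less)
  from this e1 e2[of a] e2[of b] e3 e4 u_disc[rule_format, of t]
  show ?thesis unfolding t_def[symmetric]
  proof eventually_elim
    case (elim l)
    note l = elim(1)
    define s where "s = (1 + t * l) * (1 + l\<^sup>2)"
    have t0: "1 + t * l > 0" by (rule dilated_domain(5)[OF elim(2)])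
    have a0: "1 + a * (2 * l) > 0" by (rule dilated_domain(5)[OF elim(3)])
    have b0: "1 + b * (2 * l) > 0" by (rule dilated_domain(5)[OF elim(4)])
    have "(1 + t * l) * 1 < (1 + t * l) * (1 + l\<^sup>2)" using t0 l by (intro mult_strict_left_mono) auto
    then have s: "1 + t * l < s" by (simp add: s_def)
    then have s0: "s > 0" using t0 by linarith
    have cl: "closure (dilate (1 + t * l) \<Omega>) \<subseteq> dilate s \<Omega>" by (rule closure_dilate_subset[OF cone \<kappa> t0 s])
    have ra: "s / (1 + a * (2 * l)) = ratio t a l" "s / (1 + b * (2 * l)) = ratio t b l" by (simp_all add: ratio_def s_def)
    have fc: "continuous_on (dilate r \<Omega>) f" if "good_radius r" for r
    proof (rule continuous_on_subset[OF f_cont])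
      show "dilate r \<Omega> \<subseteq> closure U" using dilated_domain(7)[OF that] closure_subset[of "dilate r \<Omega>"] by blast
    qed
    have l2: "2 * l > 0" using l by simp
    note v = discounted_solution[OF elim(3,5) l2]
    have ch: "continuous_on (dilate (1 + a * (2 * l)) \<Omega>) (\<lambda>x. f x - 2 * l * u_disc a (2 * l) x)"
      by (intro continuous_intros fc elim v)
    note sub1 = dilate_subsolution[OF v(3,2) ch op\<Omega> a0 s0 eps p, folded \<alpha>_def, unfolded ra]
    obtain w where w: "continuous_on (dilate (1 + b * (2 * l)) \<Omega>) w"
      "visc_le \<epsilon> p (\<lambda>x. f x + eig (b * (2 * l))) (dilate (1 + b * (2 * l)) \<Omega>) w" using elim(6) by blast
    have ch2: "continuous_on (dilate (1 + b * (2 * l)) \<Omega>) (\<lambda>x. f x + eig (b * (2 * l)))"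
      by (intro continuous_intros fc elim)
    note sub2 = dilate_subsolution[OF w(2,1) ch2 op\<Omega> b0 s0 eps p, folded \<alpha>_def, unfolded ra]
    note super = discounted_solution[OF elim(2,7) l]
    have ops: "open (dilate s \<Omega>)" using open_dilate[OF _ op\<Omega>] s0 by simp
    have ne: "dilate (1 + t * l) \<Omega> \<noteq> {}" using dilated_domain(3)[OF elim(2)] by blast
    have p1: "p > 1" using p by simp
    have l22: "l\<^sup>2 > 0" using l by simp
    from supersolution_test[OF super(6,1) dilated_domain(2)[OF elim(2)] ne
        sub1(1) ops sub1(2,3) cl sub2(1) ops sub2(2,3) cl eps p1 l22]
    obtain x where x: "x \<in> closure (dilate (1 + t * l) \<Omega>)"
      "f x - l * u_disc t l x \<le> (1/2) *
       (ratio t a l powr (\<alpha> - 2) * (f ((1 / ratio t a l) *\<^sub>R x) - 2 * l * u_disc a (2 * l) ((1 / ratio t a l) *\<^sub>R x)) +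
        ratio t b l powr (\<alpha> - 2) * (f ((1 / ratio t b l) *\<^sub>R x) + eig (b * (2 * l)))) + l\<^sup>2" by blast
    have "(1 / ratio t a l) *\<^sub>R x \<in> dilate (1 + a * (2 * l)) \<Omega>"
      using sub1(4) x(1) cl by blast
    then show ?case using x closure_subset by blast
  qed
qed

lemma ratio_derivative:
  "((\<lambda>l. 1 / ratio t a l) has_real_derivative 2 * a - t) (at 0)"
  "((\<lambda>l. ratio t a l powr \<beta>) has_real_derivative \<beta> * (t - 2 * a)) (at 0)"
  "ratio t a 0 = 1"
proof -
  show r0: "ratio t a 0 = 1" by (simp add: ratio_def)
  have d: "((\<lambda>l. ratio t a l) has_real_derivative t - 2 * a) (at 0)"
    unfolding ratio_def by (auto intro!: derivative_eq_intros)
  show "((\<lambda>l. 1 / ratio t a l) has_real_derivative 2 * a - t) (at 0)"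
    using DERIV_divide[OF DERIV_const d, of 1] r0 by simp
  have "((\<lambda>y. y powr \<beta>) has_real_derivative \<beta> * 1 powr (\<beta> - 1)) (at (ratio t a 0))"
    unfolding r0 by (rule has_real_derivative_powr) simp
  from DERIV_chain2[OF this d] show "((\<lambda>l. ratio t a l powr \<beta>) has_real_derivative \<beta> * (t - 2 * a)) (at 0)" by simp
qed

text \<open>Divided by \<open>l\<close>, the inequality of \<open>comparison_point\<close> becomes \<open>0 \<le> Q\<close> below.  Along a sequence of
contact points converging to \<open>z\<close> every term converges; the derivatives of \<open>f\<close> along the two
dilations and those of the two scaling factors cancel.\<close>

lemma superadditivity:
  "\<exists>z\<in>closure \<Omega>. u a z - b * c' \<le> u (a + b) z"
proof -
  define t where "t = a + b"
  define P where "P = (\<lambda>l x. x \<in> closure (dilate (1 + t * l) \<Omega>) \<and>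
     (1 / ratio t a l) *\<^sub>R x \<in> closure (dilate (1 + a * (2 * l)) \<Omega>) \<and>
     f x - l * u_disc t l x \<le> (1/2) *
       (ratio t a l powr (\<alpha> - 2) * (f ((1 / ratio t a l) *\<^sub>R x) - 2 * l * u_disc a (2 * l) ((1 / ratio t a l) *\<^sub>R x)) +
        ratio t b l powr (\<alpha> - 2) * (f ((1 / ratio t b l) *\<^sub>R x) + eig (b * (2 * l)))) + l\<^sup>2)"
  have "\<forall>\<^sub>F l in at_right 0. (\<exists>x. P l x) \<and> good_radius (1 + t * l)"
    using comparison_point[of a b] at_right_affine[OF good_radius_eventually, of t]
    unfolding P_def t_def[symmetric] by eventually_elim blast
  then obtain \<delta> where \<delta>: "\<delta> > 0" "\<And>l. 0 < l \<Longrightarrow> l < \<delta> \<Longrightarrow> (\<exists>x. P l x) \<and> good_radius (1 + t * l)"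
    unfolding eventually_at_right_field by auto
  define l0 where "l0 = (\<lambda>k::nat. \<delta> / 2 * (1 / real (Suc k)))"
  have l0pos: "l0 k > 0" "l0 k < \<delta>" for k
  proof -
    show "l0 k > 0" using \<delta>(1) by (simp add: l0_def)
    have "\<delta> / 2 * (1 / real (Suc k)) \<le> \<delta> / 2 * 1" using \<delta>(1) by (intro mult_left_mono) auto
    then show "l0 k < \<delta>" unfolding l0_def using \<delta>(1) by linarith
  qed
  have "l0 \<longlonglongrightarrow> \<delta> / 2 * 0" unfolding l0_def by (intro tendsto_intros LIMSEQ_Suc[OF lim_1_over_n])
  then have l0lim: "l0 \<longlonglongrightarrow> 0" by simp
  have "\<forall>k. \<exists>x. P (l0 k) x" using \<delta>(2) l0pos by blast
  from choice[OF this] obtain x0 where x0: "\<And>k. P (l0 k) (x0 k)" by blast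
  obtain R where R: "R > 0" "\<Omega> \<subseteq> cball 0 R" using radius_exists by blast
  have "x0 k \<in> cball 0 (2 * R)" for k
  proof -
    have g: "good_radius (1 + t * l0 k)" using \<delta>(2) l0pos by blast
    have "x0 k \<in> dilate (1 + t * l0 k) (closure \<Omega>)"
      using x0[of k] unfolding P_def closure_dilate by blast
    then obtain w where w: "w \<in> closure \<Omega>" "x0 k = (1 + t * l0 k) *\<^sub>R w" by (auto simp: dilate_def)
    have "closure \<Omega> \<subseteq> cball 0 R" using R by (simp add: closure_minimal)
    then have "norm w \<le> R" using w(1) by auto
    moreover have "\<bar>1 + t * l0 k\<bar> \<le> 2" using g by (simp add: good_radius_def)
    ultimately show ?thesis using w(2) mult_mono[of "\<bar>1 + t * l0 k\<bar>" 2 "norm w" R] by simp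
  qed
  then obtain z \<phi> where \<phi>: "strict_mono \<phi>" and z: "(x0 \<circ> \<phi>) \<longlonglongrightarrow> z"
    using compact_cball[of 0 "2 * R"] unfolding compact_eq_seq_compact_metric seq_compact_def by blast
  define l where "l = l0 \<circ> \<phi>"
  define x where "x = x0 \<circ> \<phi>"
  have l: "l \<longlonglongrightarrow> 0" "\<And>k. l k > 0"
    unfolding l_def using LIMSEQ_subseq_LIMSEQ[OF l0lim \<phi>] l0pos by auto
  then have lne: "l k \<noteq> 0" for k by (metis less_irrefl)
  have x: "x \<longlonglongrightarrow> z" using z by (simp add: x_def)
  have P: "P (l k) (x k)" for k using x0 by (simp add: l_def x_def)
  have l2: "(\<lambda>k. 2 * l k) \<longlonglongrightarrow> 0" "\<And>k. 2 * l k > 0" using tendsto_mult_left[OF l(1), of 2] l(2) by auto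
  define r1 where "r1 = (\<lambda>k. 1 / ratio t a (l k))"
  define r2 where "r2 = (\<lambda>k. 1 / ratio t b (l k))"
  define s1 where "s1 = (\<lambda>k. ratio t a (l k) powr (\<alpha> - 2))"
  define s2 where "s2 = (\<lambda>k. ratio t b (l k) powr (\<alpha> - 2))"
  have qr: "(\<lambda>k. (1 / ratio t c (l k) - 1) / l k) \<longlonglongrightarrow> 2 * c - t" for c
    using difference_quotient_sequence[OF ratio_derivative(1) l(1) lne, of t c] by (simp add: ratio_derivative(3))
  have qs: "(\<lambda>k. (ratio t c (l k) powr (\<alpha> - 2) - 1) / l k) \<longlonglongrightarrow> (\<alpha> - 2) * (t - 2 * c)" for c
    using difference_quotient_sequence[OF ratio_derivative(2) l(1) lne, of t c "\<alpha> - 2"] by (simp add: ratio_derivative(3))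
  have to1: "g \<longlonglongrightarrow> 1" if "(\<lambda>k. (g k - 1) / l k) \<longlonglongrightarrow> D" for g :: "nat \<Rightarrow> real" and D
  proof -
    have "(\<lambda>k. 1 + (g k - 1) / l k * l k) \<longlonglongrightarrow> 1 + D * 0" by (intro tendsto_intros that l)
    then show ?thesis using lne by simp
  qed
  have r1: "(\<lambda>k. (r1 k - 1) / l k) \<longlonglongrightarrow> 2 * a - t" and r2: "(\<lambda>k. (r2 k - 1) / l k) \<longlonglongrightarrow> 2 * b - t"
    and s1: "(\<lambda>k. (s1 k - 1) / l k) \<longlonglongrightarrow> (\<alpha> - 2) * (t - 2 * a)" and s2: "(\<lambda>k. (s2 k - 1) / l k) \<longlonglongrightarrow> (\<alpha> - 2) * (t - 2 * b)"
    unfolding r1_def r2_def s1_def s2_def by (intro qr qs)+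
  have xk: "\<And>k. x k \<in> closure (dilate (1 + t * l k) \<Omega>)" "\<And>k. r1 k *\<^sub>R x k \<in> closure (dilate (1 + a * (2 * l k)) \<Omega>)"
    using P unfolding P_def r1_def by blast+
  have rx: "(\<lambda>k. r1 k *\<^sub>R x k) \<longlonglongrightarrow> z" using tendsto_scaleR[OF to1[OF r1] x] by simp
  have zc: "z \<in> closure \<Omega>" by (rule discounted_limit_up_to_boundary(1)[OF l xk(1) x])
  define V where "V = (\<lambda>k. u_disc t (l k) (x k) + eig 0 / l k)"
  define W where "W = (\<lambda>k. u_disc a (2 * l k) (r1 k *\<^sub>R x k) + eig 0 / (2 * l k))"
  have V: "V \<longlonglongrightarrow> u t z" unfolding V_def by (rule discounted_limit_up_to_boundary(2)[OF l xk(1) x])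
  have W: "W \<longlonglongrightarrow> u a z" unfolding W_def by (rule discounted_limit_up_to_boundary(2)[OF l2 xk(2) rx])
  define E where "E = (\<lambda>k. (eig (b * (2 * l k)) - eig 0) / l k)"
  have E: "E \<longlonglongrightarrow> 2 * b * c'"
  proof -
    have d: "((\<lambda>l. b * (2 * l)) has_real_derivative 2 * b) (at 0)" by (auto intro!: derivative_eq_intros)
    have "(eig has_real_derivative c') (at (b * (2 * 0)))" using c' unfolding eig_def[abs_def] by simp
    from DERIV_chain2[OF this d] have "((\<lambda>l. eig (b * (2 * l))) has_real_derivative c' * (2 * b)) (at 0)" .
    from difference_quotient_sequence[OF this l(1) lne] show ?thesis by (simp add: E_def mult.commute)
  qed
  obtain G where G: "continuous_on U G" "\<And>y. y \<in> U \<Longrightarrow> (f has_derivative (\<lambda>h. G y \<bullet> h)) (at y)"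
    using gradient_exists by blast
  have zU: "z \<in> U" using zc \<Omega>U by blast
  define D1 where "D1 = (\<lambda>k. (f (r1 k *\<^sub>R x k) - f (x k)) / l k)"
  define D2 where "D2 = (\<lambda>k. (f (r2 k *\<^sub>R x k) - f (x k)) / l k)"
  have D1: "D1 \<longlonglongrightarrow> (2 * a - t) * (z \<bullet> G z)" unfolding D1_def
    by (rule radial_difference_quotient[OF opU zU G(2,1) x to1[OF r1] lne r1])
  have D2: "D2 \<longlonglongrightarrow> (2 * b - t) * (z \<bullet> G z)" unfolding D2_def
    by (rule radial_difference_quotient[OF opU zU G(2,1) x to1[OF r2] lne r2])
  have "isCont f z" using has_derivative_continuous[OF G(2)[OF zU]] .
  then have fx: "(\<lambda>k. f (x k)) \<longlonglongrightarrow> f z" using isCont_tendsto_compose x by blast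
  define Q where "Q = (\<lambda>k. (1/2) * s1 k * D1 k + (1/2) * s2 k * D2 k +
     (1/2) * ((s1 k - 1) / l k + (s2 k - 1) / l k) * (f (x k) + eig 0) - s1 k * W k + (1/2) * s2 k * E k + V k + l k)"
  have "0 \<le> Q k" for k
  proof -
    have lk: "l k > 0" by (rule l(2))
    have ineq: "f (x k) - l k * u_disc t (l k) (x k) \<le> (1/2) *
       (s1 k * (f (r1 k *\<^sub>R x k) - 2 * l k * u_disc a (2 * l k) (r1 k *\<^sub>R x k)) +
        s2 k * (f (r2 k *\<^sub>R x k) + eig (b * (2 * l k)))) + (l k)\<^sup>2"
      using P[of k] unfolding P_def r1_def r2_def s1_def s2_def by blast
    have v: "l k * u_disc t (l k) (x k) = l k * V k - eig 0"
      using lk by (simp add: V_def field_simps)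
    have w: "2 * l k * u_disc a (2 * l k) (r1 k *\<^sub>R x k) = 2 * (l k * W k) - eig 0"
      using lk by (simp add: W_def field_simps)
    have e: "eig (b * (2 * l k)) = eig 0 + l k * E k" using lk by (simp add: E_def)
    have f1: "f (r1 k *\<^sub>R x k) = f (x k) + l k * D1 k" using lk by (simp add: D1_def)
    have f2: "f (r2 k *\<^sub>R x k) = f (x k) + l k * D2 k" using lk by (simp add: D2_def)
    define S1 where "S1 = (s1 k - 1) / l k"
    define S2 where "S2 = (s2 k - 1) / l k"
    have s: "s1 k = 1 + l k * S1" "s2 k = 1 + l k * S2" using lk by (auto simp: S1_def S2_def)
    have "0 \<le> (1/2) * (s1 k * (f (x k) + l k * D1 k - (2 * (l k * W k) - eig 0)) +
        s2 k * (f (x k) + l k * D2 k + (eig 0 + l k * E k))) + (l k)\<^sup>2 - (f (x k) - (l k * V k - eig 0))"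
      using ineq unfolding v w e f1 f2 by linarith
    also have "\<dots> = l k * ((1/2) * s1 k * D1 k + (1/2) * s2 k * D2 k +
     (1/2) * (S1 + S2) * (f (x k) + eig 0) - s1 k * W k + (1/2) * s2 k * E k + V k + l k)"
      unfolding s by (simp add: algebra_simps power2_eq_square add_divide_distrib)
    finally have "0 \<le> l k * Q k" by (simp only: Q_def S1_def S2_def)
    then show ?thesis using lk by (simp add: zero_le_mult_iff)
  qed
  moreover have "Q \<longlonglongrightarrow> (1/2) * 1 * ((2 * a - t) * (z \<bullet> G z)) + (1/2) * 1 * ((2 * b - t) * (z \<bullet> G z)) +
     (1/2) * ((\<alpha> - 2) * (t - 2 * a) + (\<alpha> - 2) * (t - 2 * b)) * (f z + eig 0) - 1 * u a z + (1/2) * 1 * (2 * b * c') + u t z + 0"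
    unfolding Q_def
    by (intro tendsto_intros D1 D2 s1 s2 to1[OF s1] to1[OF s2] W E V l fx)
  ultimately have "0 \<le> (1/2) * 1 * ((2 * a - t) * (z \<bullet> G z)) + (1/2) * 1 * ((2 * b - t) * (z \<bullet> G z)) +
     (1/2) * ((\<alpha> - 2) * (t - 2 * a) + (\<alpha> - 2) * (t - 2 * b)) * (f z + eig 0) - 1 * u a z + (1/2) * 1 * (2 * b * c') + u t z + 0"
    by (intro tendsto_lowerbound[of Q _ sequentially 0] always_eventually) auto
  also have "\<dots> = u t z - u a z + b * c'"
    unfolding t_def by (simp add: algebra_simps)
  finally show ?thesis using zc by (intro bexI[of _ z]) (auto simp: t_def)
qed

end

theorem theorem1p4:
  fixes \<epsilon> p \<kappa> c' :: real
    and U \<Omega> :: "(real ^ 'n) set"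
    and f :: "real ^ 'n \<Rightarrow> real"
    and u_disc :: "real \<Rightarrow> real \<Rightarrow> real ^ 'n \<Rightarrow> real"
    and u :: "real \<Rightarrow> real ^ 'n \<Rightarrow> real"
    and C :: "real \<Rightarrow> real"
  assumes "\<epsilon> > 0" and "p > 2"
    and "open U" and "bounded U" and "smooth_boundary U" and "C1_closure U f"
    and "open \<Omega>" and "bounded \<Omega>" and "connected \<Omega>" and "C2_boundary \<Omega>" and "closure \<Omega> \<subseteq> U"
    and "\<forall>x\<in>\<Omega>. closed_segment 0 x \<subseteq> \<Omega>"
    and "\<kappa> > 0" and "cball 0 \<kappa> \<subseteq> \<Omega>"
    and "\<forall>s>0. \<forall>x\<in>dilate (1 + s) (frontier \<Omega>). infdist x (closure \<Omega>) \<ge> \<kappa> * s"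
    and u_disc: "\<forall>\<gamma>. \<forall>\<^sub>F l in at_right 0.
      state_constraint_solution \<epsilon> (hamiltonian p f) l 0 (dilate (1 + \<gamma> * l) \<Omega>) (u_disc \<gamma> l)"
    and u_cont: "\<forall>\<gamma>. continuous_on (closure \<Omega>) (u \<gamma>)"
    and u_limit: "\<forall>\<gamma>. \<forall>e>0. \<forall>\<^sub>F l in at_right 0.
      \<forall>x\<in>closure \<Omega> \<inter> closure (dilate (1 + \<gamma> * l) \<Omega>).
        \<bar>u_disc \<gamma> l x + additive_eigenvalue \<epsilon> (hamiltonian p f) \<Omega> / l - u \<gamma> x\<bar> < e"
    and C: "\<forall>\<gamma>. \<forall>x\<in>closure \<Omega>. C \<gamma> = u \<gamma> x - u 0 x"
    and c': "((\<lambda>\<theta>. additive_eigenvalue \<epsilon> (hamiltonian p f) (dilate (1 + \<theta>) \<Omega>))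
      has_real_derivative c') (at 0)"
  shows "(C has_real_derivative - c') (at 0) \<and>
    (\<forall>\<gamma>. C \<gamma> = - \<gamma> * c') \<and>
    (\<forall>\<gamma>. \<forall>x\<in>closure \<Omega>. u \<gamma> x = u 0 x - \<gamma> * c')"
proof -
  interpret changing_domains \<epsilon> p \<kappa> c' U \<Omega> f u_disc u
    by unfold_locales (use assms in auto)
  have super: "C a - b * c' \<le> C (a + b)" for a b
  proof -
    obtain z where "z \<in> closure \<Omega>" "u a z - b * c' \<le> u (a + b) z" using superadditivity by blast
    then show ?thesis using C by fastforce
  qed
  have "0 \<in> closure \<Omega>" using zero_in closure_subset by blast
  then have "C 0 = 0" using C by auto
  then have eq: "C \<gamma> = - \<gamma> * c'" for \<gamma>
    using super[of 0 \<gamma>] super[of \<gamma> "- \<gamma>"] by simp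
  then have "C = (\<lambda>\<gamma>. - c' * \<gamma>)" by (auto simp: fun_eq_iff)
  then have "(C has_real_derivative - c') (at 0)" by (auto intro!: derivative_eq_intros)
  moreover have "u \<gamma> x = u 0 x - \<gamma> * c'" if "x \<in> closure \<Omega>" for \<gamma> x
    using C eq[of \<gamma>] that by (metis (no_types, opaque_lifting) add_diff_cancel_left' diff_eq_eq minus_mult_left uminus_add_conv_diff add.commute)
  ultimately show ?thesis using eq by blast
qed

end
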